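(* Let $M\ge1$ and $0\le a<M$ be integers, and let $z_0,z_1$ be arbitrary nonzero complex numbers for which the Appell--Lerch sums below are defined. Then \[ D_2(a,M,q)=(-q)^{-\binom{a+1}{2}}\,m\Big(-(-q)^{\binom M2-Ma},(-q)^{M^2},z_0\Big)-(-q)^{-\binom a2}\,m\Big(-(-q)^{\binom M2-M(a-1)},(-q)^{M^2},z_1\Big)+T_{a,M}(q), \] where $T_{a,M}(q)$ is a theta function (in the sense described in the context) which depends on $z_0$ and $z_1$.
   Context: Let $q\in\mathbb{C}$ with $0<|q|<1$. Write $(x;q)_\infty=\prod_{i\ge0}(1-xq^i)$ and $j(x;q)=(x;q)_\infty(q/x;q)_\infty(q;q)_\infty=\sum_{n\in\mathbb{Z}}(-1)^nq^{\binom n2}x^n$. For nonzero $x,z$ and $0<|Q|<1$ with neither $z$ nor $xz$ an integral power of $Q$, the Appell--Lerch sum is $m(x,Q,z)=\frac{1}{j(z;Q)}\sum_{r\in\mathbb{Z}}\frac{(-1)^rQ^{\binom r2}z^r}{1-Q^{r-1}xz}$; here it is used with $Q=(-q)^{M^2}$. For a partition $\lambda$, let $\ell(\lambda)$ be its largest part and $\nu(\lambda)$ its number of parts; the $M_2$-rank of $\lambda$ is $\lceil \ell(\lambda)/2\rceil-\nu(\lambda)$. Let $p_o(n)$ be the number of partitions of $n$ in which no odd part is repeated, and $N_2(a,M;n)$ the number of such partitions of $n$ whose $M_2$-rank is congruent to $a$ modulo $M$. Define \[ D_2(a,M,q)=\sum_{n\ge0}\Big(N_2(a,M;n)-\frac{p_o(n)}{M}\Big)q^n.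 \] "Theta function" means a finite sum of terms $c\,q^{e}\prod_i j(x_i;q^{k_i})^{\pm1}$ with constants $c$ (depending on $M$-th roots of unity, $z_0$, $z_1$), rational $e$, positive integers $k_i$, and $x_i$ of the form (constant)$\cdot q^{s}$ possibly involving $z_0,z_1$. *)

theory Defs
  imports "HOL-Analysis.Analysis" "HOL-Library.Multiset" "HOL-Number_Theory.Cong"
begin

definition qpoch_inf :: "complex \<Rightarrow> complex \<Rightarrow> complex" where
  "qpoch_inf x q = (\<Prod>i. 1 - x * q ^ i)"

definition jtheta :: "complex \<Rightarrow> complex \<Rightarrow> complex" where
  "jtheta x q = qpoch_inf x q * qpoch_inf (q / x) q * qpoch_inf q q"

definition appell_lerch :: "complex \<Rightarrow> complex \<Rightarrow> complex \<Rightarrow> complex" where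
  "appell_lerch x Q z =
     1 / jtheta z Q *
     (\<Sum>\<^sub>\<infinity>r::int. (-1) powi r * Q powi (r * (r - 1) div 2) * z powi r
                   / (1 - Q powi (r - 1) * x * z))"

definition appell_lerch_defined :: "complex \<Rightarrow> complex \<Rightarrow> complex \<Rightarrow> bool" where
  "appell_lerch_defined x Q z \<longleftrightarrow>
     x \<noteq> 0 \<and> z \<noteq> 0 \<and> 0 < norm Q \<and> norm Q < 1 \<and>
     (\<forall>n::int. z \<noteq> Q powi n) \<and> (\<forall>n::int. x * z \<noteq> Q powi n)"

definition partitions_of :: "nat \<Rightarrow> nat multiset set" where
  "partitions_of n = {p. 0 \<notin># p \<and> sum_mset p = n}"

definition odd_parts_distinct :: "nat multiset \<Rightarrow> bool" where
  "odd_parts_distinct p \<longleftrightarrow> (\<forall>k. odd k \<longrightarrow> count p k \<le> 1)"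

text \<open>The inserted 0 gives the empty partition largest part 0, hence \<open>M\<^sub>2\<close>-rank 0.\<close>

definition largest_part :: "nat multiset \<Rightarrow> nat" where
  "largest_part p = Max (insert 0 (set_mset p))"

definition M2_rank :: "nat multiset \<Rightarrow> int" where
  "M2_rank p = \<lceil>real (largest_part p) / 2\<rceil> - int (size p)"

definition p_o :: "nat \<Rightarrow> nat" where
  "p_o n = card {p \<in> partitions_of n. odd_parts_distinct p}"

definition N_2 :: "nat \<Rightarrow> nat \<Rightarrow> nat \<Rightarrow> nat" where
  "N_2 a M n =
     card {p \<in> partitions_of n. odd_parts_distinct p \<and> [M2_rank p = int a] (mod int M)}"

definition D_2 :: "nat \<Rightarrow> nat \<Rightarrow> complex \<Rightarrow> complex" where
  "D_2 a M q = (\<Sum>n. (of_nat (N_2 a M n) - of_nat (p_o n) / of_nat M) * q ^ n)"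

text \<open>
  A theta function is given by a finite expression that does not mention \<open>q\<close>. Its constants
  (\<open>coeff\<close> and \<open>arg_const\<close>) may depend on \<open>z\<^sub>0\<close> and \<open>z\<^sub>1\<close>, but not on \<open>q\<close>; its exponents depend
  on none of the three.
  A factor stands for \<open>j(\<xi> q\<^sup>s; q\<^sup>k)\<close> raised to the power \<open>factor_sign\<close>, which is 1 or -1,
  with \<open>\<xi> = arg_const z\<^sub>0 z\<^sub>1\<close>, \<open>s = arg_exp\<close> and \<open>k = nome_exp\<close>.
\<close>

record theta_factor =
  arg_const :: "complex \<Rightarrow> complex \<Rightarrow> complex"
  arg_exp :: rat
  nome_exp :: nat
  factor_sign :: int

record theta_term =
  coeff :: "complex \<Rightarrow> complex \<Rightarrow> complex"
  q_exp :: rat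
  factors :: "theta_factor list"

definition wf_theta_factor :: "theta_factor \<Rightarrow> bool" where
  "wf_theta_factor f \<longleftrightarrow>
     nome_exp f > 0 \<and> factor_sign f \<in> {1, -1} \<and>
     (\<forall>z0 z1. z0 \<noteq> 0 \<longrightarrow> z1 \<noteq> 0 \<longrightarrow> arg_const f z0 z1 \<noteq> 0)"

text \<open>Rational powers of \<open>q\<close> are taken with respect to a logarithm \<open>w\<close> of \<open>q\<close>.\<close>

definition qpow :: "complex \<Rightarrow> rat \<Rightarrow> complex" where
  "qpow w e = exp (of_rat e * w)"

definition factor_theta :: "complex \<Rightarrow> complex \<Rightarrow> complex \<Rightarrow> theta_factor \<Rightarrow> complex" where
  "factor_theta z0 z1 w f =
     jtheta (arg_const f z0 z1 * qpow w (arg_exp f)) (exp w ^ nome_exp f)"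

definition term_value :: "complex \<Rightarrow> complex \<Rightarrow> complex \<Rightarrow> theta_term \<Rightarrow> complex" where
  "term_value z0 z1 w t =
     coeff t z0 z1 * qpow w (q_exp t) *
     (\<Prod>f\<leftarrow>factors t. factor_theta z0 z1 w f powi factor_sign f)"

text \<open>
  \<open>T z\<^sub>0 z\<^sub>1 q\<close> is a theta function on the set \<open>S\<close> of triples \<open>(z\<^sub>0, z\<^sub>1, q)\<close> if a single
  expression represents it on all of \<open>S\<close>, for every choice of the logarithm of \<open>q\<close>, and no
  denominator of that expression vanishes there. The expression has to be chosen before \<open>q\<close>:
  for one fixed \<open>q\<close> every complex number would be a theta function.
\<close>

definition theta_function_on ::
    "(complex \<times> complex \<times> complex) set \<Rightarrow> (complex \<Rightarrow> complex \<Rightarrow> complex \<Rightarrow> complex) \<Rightarrow> bool" where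
  "theta_function_on S T \<longleftrightarrow>
     (\<exists>ts :: theta_term list.
        (\<forall>t \<in> set ts. \<forall>f \<in> set (factors t). wf_theta_factor f) \<and>
        (\<forall>(z0, z1, q) \<in> S. \<forall>w. exp w = q \<longrightarrow>
           (\<forall>t \<in> set ts. \<forall>f \<in> set (factors t).
              factor_sign f = -1 \<longrightarrow> factor_theta z0 z1 w f \<noteq> 0) \<and>
           T z0 z1 q = (\<Sum>t\<leftarrow>ts. term_value z0 z1 w t)))"

end

theory Submission
  imports Defs "HOL-Complex_Analysis.Complex_Analysis"
begin

text \<open>
  Put \<open>p = - q\<close>, and let \<open>R(y)\<close> be the generating function of partitions without repeated odd parts,
  with \<open>y\<close> marking the \<open>M\<^sub>2\<close>-rank. Summing over \<open>\<lceil>\<ell>(\<lambda>) / 2\<rceil>\<close> gives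
  \<open>R(y) / (1 - y) = \<Sum>N. y ^ N * P\<^sub>N(y)\<close>, where \<open>P\<^sub>N(y)\<close> is a finite product, and the recurrence of the \<open>P\<^sub>N\<close>
  shows that \<open>\<rho>(y) = R(y) / (1 - y)\<close> satisfies \<open>\<rho>(p\<^sup>2 y) = 1 + p y + p y\<^sup>2 \<rho>(y)\<close>. The Appell--Lerch sum
  \<open>\<mu>(y) = m(- y, p, -1)\<close> satisfies the same equation, so \<open>j(y; p) (\<rho>(y) - \<mu>(y))\<close> is invariant under
  \<open>y \<mapsto> p\<^sup>2 y\<close> and free of poles, hence constant; its value is read off at \<open>y = p\<close>, where \<open>\<rho>(p) = 1\<close>.

  The function \<open>D\<^sub>2(a, M, q)\<close> is the average of \<open>\<zeta>\<^bsup>-a\<^esup> R(\<zeta>)\<close> over the \<open>M\<close>-th roots of unity \<open>\<zeta> \<noteq> 1\<close>.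
  Changing \<open>z = -1\<close> into \<open>z = - u\<close> with \<open>u ^ M = \<i>\<close> costs a theta quotient, and then the average of the
  Appell--Lerch sums over all \<open>\<zeta>\<close> can be formed termwise. Splitting the resulting series modulo \<open>M\<close> leaves
  series of nome \<open>p ^ M\<^sup>2\<close> with one common \<open>x\<close> and varying \<open>z\<close>; changing all these \<open>z\<close> into
  \<open>z\<^sub>0\<close> (respectively \<open>z\<^sub>1\<close>) produces theta quotients, and the coefficients of the remaining common
  Appell--Lerch sum add up to a theta series.
\<close>

section \<open>Infinite products and the Jacobi triple product\<close>

text \<open>The series for \<open>\<rho>\<close> is available only inside the unit disc, whereas the
  average needs its value at roots of unity. The functional equation bridges the gap: the difference
  from \<open>\<mu>\<close> is determined in the punctured disc and carried from
  \<open>p\<^sup>2 * y\<close> back to a point \<open>y\<close> of the circle. That equation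
  multiplies \<open>\<rho>\<close> by \<open>p * y\<^sup>2\<close>, exactly what two dilations take
  out of \<open>j(y; p)\<close>; this is why the product is invariant. The change from
  \<open>z = -1\<close> to \<open>z = - u\<close> is forced by the root \<open>\<zeta> = 1\<close>:
  there the series with \<open>z = -1\<close> has a pole, which the vanishing weight
  \<open>1 - \<zeta>\<close> cannot absorb. With \<open>u ^ M = \<i>\<close> the summand is finite
  and enters with weight 0. A further constraint is that one expression has to represent
  \<open>T\<close> for all \<open>q\<close>, with denominators that vanish at no admissible triple.
  Auxiliary arguments that differ from powers of the nome by norm or by a factor \<open>\<i>\<close>
  secure this uniformly in \<open>q\<close>. Finally, the nomes that arise are powers of
  \<open>- q\<close>, whereas admissible factors have nome \<open>q ^ k\<close>; a product identity
  passes from the nome \<open>n\<close> to \<open>n ^ 2\<close> and \<open>n ^ 4\<close>.\<close>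

lemma summable_qpoch: "norm (q::complex) < 1 \<Longrightarrow> summable (\<lambda>i. norm (x * q ^ i))"
  by (simp add: norm_mult norm_power summable_geometric summable_mult)

lemma convergent_prod_qpoch:
  assumes "norm (q::complex) < 1"
  shows "convergent_prod (\<lambda>i. 1 - x * q ^ i)"
  using summable_qpoch[OF assms, of x]
  by (intro abs_convergent_prod_imp_convergent_prod summable_imp_abs_convergent_prod) simp

lemma LIMSEQ_qpoch_inf:
  assumes "norm q < 1"
  shows "(\<lambda>n. \<Prod>i<n. 1 - x * q ^ i) \<longlonglongrightarrow> qpoch_inf x q"
proof -
  have "(\<lambda>n. \<Prod>i\<le>n. 1 - x * q ^ i) \<longlonglongrightarrow> qpoch_inf x q"
    unfolding qpoch_inf_def by (rule convergent_prod_LIMSEQ[OF convergent_prod_qpoch[OF assms]])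
  then show ?thesis
    by (subst (asm) lessThan_Suc_atMost[symmetric])
       (rule LIMSEQ_imp_Suc[where f = "\<lambda>n. \<Prod>i<n. 1 - x * q ^ i"])
qed

lemma qpoch_inf_rec:
  assumes "norm q < 1"
  shows "qpoch_inf x q = (1 - x) * qpoch_inf (x * q) q"
proof -
  have "(\<Prod>i<Suc n. 1 - x * q ^ i) = (1 - x) * (\<Prod>i<n. 1 - x * q * q ^ i)" for n
    by (subst prod.lessThan_Suc_shift) (simp add: mult.assoc)
  moreover have "(\<lambda>n. (1 - x) * (\<Prod>i<n. 1 - x * q * q ^ i)) \<longlonglongrightarrow> (1 - x) * qpoch_inf (x * q) q"
    by (intro tendsto_intros LIMSEQ_qpoch_inf assms)
  ultimately have "(\<lambda>n. \<Prod>i<Suc n. 1 - x * q ^ i) \<longlonglongrightarrow> (1 - x) * qpoch_inf (x * q) q"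
    by simp
  moreover have "(\<lambda>n. \<Prod>i<Suc n. 1 - x * q ^ i) \<longlonglongrightarrow> qpoch_inf x q"
    by (rule LIMSEQ_Suc[OF LIMSEQ_qpoch_inf[OF assms]])
  ultimately show ?thesis
    by (rule LIMSEQ_unique[rotated])
qed

lemma qpoch_inf_eq_0_iff:
  assumes "norm q < 1"
  shows "qpoch_inf x q = 0 \<longleftrightarrow> (\<exists>i. x * q ^ i = 1)"
proof
  assume "\<exists>i. x * q ^ i = 1"
  then obtain i where "x * q ^ i = 1" ..
  then have "eventually (\<lambda>n. (\<Prod>i<n. 1 - x * q ^ i) = 0) sequentially"
    by (intro eventually_sequentiallyI[of "Suc i"]) (auto intro!: bexI[of _ i])
  then have "(\<lambda>n. \<Prod>i<n. 1 - x * q ^ i) \<longlonglongrightarrow> 0"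
    by (rule tendsto_eventually)
  with LIMSEQ_qpoch_inf[OF assms] show "qpoch_inf x q = 0"
    using LIMSEQ_unique by blast
next
  show "qpoch_inf x q = 0 \<Longrightarrow> \<exists>i. x * q ^ i = 1"
    using prodinf_nonzero[OF convergent_prod_qpoch[OF assms, of x]]
    unfolding qpoch_inf_def by force
qed

lemma qpoch_inf_self_nonzero:
  assumes "norm q < 1"
  shows "qpoch_inf q q \<noteq> 0"
proof -
  have "q * q ^ i \<noteq> 1" for i
  proof
    assume "q * q ^ i = 1"
    then have "norm q ^ Suc i = 1"
      by (metis norm_one norm_power power_Suc)
    with assms show False
      using power_Suc_less_one[of "norm q" i] by (cases "q = 0") auto
  qed
  then show ?thesis
    using qpoch_inf_eq_0_iff[OF assms] by blast
qed

text \<open>Sorting the factors by the residue of the index modulo \<open>k\<close>: the first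
  \<open>n * k\<close> factors form \<open>k\<close> blocks of length \<open>n\<close>, and the
  limit is taken block by block.\<close>

lemma qpoch_inf_split:
  assumes "norm q < 1" "k > 0"
  shows "qpoch_inf x q = (\<Prod>r<k. qpoch_inf (x * q ^ r) (q ^ k))"
proof -
  have k: "norm (q ^ k) < 1"
    using assms by (simp add: norm_power power_less_one_iff)
  have "(\<Prod>i<n * k. 1 - x * q ^ i) = (\<Prod>r<k. \<Prod>i<n. 1 - x * q ^ r * (q ^ k) ^ i)" for n
  proof -
    have "(\<Prod>i<n * k. 1 - x * q ^ i) = (\<Prod>i<n. \<Prod>r<k. 1 - x * q ^ (r + i * k))"
      by (simp add: prod.nat_group[symmetric] prod.atLeastLessThan_shift_0[of _ "_ * k"]
           atLeast0LessThan add_ac)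
    also have "\<dots> = (\<Prod>r<k. \<Prod>i<n. 1 - x * q ^ (r + i * k))"
      by (rule prod.swap)
    finally show ?thesis
      by (simp add: power_add power_mult[symmetric] mult_ac)
  qed
  moreover have "(\<lambda>n. \<Prod>i<n * k. 1 - x * q ^ i) \<longlonglongrightarrow> qpoch_inf x q"
    using LIMSEQ_subseq_LIMSEQ[OF LIMSEQ_qpoch_inf[OF assms(1)], of "\<lambda>n. n * k" x] assms(2)
    by (simp add: strict_mono_def o_def)
  moreover have "(\<lambda>n. \<Prod>r<k. \<Prod>i<n. 1 - x * q ^ r * (q ^ k) ^ i) \<longlonglongrightarrow>
      (\<Prod>r<k. qpoch_inf (x * q ^ r) (q ^ k))"
    by (intro tendsto_prod LIMSEQ_qpoch_inf k)
  ultimately show ?thesis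
    using LIMSEQ_unique by simp
qed

text \<open>The partial products are polynomials in the argument and converge uniformly on closed
  discs of radius 1, with a geometric majorant for the deviation of the factors from 1.\<close>

lemma holomorphic_qpoch_inf [holomorphic_intros]:
  assumes "norm q < 1" "f holomorphic_on A"
  shows "(\<lambda>z. qpoch_inf (f z) q) holomorphic_on A"
proof -
  have "(\<lambda>z. qpoch_inf z q) holomorphic_on UNIV"
  proof (rule holomorphic_uniform_sequence)
    show "(\<lambda>z. \<Prod>i<n. 1 - z * q ^ i) holomorphic_on UNIV" for n
      by (intro holomorphic_intros)
    fix x :: complex
    have "uniformly_convergent_on (cball x 1) (\<lambda>N z. \<Prod>i<N. 1 - z * q ^ i)"
    proof (rule uniformly_convergent_on_prod')
      show "uniformly_convergent_on (cball x 1) (\<lambda>N z. \<Sum>n<N. norm (1 - z * q ^ n - 1))"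
      proof (rule Weierstrass_m_test')
        show "summable (\<lambda>i. norm (of_real (norm x + 1) * q ^ i))"
          by (rule summable_qpoch[OF assms(1)])
        fix n z assume "z \<in> cball x 1"
        then have "norm z \<le> norm x + 1"
          using norm_triangle_ineq2[of z x] by (auto simp: dist_norm norm_minus_commute)
        then show "norm (norm (1 - z * q ^ n - 1)) \<le> norm (of_real (norm x + 1) * q ^ n)"
          by (simp add: norm_mult norm_power mult_right_mono del: of_real_add)
      qed
    qed (auto intro!: continuous_intros)
    then obtain g where g: "uniform_limit (cball x 1) (\<lambda>N z. \<Prod>i<N. 1 - z * q ^ i) g sequentially"
      by (auto simp: uniformly_convergent_on_def)
    have "uniform_limit (cball x 1) (\<lambda>N z. \<Prod>i<N. 1 - z * q ^ i) (\<lambda>z. qpoch_inf z q) sequentially"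
      using g
    proof (rule uniform_limit_cong'[THEN iffD1, rotated -1])
      show "g z = qpoch_inf z q" if "z \<in> cball x 1" for z
        using tendsto_uniform_limitI[OF g that] LIMSEQ_qpoch_inf[OF assms(1)] LIMSEQ_unique by blast
    qed auto
    then show "\<exists>d>0. cball x d \<subseteq> UNIV \<and>
        uniform_limit (cball x d) (\<lambda>N z. \<Prod>i<N. 1 - z * q ^ i) (\<lambda>z. qpoch_inf z q) sequentially"
      by (intro exI[of _ 1]) auto
  qed auto
  then have "((\<lambda>z. qpoch_inf z q) \<circ> f) holomorphic_on A"
    by (intro holomorphic_on_compose assms(2)) (auto intro: holomorphic_on_subset)
  then show ?thesis
    by (simp add: o_def)
qed

section \<open>Functional equation, zeros and derivative of the theta product\<close>

lemma jtheta_mult_nome: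
  assumes "norm q < 1" "q \<noteq> 0" "x \<noteq> 0"
  shows "jtheta (q * x) q = - jtheta x q / x"
proof -
  have 1: "qpoch_inf x q = (1 - x) * qpoch_inf (q * x) q"
    using qpoch_inf_rec[OF assms(1), of x] by (simp add: mult.commute)
  have 2: "qpoch_inf (q / (q * x)) q = (1 - 1 / x) * qpoch_inf (q / x) q"
    using qpoch_inf_rec[OF assms(1), of "1 / x"] assms by simp
  show ?thesis
    unfolding jtheta_def 1 2 using assms by (simp add: field_simps)
qed

lemma holomorphic_jtheta [holomorphic_intros]:
  assumes "norm q < 1" "f holomorphic_on A" "\<And>z. z \<in> A \<Longrightarrow> f z \<noteq> 0"
  shows "(\<lambda>z. jtheta (f z) q) holomorphic_on A"
  unfolding jtheta_def using assms by (intro holomorphic_intros) auto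

text \<open>The zeros with \<open>n \<le> 0\<close> come from the factor
  \<open>qpoch_inf x q\<close>, those with \<open>n \<ge> 1\<close> from
  \<open>qpoch_inf (q / x) q\<close>; the third factor never vanishes.\<close>

lemma jtheta_eq_0_iff:
  assumes "norm q < 1" "q \<noteq> 0" "x \<noteq> 0"
  shows "jtheta x q = 0 \<longleftrightarrow> (\<exists>n::int. x = q powi n)"
proof
  assume "jtheta x q = 0"
  then consider i where "x * q ^ i = 1" | i where "q / x * q ^ i = 1"
    using qpoch_inf_self_nonzero[OF assms(1)] qpoch_inf_eq_0_iff[OF assms(1)]
    by (auto simp: jtheta_def)
  then show "\<exists>n::int. x = q powi n"
  proof cases
    case (1 i)
    then have "x = q powi (- int i)"
      using assms by (simp add: power_int_minus field_simps)
    then show ?thesis ..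
  next
    case (2 i)
    then have "x = q powi (int (Suc i))"
      using assms by (simp add: field_simps del: of_nat_Suc)
    then show ?thesis ..
  qed
next
  assume "\<exists>n::int. x = q powi n"
  then obtain n :: int where n: "x = q powi n" ..
  show "jtheta x q = 0"
  proof (cases "n \<le> 0")
    case True
    then have "x * q ^ nat (- n) = 1"
      using n assms by (metis (no_types, lifting) add.right_inverse neg_0_le_iff_le power_int_0_right
          power_int_add power_int_of_nat int_nat_eq)
    then show ?thesis
      using qpoch_inf_eq_0_iff[OF assms(1)] by (auto simp: jtheta_def)
  next
    case False
    then have "q * q ^ nat (n - 1) = x"
      using n assms power_int_add_1'[of q "n - 1"] by (simp add: power_int_def)
    then have "q / x * q ^ nat (n - 1) = 1"
      using assms by (simp add: field_simps)
    then show ?thesis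
      using qpoch_inf_eq_0_iff[OF assms(1)] by (auto simp: jtheta_def)
  qed
qed

text \<open>Splitting off the factor \<open>1 - x\<close> leaves a cofactor equal to
  \<open>qpoch_inf q q ^ 3\<close> at 1. This value is the source of the cubed products in the later
  theta quotients.\<close>

lemma jtheta_has_derivative_1:
  assumes "norm q < 1"
  shows "((\<lambda>x. jtheta x q) has_field_derivative - (qpoch_inf q q ^ 3)) (at 1)"
proof -
  define k where "k x = qpoch_inf (x * q) q * qpoch_inf (q / x) q * qpoch_inf q q" for x
  have "k holomorphic_on (- {0})"
    unfolding k_def by (intro holomorphic_intros assms) auto
  then have "(k has_field_derivative deriv k 1) (at 1)"
    by (rule holomorphic_derivI) auto
  then have "((\<lambda>x. (1 - x) * k x) has_field_derivative - k 1) (at 1)"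
    by (auto intro!: derivative_eq_intros)
  moreover have "(1 - x) * k x = jtheta x q" for x
    using qpoch_inf_rec[OF assms, of x] by (simp add: k_def jtheta_def)
  ultimately show ?thesis
    by (simp add: k_def power3_eq_cube)
qed

text \<open>Dominated convergence for unordered sums: the majorant makes the finite partial sums
  converge uniformly in \<open>n\<close>, so that the two limits may be interchanged.\<close>

lemma tannery_infsum:
  fixes f :: "'a \<Rightarrow> nat \<Rightarrow> 'b :: banach"
  assumes bound: "\<And>x n. x \<in> X \<Longrightarrow> norm (f x n) \<le> M x" and M: "M summable_on X"
    and lim: "\<And>x. x \<in> X \<Longrightarrow> f x \<longlonglongrightarrow> g x"
  shows "(\<lambda>n. \<Sum>\<^sub>\<infinity>x\<in>X. f x n) \<longlonglongrightarrow> (\<Sum>\<^sub>\<infinity>x\<in>X. g x)"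
proof (rule swap_uniform_limit'[where S = UNIV and F = "finite_subsets_at_top X" and g = "sum g"])
  show "uniform_limit UNIV (\<lambda>Y n. \<Sum>x\<in>Y. f x n) (\<lambda>n. \<Sum>\<^sub>\<infinity>x\<in>X. f x n) (finite_subsets_at_top X)"
    by (rule Weierstrass_m_test_general[OF bound M])
  show "\<forall>\<^sub>F Y in finite_subsets_at_top X. (\<lambda>n. \<Sum>x\<in>Y. f x n) \<longlonglongrightarrow> sum g Y"
    using lim by (intro eventually_finite_subsets_at_top_weakI tendsto_sum) auto
  have "norm (g x) \<le> M x" if "x \<in> X" for x
    by (rule tendsto_upperbound[OF tendsto_norm[OF lim[OF that]]]) (use bound that in auto)
  then have "(\<lambda>x. norm (g x)) summable_on X"
    by (rule Infinite_Sum.abs_summable_on_comparison_test'[OF M])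
  then show "(sum g \<longlongrightarrow> (\<Sum>\<^sub>\<infinity>x\<in>X. g x)) (finite_subsets_at_top X)"
    using abs_summable_summable infsum_tendsto by blast
qed auto

lemma summable_on_int_halves:
  fixes f :: "int \<Rightarrow> real"
  assumes "(\<lambda>n. f (int n)) summable_on UNIV" "(\<lambda>n. f (- int n)) summable_on UNIV"
  shows "f summable_on UNIV"
proof -
  have "f summable_on range int"
    using assms(1) summable_on_reindex[of int UNIV f] by (simp add: o_def)
  moreover have "f summable_on range (\<lambda>n. - int n)"
    using assms(2) summable_on_reindex[of "\<lambda>n. - int n" UNIV f] by (simp add: o_def inj_def)
  ultimately have "f summable_on (range int \<union> range (\<lambda>n. - int n))"
    by (rule summable_on_union)
  moreover have "x \<in> range int \<union> range (\<lambda>n. - int n)" for x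
    by (cases x rule: int_cases2) auto
  then have "range int \<union> range (\<lambda>n. - int n) = UNIV"
    by blast
  ultimately show ?thesis
    by simp
qed

section \<open>Terms of the bilateral theta series\<close>

lemma triangular_Suc: "(r + 1) * r div 2 = r * (r - 1) div 2 + (r :: int)"
proof -
  have *: "(r + 1) * r = r * (r - 1) + r * 2"
    by (simp add: algebra_simps)
  show ?thesis
    unfolding * by (subst div_mult_self1) simp_all
qed

definition jtheta_term :: "complex \<Rightarrow> complex \<Rightarrow> int \<Rightarrow> complex" where
  "jtheta_term z q r = (-1) powi r * q powi (r * (r - 1) div 2) * z powi r"

lemma jtheta_term_0 [simp]: "jtheta_term z q 0 = 1"
  by (simp add: jtheta_term_def)

lemma jtheta_term_1 [simp]: "jtheta_term z q 1 = - z"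
  by (simp add: jtheta_term_def)

lemma jtheta_term_Suc:
  assumes "q \<noteq> 0" "z \<noteq> 0"
  shows "jtheta_term z q (r + 1) = - (q powi r * z * jtheta_term z q r)"
  using assms by (simp add: jtheta_term_def triangular_Suc power_int_add)

lemma jtheta_term_pred:
  assumes "q \<noteq> 0" "z \<noteq> 0"
  shows "jtheta_term z q (r - 1) = - jtheta_term z q r / (q powi (r - 1) * z)"
  using jtheta_term_Suc[OF assms, of "r - 1"] assms by simp

text \<open>Reflection swaps the two halves of the bilateral series and turns \<open>z\<close> into
  \<open>q / z\<close>, which reduces estimates to nonnegative indices.\<close>

lemma jtheta_term_minus:
  assumes "q \<noteq> 0" "z \<noteq> 0"
  shows "jtheta_term z q (- r) = jtheta_term (q / z) q r"
proof -
  have "- r * (- r - 1) div 2 = r * (r - 1) div 2 + r"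
    using triangular_Suc[of r] by (simp only: minus_mult_minus mult.commute[of r]
      minus_diff_eq diff_minus_eq_add add.commute[of 1] minus_add_distrib[symmetric]
      diff_conv_add_uminus)
  moreover have "z powi (- r) * q powi r = (q / z) powi r"
    by (simp add: power_int_minus power_int_divide_distrib field_simps)
  ultimately show ?thesis
    unfolding jtheta_term_def using assms
    by (simp add: power_int_add power_int_minus_one_minus mult_ac)
qed

lemma jtheta_term_nonzero: "q \<noteq> 0 \<Longrightarrow> z \<noteq> 0 \<Longrightarrow> jtheta_term z q r \<noteq> 0"
  by (simp add: jtheta_term_def)

text \<open>Successive terms have a ratio of norm \<open>norm z * norm q ^ n\<close>, eventually
  below 1/2, so the ratio test applies to each half.\<close>

lemma abs_summable_jtheta_term:
  assumes q: "norm q < 1" "q \<noteq> 0" and "z \<noteq> 0"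
  shows "(\<lambda>r. norm (jtheta_term z q r)) summable_on UNIV"
proof -
  have half: "(\<lambda>n. norm (jtheta_term z q (int n))) summable_on UNIV" if z: "z \<noteq> 0" for z
  proof -
    have "(\<lambda>n. norm z * norm q ^ n) \<longlonglongrightarrow> norm z * 0"
      using q by (intro tendsto_intros LIMSEQ_power_zero) auto
    then have "eventually (\<lambda>n. norm z * norm q ^ n < 1 / 2) sequentially"
      by (rule order_tendstoD) auto
    then obtain N where N: "norm z * norm q ^ n < 1 / 2" if "n \<ge> N" for n
      by (auto simp: eventually_sequentially)
    have "summable (\<lambda>n. norm (jtheta_term z q (int n)))"
    proof (rule summable_ratio_test)
      fix n assume "n \<ge> N"
      then have "norm z * norm q ^ n * norm (jtheta_term z q (int n))
          \<le> 1 / 2 * norm (jtheta_term z q (int n))"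
        by (intro mult_right_mono less_imp_le[OF N]) auto
      then show "norm (norm (jtheta_term z q (int (Suc n))))
          \<le> 1 / 2 * norm (norm (jtheta_term z q (int n)))"
        using jtheta_term_Suc[OF q(2) z, of "int n"]
        by (simp add: norm_mult norm_power add.commute mult_ac)
    qed auto
    then show ?thesis
      by (intro norm_summable_imp_summable_on) auto
  qed
  have "(\<lambda>n. norm (jtheta_term z q (- int n))) summable_on UNIV"
    using half[of "q / z"] assms by (simp add: jtheta_term_minus)
  with half[OF assms(3)] show ?thesis
    by (intro summable_on_int_halves) auto
qed

section \<open>Finite form of the triple product and its limit\<close>

definition gauss_denom :: "complex \<Rightarrow> nat \<Rightarrow> complex" where
  "gauss_denom q n = (\<Prod>i<n. 1 - q * q ^ i)"

lemma gauss_denom_Suc: "gauss_denom q (Suc n) = gauss_denom q n * (1 - q ^ Suc n)"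
  by (simp add: gauss_denom_def)

lemma gauss_denom_0 [simp]: "gauss_denom q 0 = 1"
  by (simp add: gauss_denom_def)

lemma gauss_denom_nonzero:
  assumes "norm q < 1"
  shows "gauss_denom q n \<noteq> 0"
  using qpoch_inf_self_nonzero[OF assms] qpoch_inf_eq_0_iff[OF assms, of q]
  by (auto simp: gauss_denom_def)

text \<open>The symmetric Gaussian binomial coefficient with upper index \<open>2 N\<close> and lower index \<open>N + k\<close>.\<close>

definition sym_gauss :: "complex \<Rightarrow> nat \<Rightarrow> int \<Rightarrow> complex" where
  "sym_gauss q N k = (if \<bar>k\<bar> \<le> int N then
     gauss_denom q (2 * N) / (gauss_denom q (nat (int N - k)) * gauss_denom q (nat (int N + k))) else 0)"

text \<open>Two q-Pascal steps in one, raising the upper index by 2 while the coefficient stays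
  centred. All four coefficients are put over the denominator
  \<open>gauss_denom q A * gauss_denom q B\<close>, which leaves a polynomial identity.\<close>

lemma sym_gauss_Suc:
  assumes q: "norm q < 1" "q \<noteq> 0"
  shows "sym_gauss q (Suc N) k = (1 + q ^ (2 * N + 1)) * sym_gauss q N k
     + q powi (int N - k + 1) * sym_gauss q N (k - 1) + q powi (int N + k + 1) * sym_gauss q N (k + 1)"
proof (cases "\<bar>k\<bar> \<le> int N + 1")
  case True
  define A B where "A = nat (int N + 1 - k)" and "B = nat (int N + 1 + k)"
  have AB: "int N + 1 - k = int A" "int N + 1 + k = int B" "A + B = 2 * N + 2"
    using True by (auto simp: A_def B_def)
  have nz: "gauss_denom q n \<noteq> 0" for n
    by (rule gauss_denom_nonzero[OF q(1)])
  have F2: "gauss_denom q (2 * Suc N) =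
      gauss_denom q (2 * N) * (1 - q ^ (2 * N + 1)) * (1 - q ^ (2 * N + 2))"
    by (simp add: gauss_denom_Suc)
  have g0: "sym_gauss q N k = gauss_denom q (2 * N) * (1 - q ^ A) * (1 - q ^ B) /
      (gauss_denom q A * gauss_denom q B)"
  proof (cases "A = 0 \<or> B = 0")
    case True
    with AB show ?thesis
      by (auto simp: sym_gauss_def)
  next
    case False
    then obtain a b where "A = Suc a" "B = Suc b"
      by (metis not0_implies_Suc)
    with AB have "nat (int N - k) = a" "nat (int N + k) = b" "\<bar>k\<bar> \<le> int N"
      by auto
    with \<open>A = Suc a\<close> \<open>B = Suc b\<close> nz[of A] nz[of B] show ?thesis
      by (simp add: sym_gauss_def gauss_denom_Suc)
  qed
  have g1: "sym_gauss q N (k - 1) = gauss_denom q (2 * N) * (1 - q ^ B) * (1 - q ^ (B - 1)) /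
      (gauss_denom q A * gauss_denom q B)"
  proof (cases "B = 0 \<or> B = 1")
    case True
    with AB show ?thesis
      by (auto simp: sym_gauss_def)
  next
    case False
    then obtain b where b: "B = Suc (Suc b)"
      by (metis not0_implies_Suc One_nat_def)
    with AB have "nat (int N - (k - 1)) = A" "nat (int N + (k - 1)) = b" "\<bar>k - 1\<bar> \<le> int N"
      by auto
    with b nz[of B] show ?thesis
      by (simp add: sym_gauss_def gauss_denom_Suc)
  qed
  have g2: "sym_gauss q N (k + 1) = gauss_denom q (2 * N) * (1 - q ^ A) * (1 - q ^ (A - 1)) /
      (gauss_denom q A * gauss_denom q B)"
  proof (cases "A = 0 \<or> A = 1")
    case True
    with AB show ?thesis
      by (auto simp: sym_gauss_def)
  next
    case False
    then obtain a where a: "A = Suc (Suc a)"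
      by (metis not0_implies_Suc One_nat_def)
    with AB have "nat (int N - (k + 1)) = a" "nat (int N + (k + 1)) = B" "\<bar>k + 1\<bar> \<le> int N"
      by auto
    with a nz[of A] show ?thesis
      by (simp add: sym_gauss_def gauss_denom_Suc)
  qed
  have g3: "sym_gauss q (Suc N) k = gauss_denom q (2 * N) * ((1 - q ^ (2 * N + 1)) * (1 - q ^ (2 * N + 2))) /
      (gauss_denom q A * gauss_denom q B)"
  proof -
    have "nat (int (Suc N) - k) = A" "nat (int (Suc N) + k) = B" "\<bar>k\<bar> \<le> int (Suc N)"
      using True by (auto simp: A_def B_def add.commute)
    then show ?thesis
      by (simp only: sym_gauss_def F2 if_True mult.assoc)
  qed
  \<comment> \<open>The truncated differences \<open>A - 1\<close> and \<open>B - 1\<close> are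
    harmless at 0, because the factor \<open>1 - q ^ A\<close> or \<open>1 - q ^ B\<close> next to
    them is then 0.\<close>
  have poly: "(1 - q ^ (2 * N + 1)) * (1 - q ^ (2 * N + 2)) =
      (1 + q ^ (2 * N + 1)) * ((1 - q ^ A) * (1 - q ^ B))
      + q ^ A * ((1 - q ^ B) * (1 - q ^ (B - 1))) + q ^ B * ((1 - q ^ A) * (1 - q ^ (A - 1)))"
  proof (cases "A = 0 \<or> B = 0")
    case True
    then show ?thesis
      using AB by (auto simp: algebra_simps power_add)
  next
    case False
    then obtain a b where ab: "A = Suc a" "B = Suc b"
      by (metis not0_implies_Suc)
    then have "2 * N = a + b"
      using AB by simp
    then have pw: "q ^ (2 * N) = q ^ a * q ^ b"
      by (simp only: power_add)
    show ?thesis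
      unfolding ab power_add pw by (simp add: algebra_simps power2_eq_square)
  qed
  have "int N - k + 1 = int A" "int N + k + 1 = int B"
    using AB by auto
  then have "q powi (int N - k + 1) = q ^ A" "q powi (int N + k + 1) = q ^ B"
    by (simp_all only: power_int_of_nat)
  then show ?thesis
    unfolding g0 g1 g2 g3 poly
    by (simp only: times_divide_eq_right add_divide_distrib[symmetric]) (simp add: algebra_simps)
next
  case False
  then show ?thesis
    by (auto simp: sym_gauss_def)
qed

text \<open>Each new pair of factors is a Laurent polynomial in \<open>z\<close> that shifts the
  index by at most 1; absorbing the shifts into neighbouring terms reproduces the recurrence of
  \<open>sym_gauss\<close>.\<close>

lemma finite_jacobi_triple:
  assumes q: "norm q < 1" "q \<noteq> 0" and z: "z \<noteq> 0"
  shows "(\<Prod>i<N. 1 - z * q ^ i) * (\<Prod>i<N. 1 - q / z * q ^ i) =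
    (\<Sum>k\<in>{- int N..int N}. sym_gauss q N k * jtheta_term z q k)"
proof (induction N)
  case 0
  then show ?case
    by (simp add: sym_gauss_def)
next
  case (Suc N)
  let ?t = "jtheta_term z q" and ?g = "sym_gauss q N" and ?S = "{- int N - 1..int N + 1}"
  \<comment> \<open>\<open>sym_gauss\<close> is 0 just outside its range, so the range may be
    widened by 1 on either side to make room for the two shifts.\<close>
  have ext: "(\<Sum>k\<in>{- int N..int N}. ?g k * h k) = (\<Sum>k\<in>?S. ?g k * h k)" for h
    by (rule sum.mono_neutral_left) (auto simp: sym_gauss_def)
  have up: "q powi (int N - k) * ?t (k + 1) = - (z * q ^ N) * ?t k" for k
    using q z by (simp add: jtheta_term_Suc power_int_diff)
  have down: "q powi (int N + k) * ?t (k - 1) = - (q ^ Suc N / z) * ?t k" for k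
    using q z by (simp add: jtheta_term_pred power_int_add power_int_diff)
  have shift_up: "(\<Sum>k\<in>?S. ?g k * (q powi (int N - k) * ?t (k + 1))) =
      (\<Sum>k\<in>?S. ?g (k - 1) * (q powi (int N - k + 1) * ?t k))"
  proof -
    have "(\<Sum>k\<in>?S. ?g (k - 1) * (q powi (int N - k + 1) * ?t k)) =
        (\<Sum>k\<in>{- int N + 1..int N + 1}. ?g (k - 1) * (q powi (int N - k + 1) * ?t k))"
      by (rule sum.mono_neutral_right) (auto simp: sym_gauss_def)
    also have "\<dots> = (\<Sum>k\<in>{- int N..int N}. ?g k * (q powi (int N - k) * ?t (k + 1)))"
      by (rule sum.reindex_bij_witness[of _ "\<lambda>k. k + 1" "\<lambda>k. k - 1"]) (auto simp: diff_diff_eq2 diff_add_eq)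
    finally show ?thesis
      by (simp add: ext)
  qed
  have shift_down: "(\<Sum>k\<in>?S. ?g k * (q powi (int N + k) * ?t (k - 1))) =
      (\<Sum>k\<in>?S. ?g (k + 1) * (q powi (int N + k + 1) * ?t k))"
  proof -
    have "(\<Sum>k\<in>?S. ?g (k + 1) * (q powi (int N + k + 1) * ?t k)) =
        (\<Sum>k\<in>{- int N - 1..int N - 1}. ?g (k + 1) * (q powi (int N + k + 1) * ?t k))"
      by (rule sum.mono_neutral_right) (auto simp: sym_gauss_def)
    also have "\<dots> = (\<Sum>k\<in>{- int N..int N}. ?g k * (q powi (int N + k) * ?t (k - 1)))"
      by (rule sum.reindex_bij_witness[of _ "\<lambda>k. k - 1" "\<lambda>k. k + 1"]) (auto simp: add.assoc)
    finally show ?thesis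
      by (simp add: ext)
  qed
  have step: "?t k * ((1 - z * q ^ N) * (1 - q / z * q ^ N)) = (1 + q ^ (2 * N + 1)) * ?t k +
      q powi (int N - k) * ?t (k + 1) + q powi (int N + k) * ?t (k - 1)" for k
    unfolding up down using z by (simp add: field_simps power_add mult_2 mult_2_right)
  have "(\<Prod>i<Suc N. 1 - z * q ^ i) * (\<Prod>i<Suc N. 1 - q / z * q ^ i) =
      (\<Sum>k\<in>{- int N..int N}. ?g k * ?t k) * ((1 - z * q ^ N) * (1 - q / z * q ^ N))"
    by (simp add: Suc.IH[symmetric])
  also have "\<dots> = (\<Sum>k\<in>?S. ?g k * ((1 + q ^ (2 * N + 1)) * ?t k))
      + (\<Sum>k\<in>?S. ?g k * (q powi (int N - k) * ?t (k + 1)))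
      + (\<Sum>k\<in>?S. ?g k * (q powi (int N + k) * ?t (k - 1)))"
    unfolding ext sum_distrib_right mult.assoc step by (simp add: ring_distribs sum.distrib)
  also have "\<dots> = (\<Sum>k\<in>?S. sym_gauss q (Suc N) k * ?t k)"
    unfolding shift_up shift_down sym_gauss_Suc[OF q]
    by (simp add: ring_distribs sum.distrib mult_ac)
  also have "?S = {- int (Suc N)..int (Suc N)}"
    by auto
  finally show ?case .
qed

text \<open>The limit of the finite form: the coefficients tend to \<open>1 / qpoch_inf q q\<close>
  and are bounded uniformly in \<open>N\<close> and \<open>k\<close>, so dominated convergence
  applies with a multiple of the norms of the theta terms as majorant.\<close>

theorem jacobi_triple_product:
  assumes q: "norm q < 1" "q \<noteq> 0" and z: "z \<noteq> 0"
  shows "(jtheta_term z q has_sum jtheta z q) UNIV"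
proof -
  let ?F = "gauss_denom q" and ?t = "jtheta_term z q"
  have Flim: "?F \<longlonglongrightarrow> qpoch_inf q q"
    unfolding gauss_denom_def[abs_def] by (rule LIMSEQ_qpoch_inf[OF q(1)])
  have nz: "qpoch_inf q q \<noteq> 0" "\<And>n. ?F n \<noteq> 0"
    using qpoch_inf_self_nonzero gauss_denom_nonzero q by auto
  obtain K where K: "norm (?F n) \<le> K" for n
    using convergent_imp_Bseq[OF convergentI[OF Flim]] by (auto simp: Bseq_def)
  \<comment> \<open>The reciprocals are bounded because the limit \<open>qpoch_inf q q\<close> is
    nonzero.\<close>
  obtain L where L: "norm (inverse (?F n)) \<le> L" for n
    using convergent_imp_Bseq[OF convergentI[OF tendsto_inverse[OF Flim nz(1)]]]
    by (auto simp: Bseq_def)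
  have KL: "0 \<le> K" "0 \<le> L"
    using K[of 0] L[of 0] by (auto intro: order_trans[OF norm_ge_zero])
  have bound: "norm (sym_gauss q N k) \<le> K * (L * L)" for N k
    using KL by (auto simp: sym_gauss_def divide_inverse norm_mult intro!: mult_mono K L)
  have lim: "(\<lambda>N. sym_gauss q N k) \<longlonglongrightarrow> 1 / qpoch_inf q q" for k
  proof -
    have sub: "filterlim (\<lambda>N. nat (int N + m)) at_top sequentially" for m
      by (rule filterlim_at_top_mono[OF filterlim_compose[OF filterlim_minus_const_nat_at_top[of "nat \<bar>m\<bar>"] filterlim_ident]])
         (auto intro!: always_eventually)
    have "(\<lambda>N. ?F (2 * N) / (?F (nat (int N + (- k))) * ?F (nat (int N + k)))) \<longlonglongrightarrow>
        qpoch_inf q q / (qpoch_inf q q * qpoch_inf q q)"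
      by (intro tendsto_intros filterlim_compose[OF Flim sub] nz
            LIMSEQ_subseq_LIMSEQ[OF Flim, of "\<lambda>n. 2 * n", unfolded o_def])
         (auto simp: strict_mono_def nz)
    moreover have "eventually (\<lambda>N. sym_gauss q N k =
        ?F (2 * N) / (?F (nat (int N + (- k))) * ?F (nat (int N + k)))) sequentially"
      by (rule eventually_sequentiallyI[of "nat \<bar>k\<bar>"]) (auto simp: sym_gauss_def)
    ultimately show ?thesis
      using nz by (simp add: tendsto_cong)
  qed
  have "(\<lambda>N. \<Sum>\<^sub>\<infinity>k. sym_gauss q N k * ?t k) \<longlonglongrightarrow> (\<Sum>\<^sub>\<infinity>k. 1 / qpoch_inf q q * ?t k)"
  proof (rule tannery_infsum)
    show "(\<lambda>k. K * (L * L) * norm (?t k)) summable_on UNIV"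
      by (intro summable_on_cmult_right abs_summable_jtheta_term assms)
    show "norm (sym_gauss q N k * ?t k) \<le> K * (L * L) * norm (?t k)" for N k
      unfolding norm_mult by (intro mult_right_mono bound) auto
  qed (intro tendsto_intros lim)
  moreover have "(\<Sum>\<^sub>\<infinity>k. sym_gauss q N k * ?t k) =
      (\<Prod>i<N. 1 - z * q ^ i) * (\<Prod>i<N. 1 - q / z * q ^ i)" for N
    unfolding finite_jacobi_triple[OF assms]
    by (rule infsum_finite[THEN trans[rotated], OF _ infsum_cong_neutral])
       (auto simp: sym_gauss_def)
  moreover have "(\<lambda>N. (\<Prod>i<N. 1 - z * q ^ i) * (\<Prod>i<N. 1 - q / z * q ^ i)) \<longlonglongrightarrow>
      qpoch_inf z q * qpoch_inf (q / z) q"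
    by (intro tendsto_intros LIMSEQ_qpoch_inf q)
  ultimately have "qpoch_inf z q * qpoch_inf (q / z) q = (\<Sum>\<^sub>\<infinity>k. 1 / qpoch_inf q q * ?t k)"
    using LIMSEQ_unique by simp
  also have "\<dots> = 1 / qpoch_inf q q * infsum ?t UNIV"
    by (rule infsum_cmult_right')
  finally have "jtheta z q = infsum ?t UNIV"
    using nz by (simp add: jtheta_def field_simps)
  moreover have "?t summable_on UNIV"
    using abs_summable_jtheta_term[OF assms] abs_summable_summable by blast
  ultimately show ?thesis
    by simp
qed

section \<open>Functions multiplicative under dilation by the nome\<close>

text \<open>The points where the functions differ form an open set, and a nonempty open set in the
  plane is uncountable. This extends functional equations that are derived only away from
  poles.\<close>

lemma continuous_eq_off_countable:
  fixes f g :: "complex \<Rightarrow> complex"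
  assumes "open S" "continuous_on S f" "continuous_on S g" "countable C"
    and eq: "\<And>z. z \<in> S - C \<Longrightarrow> f z = g z" and "x \<in> S"
  shows "f x = g x"
proof (rule ccontr)
  assume "f x \<noteq> g x"
  have "open (S \<inter> (\<lambda>z. f z - g z) -` (- {0}))"
    using assms by (intro continuous_open_preimage continuous_intros) auto
  moreover have "x \<in> S \<inter> (\<lambda>z. f z - g z) -` (- {0})"
    using \<open>f x \<noteq> g x\<close> \<open>x \<in> S\<close> by auto
  ultimately obtain e where "e > 0" "ball x e \<subseteq> S \<inter> (\<lambda>z. f z - g z) -` (- {0})"
    by (rule openE)
  moreover have "S \<inter> (\<lambda>z. f z - g z) -` (- {0}) \<subseteq> C"
    using eq by auto
  ultimately have "countable (ball x e)"
    using \<open>countable C\<close> by (meson countable_subset subset_trans)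
  with uncountable_ball[OF \<open>e > 0\<close>, of x] show False
    by simp
qed

lemma holomorphic_on_dilation:
  assumes "f holomorphic_on T" "\<And>z. z \<in> S \<Longrightarrow> q * z \<in> T"
  shows "(\<lambda>z. f (q * z)) holomorphic_on S"
proof -
  have "(\<lambda>z. q * z) holomorphic_on S"
    by (intro holomorphic_intros)
  from holomorphic_on_compose_gen[OF this assms(1)] assms(2) show ?thesis
    by (simp add: o_def image_subset_iff)
qed

lemma ball_dilation:
  assumes "z \<in> ball 0 r" "norm (q :: complex) < 1"
  shows "q * z \<in> ball 0 r"
proof -
  have "norm q * norm z \<le> 1 * norm z"
    using assms by (intro mult_right_mono) auto
  with assms(1) show ?thesis
    by (auto simp: norm_mult)
qed

lemma q_multiplicative_power:
  assumes eq: "\<And>z. z \<in> ball 0 r - {0} \<Longrightarrow> \<psi> (q * z) = \<mu> * \<psi> z"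
    and q: "norm (q::complex) < 1" "q \<noteq> 0" and z: "z \<in> ball 0 r - {0}"
  shows "\<psi> (q ^ n * z) = (\<mu>::complex) ^ n * \<psi> z"
proof (induction n)
  case (Suc n)
  have "norm q ^ n * norm z \<le> 1 * norm z"
    using q by (intro mult_right_mono power_le_one) auto
  then have "norm (q ^ n * z) \<le> norm z"
    by (simp add: norm_mult norm_power)
  then have "q ^ n * z \<in> ball 0 r - {0}"
    using z q by auto
  then show ?case
    using eq[of "q ^ n * z"] Suc.IH by (simp add: mult_ac)
qed auto

text \<open>Every small point is a power of \<open>q\<close> times a point of a compact fundamental
  annulus. Since \<open>norm \<mu> \<le> 1\<close>, the bound on the annulus persists near 0, where
  the singularity is therefore removable.\<close>

lemma q_multiplicative_extend:
  assumes hol: "\<psi> holomorphic_on (ball 0 r - {0})" and r: "r > 0"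
    and eq: "\<And>z. z \<in> ball 0 r - {0} \<Longrightarrow> \<psi> (q * z) = \<mu> * \<psi> z"
    and q: "norm q < 1" "q \<noteq> 0" and \<mu>: "norm \<mu> \<le> 1"
  obtains g where "g holomorphic_on ball 0 r" "\<And>z. z \<in> ball 0 r - {0} \<Longrightarrow> g z = \<psi> z"
    "\<And>z. z \<in> ball 0 r \<Longrightarrow> g (q * z) = \<mu> * g z"
proof -
  define s where "s = r / 2"
  have s: "0 < s" "s < r"
    using r by (auto simp: s_def)
  define A where "A = cball 0 s - ball (0::complex) (norm q * s)"
  have Asub: "A \<subseteq> ball 0 r - {0}"
    using s q by (auto simp: A_def)
  have "compact A"
    unfolding A_def by (intro compact_diff) auto
  moreover have "continuous_on A \<psi>"
    using holomorphic_on_imp_continuous_on[OF hol] Asub continuous_on_subset by blast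
  ultimately have "bounded (\<psi> ` A)"
    by (intro compact_imp_bounded compact_continuous_image)
  then obtain B where B: "norm (\<psi> z) \<le> B" if "z \<in> A" for z
    by (auto simp: bounded_iff)
  have bound: "norm (\<psi> z) \<le> B" if z: "z \<noteq> 0" "norm z < s" for z
  proof -
    have "(\<lambda>n. norm q ^ n * s) \<longlonglongrightarrow> 0 * s"
      using q by (intro tendsto_intros LIMSEQ_power_zero) auto
    then have "eventually (\<lambda>n. norm q ^ n * s < norm z) sequentially"
      by (rule order_tendstoD) (use z in auto)
    then have ex: "\<exists>n. norm q ^ n * s < norm z"
      by (auto simp: eventually_sequentially)
    \<comment> \<open>Minimality of \<open>N\<close> puts \<open>z / q ^ (N - 1)\<close> into the
      annulus \<open>A\<close>.\<close>
    define N where "N = (LEAST n. norm q ^ n * s < norm z)"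
    have N: "norm q ^ N * s < norm z"
      unfolding N_def by (rule LeastI_ex[OF ex])
    with z have "N \<noteq> 0"
      by (intro notI) auto
    then obtain n where n: "N = Suc n"
      by (metis not0_implies_Suc)
    then have "\<not> norm q ^ n * s < norm z"
      using not_less_Least[of n "\<lambda>n. norm q ^ n * s < norm z"] by (simp add: N_def[symmetric])
    then have "z / q ^ n \<in> A"
    proof -
      have "norm q * s * norm q ^ n < norm z" "norm z \<le> s * norm q ^ n"
        using N \<open>\<not> norm q ^ n * s < norm z\<close> by (simp_all add: n mult_ac)
      then show ?thesis
        using q by (simp add: A_def norm_divide norm_power pos_less_divide_eq pos_divide_le_eq not_less
            less_imp_le)
    qed
    moreover have "\<psi> (q ^ n * (z / q ^ n)) = \<mu> ^ n * \<psi> (z / q ^ n)"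
      using Asub \<open>z / q ^ n \<in> A\<close> by (intro q_multiplicative_power[where r = r] eq q) auto
    ultimately have "norm (\<psi> z) \<le> norm \<mu> ^ n * B"
      using q B[of "z / q ^ n"] by (simp add: norm_mult norm_power mult_left_mono)
    also have "\<dots> \<le> 1 * B"
      using \<mu> order_trans[OF norm_ge_zero B[OF \<open>z / q ^ n \<in> A\<close>]]
      by (intro mult_right_mono power_le_one) auto
    finally show ?thesis
      by simp
  qed
  have "eventually (\<lambda>z. norm (\<psi> z) \<le> B) (at 0)"
    unfolding eventually_at using s bound by (intro exI[of _ s]) (auto simp: dist_norm)
  then obtain g where g: "g holomorphic_on ball 0 r" "\<And>z. z \<in> ball 0 r - {0} \<Longrightarrow> g z = \<psi> z"
    using holomorphic_on_extend_bounded[OF hol] r by auto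
  have qz: "q * z \<in> ball 0 r" if "z \<in> ball 0 r" for z
    using that q ball_dilation[OF _ q(1)] by auto
  have "g (q * z) = \<mu> * g z" if "z \<in> ball 0 r" for z
  proof (rule continuous_eq_off_countable[where f = "\<lambda>z. g (q * z)" and g = "\<lambda>z. \<mu> * g z"
        and S = "ball 0 r" and C = "{0}"])
    have "(\<lambda>z. g (q * z)) holomorphic_on ball 0 r"
      using holomorphic_on_dilation[OF g(1)] qz by blast
    then show "continuous_on (ball 0 r) (\<lambda>z. g (q * z))"
      by (rule holomorphic_on_imp_continuous_on)
    show "continuous_on (ball 0 r) (\<lambda>z. \<mu> * g z)"
      by (intro continuous_intros holomorphic_on_imp_continuous_on g)
    show "g (q * z) = \<mu> * g z" if "z \<in> ball 0 r - {0}" for z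
      using g(2)[of z] g(2)[of "q * z"] qz[of z] eq[of z] that q by auto
  qed (use that in auto)
  with g show ?thesis
    using that by blast
qed

lemma q_multiplicative_eq_off_countable:
  fixes \<psi> :: "complex \<Rightarrow> complex"
  assumes hol: "\<psi> holomorphic_on (ball 0 r - {0})"
    and eq: "\<And>z. z \<in> ball 0 r - {0} - C \<Longrightarrow> \<psi> (q * z) = \<mu> * \<psi> z" and C: "countable C"
    and q: "norm q < 1" "q \<noteq> 0" and z: "z \<in> ball 0 r - {0}"
  shows "\<psi> (q * z) = \<mu> * \<psi> z"
proof (rule continuous_eq_off_countable[where f = "\<lambda>z. \<psi> (q * z)" and g = "\<lambda>z. \<mu> * \<psi> z"
      and S = "ball 0 r - {0}" and C = C])
  have qz: "q * z \<in> ball 0 r - {0}" if "z \<in> ball 0 r - {0}" for z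
    using that q ball_dilation[OF _ q(1)] by auto
  have "(\<lambda>z. \<psi> (q * z)) holomorphic_on (ball 0 r - {0})"
    using holomorphic_on_dilation[OF hol] qz by blast
  then show "continuous_on (ball 0 r - {0}) (\<lambda>z. \<psi> (q * z))"
    by (rule holomorphic_on_imp_continuous_on)
  show "continuous_on (ball 0 r - {0}) (\<lambda>z. \<mu> * \<psi> z)"
    by (intro continuous_intros holomorphic_on_imp_continuous_on hol)
qed (use assms in auto)

text \<open>Once extended to 0, the function is constant along \<open>q ^ n * z\<close>, which tends
  to 0; so every value is the value at 0.\<close>

lemma q_periodic_constant:
  fixes \<psi> :: "complex \<Rightarrow> complex"
  assumes hol: "\<psi> holomorphic_on (ball 0 r - {0})"
    and eq: "\<And>z. z \<in> ball 0 r - {0} - C \<Longrightarrow> \<psi> (q * z) = \<psi> z" and C: "countable C"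
    and q: "norm q < 1" "q \<noteq> 0" and r: "r > 0"
    and zw: "z \<in> ball 0 r - {0}" "w \<in> ball 0 r - {0}"
  shows "\<psi> z = \<psi> w"
proof -
  have eq': "\<psi> (q * z) = 1 * \<psi> z" if "z \<in> ball 0 r - {0}" for z
    by (rule q_multiplicative_eq_off_countable[OF hol _ C q that]) (use eq in auto)
  obtain g where g: "g holomorphic_on ball 0 r" "\<And>z. z \<in> ball 0 r - {0} \<Longrightarrow> g z = \<psi> z"
    "\<And>z. z \<in> ball 0 r \<Longrightarrow> g (q * z) = 1 * g z"
    using q_multiplicative_extend[OF hol r eq' q] by auto
  have "g z = g 0" if z: "z \<in> ball 0 r - {0}" for z
  proof -
    have "isCont g 0"
      using holomorphic_on_imp_continuous_on[OF g(1)] r by (simp add: continuous_on_eq_continuous_at)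
    moreover have "(\<lambda>n. q ^ n * z) \<longlonglongrightarrow> 0 * z"
      using q by (intro tendsto_intros LIMSEQ_power_zero) auto
    ultimately have "(\<lambda>n. g (q ^ n * z)) \<longlonglongrightarrow> g 0"
      by (intro isCont_tendsto_compose[of 0 g]) auto
    moreover have "g (q ^ n * z) = 1 ^ n * g z" for n
      by (rule q_multiplicative_power[of r, OF _ q z]) (use g in auto)
    ultimately show ?thesis
      by (simp add: LIMSEQ_const_iff)
  qed
  then show ?thesis
    using g(2) zw by metis
qed

text \<open>Comparison of Taylor coefficients at 0: the one of order \<open>n\<close> is multiplied
  both by \<open>q ^ n\<close> and by the multiplier, which is no power of \<open>q\<close>. A
  preliminary factor \<open>z ^ k\<close> makes the multiplier small enough for the extension to
  0.\<close>

lemma q_multiplicative_eq_0: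
  fixes \<psi> :: "complex \<Rightarrow> complex"
  assumes hol: "\<psi> holomorphic_on (ball 0 r - {0})"
    and eq: "\<And>z. z \<in> ball 0 r - {0} - C \<Longrightarrow> \<psi> (q * z) = \<mu> * \<psi> z" and C: "countable C"
    and q: "norm q < 1" "q \<noteq> 0" and r: "r > 0" and \<mu>: "\<And>n::int. \<mu> \<noteq> q powi n"
    and z: "z \<in> ball 0 r - {0}"
  shows "\<psi> z = 0"
proof -
  have "(\<lambda>k. norm \<mu> * norm q ^ k) \<longlonglongrightarrow> norm \<mu> * 0"
    using q by (intro tendsto_intros LIMSEQ_power_zero) auto
  then have "eventually (\<lambda>k. norm \<mu> * norm q ^ k < 1) sequentially"
    by (rule order_tendstoD) auto
  then obtain k where k: "norm (\<mu> * q ^ k) \<le> 1"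
    by (auto simp: eventually_sequentially norm_mult norm_power intro: less_imp_le)
  have eq': "(q * z) ^ k * \<psi> (q * z) = (\<mu> * q ^ k) * (z ^ k * \<psi> z)" if "z \<in> ball 0 r - {0}" for z
    using q_multiplicative_eq_off_countable[OF hol eq C q that] by (simp add: power_mult_distrib mult_ac)
  have hol': "(\<lambda>z. z ^ k * \<psi> z) holomorphic_on (ball 0 r - {0})"
    by (intro holomorphic_intros hol)
  obtain g where g: "g holomorphic_on ball 0 r"
    "\<And>z. z \<in> ball 0 r - {0} \<Longrightarrow> g z = z ^ k * \<psi> z"
    "\<And>z. z \<in> ball 0 r \<Longrightarrow> g (q * z) = \<mu> * q ^ k * g z"
    using q_multiplicative_extend[OF hol' r eq' q k] by auto
  have "(deriv ^^ n) g 0 = 0" for n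
  proof -
    have qz: "q * z \<in> ball 0 r" if "z \<in> ball 0 r" for z
      using that q ball_dilation[OF _ q(1)] by auto
    have gq: "(\<lambda>z. g (q * z)) holomorphic_on ball 0 r"
      using holomorphic_on_dilation[OF g(1)] qz by blast
    have "(deriv ^^ n) (\<lambda>z. g (q * z)) 0 = q ^ n * (deriv ^^ n) g (q * 0)"
      by (rule higher_deriv_compose_linear[OF g(1), of "ball 0 r"]) (use r qz in auto)
    moreover have "(deriv ^^ n) (\<lambda>z. g (q * z)) 0 = (deriv ^^ n) (\<lambda>z. \<mu> * q ^ k * g z) 0"
      by (rule higher_deriv_transform_within_open[OF gq])
         (use r g in \<open>auto intro!: holomorphic_intros\<close>)
    moreover have "(deriv ^^ n) (\<lambda>z. \<mu> * q ^ k * g z) 0 = \<mu> * q ^ k * (deriv ^^ n) g 0"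
      by (rule higher_deriv_cmult[OF g(1)]) (use r in auto)
    moreover have "\<mu> * q ^ k \<noteq> q ^ n"
    proof
      assume "\<mu> * q ^ k = q ^ n"
      then have "\<mu> = q powi (int n - int k)"
        using q by (simp add: power_int_diff field_simps)
      with \<mu> show False
        by blast
    qed
    ultimately show ?thesis
      by auto
  qed
  then have "g z = 0"
    using holomorphic_fun_eq_0_on_ball[OF g(1)] z by auto
  then show ?thesis
    using g(2)[OF z] z by auto
qed

text \<open>At a zero \<open>a\<close> of the denominator both functions are replaced by their
  difference quotients at \<open>a\<close>, filled in by the derivatives; the quotient of these is
  holomorphic near \<open>a\<close>.\<close>

lemma holomorphic_quotient_simple_zeros:
  assumes f: "f holomorphic_on S" and g: "g holomorphic_on S" and S: "open S"
    and zeros: "\<And>z. z \<in> S \<Longrightarrow> g z = 0 \<Longrightarrow> f z = 0 \<and> deriv g z \<noteq> 0"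
  shows "(\<lambda>z. if g z = 0 then deriv f z / deriv g z else f z / g z) holomorphic_on S"
    (is "?h holomorphic_on S")
proof -
  have "?h field_differentiable (at a)" if a: "a \<in> S" for a
  proof -
    define f1 where "f1 z = (if z = a then deriv f a else (f z - f a) / (z - a))" for z
    define g1 where "g1 z = (if z = a then deriv g a else (g z - g a) / (z - a))" for z
    have f1: "f1 holomorphic_on S" and g1: "g1 holomorphic_on S"
      unfolding f1_def g1_def by (intro pole_lemma_open f g S)+
    show ?thesis
    proof (cases "g a = 0")
      case True
      with zeros a have fa: "f a = 0" and ga: "g1 a \<noteq> 0"
        by (auto simp: g1_def)
      have "open (S \<inter> g1 -` (- {0}))"
        using holomorphic_on_imp_continuous_on[OF g1] S by (intro continuous_open_preimage) auto
      moreover have "a \<in> S \<inter> g1 -` (- {0})"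
        using a ga by auto
      moreover have "(\<lambda>z. f1 z / g1 z) holomorphic_on (S \<inter> g1 -` (- {0}))"
        using f1 g1 by (intro holomorphic_intros) (auto intro: holomorphic_on_subset)
      ultimately have "(\<lambda>z. f1 z / g1 z) field_differentiable (at a)"
        using holomorphic_on_imp_differentiable_at by blast
      then obtain D where D: "((\<lambda>z. f1 z / g1 z) has_field_derivative D) (at a)"
        by (auto simp: field_differentiable_def)
      have "eventually (\<lambda>z. z \<in> S \<inter> g1 -` (- {0})) (nhds a)"
        using \<open>open (S \<inter> g1 -` (- {0}))\<close> \<open>a \<in> S \<inter> g1 -` (- {0})\<close> by (rule eventually_nhds_in_open)
      then have "eventually (\<lambda>z. f1 z / g1 z = ?h z) (nhds a)"
        by eventually_elim (auto simp: f1_def g1_def fa True split: if_splits)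
      from DERIV_cong_ev[OF refl this refl, THEN iffD1, OF D] show ?thesis
        by (auto simp: field_differentiable_def)
    next
      case False
      have "open (S \<inter> g -` (- {0}))"
        using holomorphic_on_imp_continuous_on[OF g] S by (intro continuous_open_preimage) auto
      moreover have "a \<in> S \<inter> g -` (- {0})"
        using a False by auto
      moreover have "(\<lambda>z. f z / g z) holomorphic_on (S \<inter> g -` (- {0}))"
        using f g by (intro holomorphic_intros) (auto intro: holomorphic_on_subset)
      then have "?h holomorphic_on (S \<inter> g -` (- {0}))"
        by (rule holomorphic_transform) auto
      ultimately show ?thesis
        using holomorphic_on_imp_differentiable_at by blast
    qed
  qed
  then show ?thesis
    by (auto simp: holomorphic_on_def field_differentiable_at_within)
qed

section \<open>Theta functions of degree one\<close>

lemma jtheta_mult_powi: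
  assumes "norm q < 1" "q \<noteq> 0" "x \<noteq> 0"
  shows "jtheta (q powi n * x) q = jtheta x q / jtheta_term x q n"
proof (induction n rule: int_induct[where k = 0])
  case base
  then show ?case
    by simp
next
  case (step1 n)
  have "jtheta (q powi (n + 1) * x) q = jtheta (q * (q powi n * x)) q"
    using assms by (simp add: power_int_add mult_ac)
  also have "\<dots> = - jtheta (q powi n * x) q / (q powi n * x)"
    by (rule jtheta_mult_nome) (use assms in auto)
  finally show ?case
    unfolding step1.IH using assms by (simp add: jtheta_term_Suc mult_ac)
next
  case (step2 n)
  have "jtheta (q powi n * x) q = jtheta (q * (q powi (n - 1) * x)) q"
    using assms by (simp add: power_int_diff)
  also have "\<dots> = - jtheta (q powi (n - 1) * x) q / (q powi (n - 1) * x)"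
    by (rule jtheta_mult_nome) (use assms in auto)
  finally show ?case
    unfolding step2.IH using assms jtheta_term_nonzero[of q x n]
    by (simp add: jtheta_term_pred field_simps)
qed

text \<open>A power of the nome carries the zero to 1, where the derivative is known. In the product
  rule the other summand contains \<open>jtheta 1 q = 0\<close>.\<close>

lemma jtheta_deriv_at_zero:
  assumes q: "norm q < 1" "q \<noteq> 0" and c: "c \<noteq> 0" and x: "x = c * q powi n"
  shows "deriv (\<lambda>x. jtheta (x / c) q) x \<noteq> 0"
proof -
  define y where "y = (\<lambda>z. z / (c * q powi n))"
  have eq: "jtheta (z / c) q = jtheta (y z) q * (1 / jtheta_term (y z) q n)" if "z \<noteq> 0" for z
    using jtheta_mult_powi[OF q, of "y z" n] that q c by (simp add: y_def)
  have "x \<noteq> 0"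
    using q c by (simp add: x)
  have "y x = 1"
    using q c by (simp add: x y_def)
  have "((\<lambda>w. jtheta w q) has_field_derivative - (qpoch_inf q q ^ 3)) (at (y x))"
    using jtheta_has_derivative_1[OF q(1)] \<open>y x = 1\<close> by simp
  moreover have "(y has_field_derivative 1 / (c * q powi n)) (at x)"
    unfolding y_def using q c by (auto intro!: derivative_eq_intros)
  ultimately have d1: "((\<lambda>z. jtheta (y z) q) has_field_derivative (- (qpoch_inf q q ^ 3) * (1 / (c * q powi n)))) (at x)"
    by (rule DERIV_chain2)
  have "(\<lambda>z. 1 / jtheta_term (y z) q n) holomorphic_on (- {0})"
    unfolding jtheta_term_def y_def using q c by (intro holomorphic_intros) auto
  then have "((\<lambda>z. 1 / jtheta_term (y z) q n) has_field_derivative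
      deriv (\<lambda>z. 1 / jtheta_term (y z) q n) x) (at x)"
    by (rule holomorphic_derivI) (use \<open>x \<noteq> 0\<close> in auto)
  from DERIV_mult[OF d1 this]
  have "((\<lambda>z. jtheta (y z) q * (1 / jtheta_term (y z) q n)) has_field_derivative
      - (qpoch_inf q q ^ 3) * (1 / (c * q powi n)) * (1 / jtheta_term 1 q n)) (at x)"
    using jtheta_eq_0_iff[OF q, of 1] \<open>y x = 1\<close> by (auto simp: exI[of _ "0::int"])
  moreover have "eventually (\<lambda>z. jtheta (y z) q * (1 / jtheta_term (y z) q n) = jtheta (z / c) q) (nhds x)"
    by (rule eventually_mono[OF eventually_nhds_in_open[of "- {0}"]]) (use \<open>x \<noteq> 0\<close> eq in auto)
  ultimately have "((\<lambda>z. jtheta (z / c) q) has_field_derivative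
      - (qpoch_inf q q ^ 3) * (1 / (c * q powi n)) * (1 / jtheta_term 1 q n)) (at x)"
    by (simp add: DERIV_cong_ev)
  then show ?thesis
    using qpoch_inf_self_nonzero[OF q(1)] jtheta_term_nonzero[of q 1 n] q c
    by (simp add: DERIV_imp_deriv)
qed

text \<open>The equation is that of \<open>jtheta (x * w) q\<close>, whose zeros are
  \<open>1 / w\<close> times powers of \<open>q\<close>; a zero elsewhere is one too many. Division
  by \<open>jtheta (x / x1) q\<close> gives a quotient without poles and with the constant
  multiplier \<open>1 / (x1 * w)\<close>, which is no power of \<open>q\<close>.\<close>

lemma degree_one_eq_0:
  assumes hol: "\<phi> holomorphic_on (- {0})" and q: "norm q < 1" "q \<noteq> 0"
    and eq: "\<And>x. x \<noteq> 0 \<Longrightarrow> \<phi> (q * x) = - \<phi> x / (x * w)"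
    and x1: "\<phi> x1 = 0" "x1 \<noteq> 0" and w: "w \<noteq> 0" "\<And>n::int. x1 * w \<noteq> q powi n"
    and x: "x \<noteq> 0"
  shows "\<phi> x = 0"
proof -
  let ?g = "\<lambda>x. jtheta (x / x1) q"
  have g0: "?g x = 0 \<longleftrightarrow> (\<exists>n::int. x = x1 * q powi n)" if "x \<noteq> 0" for x
    using jtheta_eq_0_iff[OF q, of "x / x1"] that x1 by (auto simp: field_simps)
  \<comment> \<open>The functional equation spreads the zero at \<open>x1\<close> over all zeros of
    the divisor.\<close>
  have \<phi>0: "\<phi> (x1 * q powi n) = 0" for n :: int
  proof (induction n rule: int_induct[where k = 0])
    case (step1 n)
    then show ?case
      using eq[of "x1 * q powi n"] q x1 by (simp add: power_int_add mult_ac)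
  next
    case (step2 n)
    then show ?case
      using eq[of "x1 * q powi (n - 1)"] q x1 w by (simp add: power_int_diff field_simps)
  qed (use x1 in simp)
  define \<psi> where "\<psi> x = (if ?g x = 0 then deriv \<phi> x / deriv ?g x else \<phi> x / ?g x)" for x
  have hol\<psi>: "\<psi> holomorphic_on (- {0})"
    unfolding \<psi>_def
  proof (rule holomorphic_quotient_simple_zeros[OF hol])
    show "?g holomorphic_on - {0}"
      using q x1 by (intro holomorphic_intros) auto
    show "\<phi> z = 0 \<and> deriv ?g z \<noteq> 0" if "z \<in> - {0}" "?g z = 0" for z
      using that g0[of z] \<phi>0 jtheta_deriv_at_zero[OF q x1(2)] by auto
  qed auto
  have "\<psi> x = 0"
  proof (rule q_multiplicative_eq_0[where \<psi> = \<psi> and z = x and r = "norm x + 1" and q = q and \<mu> = "1 / (x1 * w)"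
        and C = "range (\<lambda>n::int. x1 * q powi n)"])
    show "\<psi> holomorphic_on ball 0 (cmod x + 1) - {0}"
      by (rule holomorphic_on_subset[OF hol\<psi>]) auto
    show "\<psi> (q * z) = 1 / (x1 * w) * \<psi> z"
      if "z \<in> ball 0 (cmod x + 1) - {0} - range (\<lambda>n::int. x1 * q powi n)" for z
    proof -
      have "?g z \<noteq> 0"
        using that g0[of z] by auto
      moreover have "?g (q * z) = - ?g z / (z / x1)"
        using jtheta_mult_nome[OF q, of "z / x1"] that x1 by simp
      moreover from calculation have "?g (q * z) \<noteq> 0"
        using that x1 by auto
      moreover have "\<phi> (q * z) = - \<phi> z / (z * w)"
        using eq[of z] that by simp
      ultimately show ?thesis
        using that x1 w by (simp add: \<psi>_def)
    qed
    show "1 / (x1 * w) \<noteq> q powi n" for n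
      using w(2)[of "- n"] q x1 w(1) by (auto simp: power_int_minus field_simps)
  qed (use q x in \<open>auto intro: add_nonneg_pos\<close>)
  then show ?thesis
    using \<phi>0 g0[OF x] by (auto simp: \<psi>_def split: if_splits)
qed

section \<open>Appell--Lerch series\<close>

text \<open>The finite sets \<open>A n\<close> turn the unordered sum into the limit of a sequence
  of holomorphic functions; a local majorant makes this limit locally uniform.\<close>

lemma holomorphic_infsum:
  fixes f :: "'i \<Rightarrow> complex \<Rightarrow> complex" and A :: "nat \<Rightarrow> 'i set"
  assumes A: "filterlim A (finite_subsets_at_top UNIV) sequentially"
    and S: "open S" and hol: "\<And>i. f i holomorphic_on S"
    and bound: "\<And>x. x \<in> S \<Longrightarrow> \<exists>d>0. \<exists>M. cball x d \<subseteq> S \<and> M summable_on UNIV \<and>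
      (\<forall>i. \<forall>w\<in>cball x d. norm (f i w) \<le> M i)"
  shows "(\<lambda>w. \<Sum>\<^sub>\<infinity>i. f i w) holomorphic_on S"
proof (rule holomorphic_uniform_sequence[OF S])
  show "(\<lambda>w. \<Sum>i\<in>A n. f i w) holomorphic_on S" for n
    by (intro holomorphic_intros hol)
  fix x assume "x \<in> S"
  from bound[OF this] obtain d M where d: "d > 0" "cball x d \<subseteq> S"
    and M: "M summable_on UNIV" "\<And>i w. w \<in> cball x d \<Longrightarrow> norm (f i w) \<le> M i"
    by blast
  have "uniform_limit (cball x d) (\<lambda>X w. \<Sum>i\<in>X. f i w) (\<lambda>w. \<Sum>\<^sub>\<infinity>i. f i w) (finite_subsets_at_top UNIV)"
    by (rule Weierstrass_m_test_general[OF M(2) M(1)])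
  from filterlim_compose[OF this A] d
  show "\<exists>d>0. cball x d \<subseteq> S \<and>
      uniform_limit (cball x d) (\<lambda>n w. \<Sum>i\<in>A n. f i w) (\<lambda>w. \<Sum>\<^sub>\<infinity>i. f i w) sequentially"
    by blast
qed

lemma filterlim_int_interval_finite_subsets:
  "filterlim (\<lambda>n. {- int n..int n}) (finite_subsets_at_top UNIV) sequentially"
  unfolding filterlim_finite_subsets_at_top
proof safe
  fix X :: "int set" assume "finite X"
  then obtain B where B: "\<And>x. x \<in> X \<Longrightarrow> \<bar>x\<bar> \<le> B"
    by (metis bdd_above.E finite_imageI bdd_above_finite imageI)
  show "\<forall>\<^sub>F n in sequentially. finite {- int n..int n} \<and> X \<subseteq> {- int n..int n} \<and> {- int n..int n} \<subseteq> UNIV"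
  proof (rule eventually_sequentiallyI[of "nat B"])
    fix n assume "nat B \<le> n"
    then show "finite {- int n..int n} \<and> X \<subseteq> {- int n..int n} \<and> {- int n..int n} \<subseteq> UNIV"
      using B by (fastforce simp: abs_le_iff)
  qed
qed

section \<open>Lambert series and their poles\<close>

lemma norm_power_int_eq_1_imp:
  assumes "norm (q::complex) < 1" "q \<noteq> 0" "norm (q powi n) = 1"
  shows "n = 0"
proof (rule ccontr)
  assume "n \<noteq> 0"
  then have "norm q ^ nat \<bar>n\<bar> < 1"
    using assms(1) by (simp add: power_less_one_iff)
  moreover have "norm q ^ nat \<bar>n\<bar> = 1"
    using assms(3) by (auto simp: norm_power norm_inverse power_int_def power_inverse split: if_splits)
  ultimately show False
    by simp
qed

text \<open>In an annulus \<open>q powi n * w\<close> is small for large \<open>n\<close> and large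
  for very negative \<open>n\<close>, uniformly in \<open>w\<close>; only finitely many denominators
  can come close to 0.\<close>

lemma lambert_denominators_bounded_below:
  assumes q: "norm (q::complex) < 1" "q \<noteq> 0" and "\<alpha> > 0"
  obtains N :: int where
    "\<And>n w. N \<le> \<bar>n\<bar> \<Longrightarrow> \<alpha> \<le> norm w \<Longrightarrow> norm w \<le> \<beta> \<Longrightarrow> 1 / 2 \<le> norm (1 - q powi n * w)"
proof -
  \<comment> \<open>The first bound makes \<open>norm (q powi n * w)\<close> at least 2 for negative
    \<open>n\<close>, the second makes it at most 1/2 for the others.\<close>
  define \<gamma> where "\<gamma> = min (\<alpha> / 2) (1 / (2 * (\<bar>\<beta>\<bar> + 1)))"
  have "\<gamma> > 0"
    using \<open>\<alpha> > 0\<close> by (simp add: \<gamma>_def add_nonneg_pos)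
  moreover have "(\<lambda>n. norm q ^ n) \<longlonglongrightarrow> 0"
    using q by (intro LIMSEQ_power_zero) auto
  ultimately have "eventually (\<lambda>n. norm q ^ n < \<gamma>) sequentially"
    by (rule order_tendstoD(2)[rotated])
  then obtain N where N: "norm q ^ n < \<gamma>" if "n \<ge> N" for n
    by (auto simp: eventually_sequentially)
  show ?thesis
  proof (rule that[of "int N"])
    fix n :: int and w :: complex assume n: "int N \<le> \<bar>n\<bar>" and w: "\<alpha> \<le> norm w" "norm w \<le> \<beta>"
    define k where "k = nat \<bar>n\<bar>"
    have k: "norm q ^ k < \<gamma>"
      using n by (intro N) (simp add: k_def)
    show "1 / 2 \<le> norm (1 - q powi n * w)"
    proof (cases "n \<ge> 0")
      case True
      have "norm q ^ k * norm w \<le> 1 / (2 * (\<bar>\<beta>\<bar> + 1)) * (\<bar>\<beta>\<bar> + 1)"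
        using k w by (intro mult_mono) (auto simp: \<gamma>_def)
      also have "\<dots> = 1 / 2"
        by (simp add: field_simps)
      finally have "norm (q powi n * w) \<le> 1 / 2"
        using True by (simp add: k_def norm_mult norm_power power_int_def)
      then show ?thesis
        using norm_triangle_ineq2[of 1 "q powi n * w"] by simp
    next
      case False
      then have "n = - int k"
        by (simp add: k_def)
      then have "norm (q powi n * w) = norm w / norm q ^ k"
        by (simp add: norm_divide norm_power norm_mult power_int_minus field_simps)
      moreover have "2 * norm q ^ k \<le> norm w"
        using k w by (simp add: \<gamma>_def)
      then have "2 \<le> norm w / norm q ^ k"
        using q by (simp add: field_simps)
      ultimately show ?thesis
        using norm_triangle_ineq2[of "q powi n * w" 1] by (simp add: norm_minus_commute)
    qed
  qed
qed

text \<open>The numerator of the Appell--Lerch sum with \<open>w\<close> for \<open>x * z\<close>.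
  Keeping \<open>w\<close> apart from \<open>z\<close> allows \<open>z\<close> to stay fixed while
  \<open>w\<close> is dilated.\<close>

definition lambert :: "complex \<Rightarrow> complex \<Rightarrow> complex \<Rightarrow> complex" where
  "lambert q z w = (\<Sum>\<^sub>\<infinity>r. jtheta_term z q r / (1 - q powi (r - 1) * w))"

lemma appell_lerch_eq_lambert: "appell_lerch x q z = lambert q z (x * z) / jtheta z q"
  by (simp add: appell_lerch_def lambert_def jtheta_term_def mult.assoc)

text \<open>\<open>jtheta w q / (1 - q powi n * w)\<close> with its removable singularity filled in.\<close>

definition jtheta_quot :: "complex \<Rightarrow> int \<Rightarrow> complex \<Rightarrow> complex" where
  "jtheta_quot q n w = (if 1 - q powi n * w = 0 then deriv (\<lambda>w. jtheta w q) w / deriv (\<lambda>w. 1 - q powi n * w) w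
     else jtheta w q / (1 - q powi n * w))"

text \<open>The product of \<open>jtheta w q\<close> and \<open>lambert q z w\<close>, formed
  termwise so that it also has values at the poles of the latter.\<close>

definition theta_lambert :: "complex \<Rightarrow> complex \<Rightarrow> complex \<Rightarrow> complex" where
  "theta_lambert q z w = (\<Sum>\<^sub>\<infinity>r. jtheta_term z q r * jtheta_quot q (r - 1) w)"

lemma deriv_lambert_denominator: "deriv (\<lambda>w. 1 - q powi n * w) w = - (q powi n)"
  by (rule DERIV_imp_deriv) (auto intro!: derivative_eq_intros)

context
  fixes q :: complex
  assumes q: "norm q < 1" "q \<noteq> 0"
begin

lemma holomorphic_jtheta_quot: "jtheta_quot q n holomorphic_on (- {0})"
  unfolding jtheta_quot_def
proof (rule holomorphic_quotient_simple_zeros)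
  show "(\<lambda>w. jtheta w q) holomorphic_on - {0}"
    using q by (intro holomorphic_intros) auto
  fix w assume "w \<in> - {0}" "1 - q powi n * w = 0"
  then have "w = q powi (- n)"
    using q by (simp add: power_int_minus field_simps)
  then show "jtheta w q = 0 \<and> deriv (\<lambda>w. 1 - q powi n * w) w \<noteq> 0"
    using q jtheta_eq_0_iff[OF q, of w] \<open>w \<in> - {0}\<close> by (auto simp: deriv_lambert_denominator)
qed (auto intro!: holomorphic_intros)

text \<open>The bound is uniform in \<open>n\<close>: for far indices the denominators have norm at
  least 1/2, and the finitely many other quotients are continuous on a compact disc.\<close>

lemma jtheta_quot_bounded:
  assumes "x \<noteq> 0"
  obtains d C where "d > 0" "cball x d \<subseteq> - {0}" "\<And>n w. w \<in> cball x d \<Longrightarrow> norm (jtheta_quot q n w) \<le> C"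
proof -
  define d where "d = norm x / 2"
  have d: "d > 0" "cball x d \<subseteq> - {0}"
    using assms by (auto simp: d_def)
  have w: "d \<le> norm w" "norm w \<le> 3 * d" if "w \<in> cball x d" for w
    using that norm_triangle_ineq2[of x w] norm_triangle_ineq2[of w x]
    by (auto simp: d_def dist_norm norm_minus_commute)
  obtain N :: int where N: "\<And>n w. N \<le> \<bar>n\<bar> \<Longrightarrow> d \<le> norm w \<Longrightarrow> norm w \<le> 3 * d \<Longrightarrow> 1 / 2 \<le> norm (1 - q powi n * w)"
    using lambert_denominators_bounded_below[OF q d(1)] by metis
  have "\<exists>B. \<forall>w\<in>cball x d. norm (f w) \<le> B" if "f holomorphic_on (- {0})" for f :: "complex \<Rightarrow> complex"
  proof -
    have "continuous_on (cball x d) f"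
      using holomorphic_on_imp_continuous_on[OF that] d(2) continuous_on_subset by blast
    then have "bounded (f ` cball x d)"
      by (intro compact_imp_bounded compact_continuous_image) auto
    then show ?thesis
      by (auto simp: bounded_iff)
  qed
  note * = this
  have "(\<lambda>w. jtheta w q) holomorphic_on (- {0})"
    using q by (intro holomorphic_intros) auto
  from *[OF this] obtain B where B: "\<And>w. w \<in> cball x d \<Longrightarrow> norm (jtheta w q) \<le> B"
    by blast
  obtain K where K: "\<And>n w. w \<in> cball x d \<Longrightarrow> norm (jtheta_quot q n w) \<le> K n"
    using *[OF holomorphic_jtheta_quot] by metis
  have Bpos: "0 \<le> B" and Kpos: "\<And>n. 0 \<le> K n"
    using order_trans[OF norm_ge_zero B[of x]] order_trans[OF norm_ge_zero K[of x]] d by auto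
  define C where "C = 2 * B + (\<Sum>n\<in>{- N..N}. K n)"
  have "norm (jtheta_quot q n w) \<le> C" if "w \<in> cball x d" for n w
  proof (cases "N \<le> \<bar>n\<bar>")
    case True
    then have ge: "1 / 2 \<le> norm (1 - q powi n * w)"
      using w[OF that] by (intro N) auto
    then have "1 - q powi n * w \<noteq> 0"
      by auto
    then have "norm (jtheta_quot q n w) = norm (jtheta w q) / norm (1 - q powi n * w)"
      by (simp add: jtheta_quot_def norm_divide)
    also have "\<dots> \<le> B / (1 / 2)"
      using B[OF that] Bpos ge by (intro frac_le) auto
    also have "\<dots> \<le> C"
      using Kpos by (simp add: C_def sum_nonneg)
    finally show ?thesis .
  next
    case False
    have "norm (jtheta_quot q n w) \<le> K n"
      by (rule K[OF that])
    also have "\<dots> \<le> (\<Sum>n\<in>{- N..N}. K n)"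
      using False Kpos by (intro member_le_sum) auto
    also have "\<dots> \<le> C"
      using Bpos by (simp add: C_def)
    finally show ?thesis .
  qed
  with d show ?thesis
    using that by blast
qed

lemma holomorphic_theta_lambert:
  assumes "z \<noteq> 0"
  shows "theta_lambert q z holomorphic_on (- {0})"
  unfolding theta_lambert_def
proof (rule holomorphic_infsum[OF filterlim_int_interval_finite_subsets])
  show "(\<lambda>w. jtheta_term z q r * jtheta_quot q (r - 1) w) holomorphic_on - {0}" for r
    by (intro holomorphic_intros holomorphic_jtheta_quot)
  fix x :: complex assume "x \<in> - {0}"
  then obtain d C where d: "d > 0" "cball x d \<subseteq> - {0}"
    and C: "\<And>n w. w \<in> cball x d \<Longrightarrow> norm (jtheta_quot q n w) \<le> C"
    using jtheta_quot_bounded[of x] by auto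
  have "(\<lambda>r. norm (jtheta_term z q r) * C) summable_on UNIV"
    by (intro summable_on_cmult_left abs_summable_jtheta_term q assms)
  moreover have "norm (jtheta_term z q r * jtheta_quot q (r - 1) w) \<le> norm (jtheta_term z q r) * C"
    if "w \<in> cball x d" for r w
    unfolding norm_mult by (intro mult_left_mono C that) auto
  ultimately show "\<exists>d>0. \<exists>M. cball x d \<subseteq> - {0} \<and> M summable_on UNIV \<and>
      (\<forall>r. \<forall>w\<in>cball x d. norm (jtheta_term z q r * jtheta_quot q (r - 1) w) \<le> M r)"
    using d by blast
qed auto

lemma lambert_denominator_nonzero:
  assumes "\<And>n::int. w \<noteq> q powi n"
  shows "1 - q powi n * w \<noteq> 0"
proof
  assume "1 - q powi n * w = 0"
  then have "w = q powi (- n)"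
    using q by (simp add: power_int_minus field_simps)
  with assms show False
    by blast
qed

lemma theta_lambert_eq:
  assumes "\<And>n::int. w \<noteq> q powi n"
  shows "theta_lambert q z w = jtheta w q * lambert q z w"
  using lambert_denominator_nonzero[OF assms]
  by (simp add: theta_lambert_def lambert_def jtheta_quot_def mult_ac flip: infsum_cmult_right')

lemma abs_summable_lambert:
  assumes "z \<noteq> 0" "w \<noteq> 0" "\<And>n::int. w \<noteq> q powi n"
  shows "(\<lambda>r. norm (jtheta_term z q r / (1 - q powi (r - 1) * w))) summable_on UNIV"
proof -
  obtain d C where "d > 0" and C: "\<And>n w'. w' \<in> cball w d \<Longrightarrow> norm (jtheta_quot q n w') \<le> C"
    using jtheta_quot_bounded[OF assms(2)] by metis
  have nz: "jtheta w q \<noteq> 0"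
    using jtheta_eq_0_iff[OF q assms(2)] assms(3) by auto
  have "(\<lambda>r. norm (jtheta_term z q r) * (C / norm (jtheta w q))) summable_on UNIV"
    by (intro summable_on_cmult_left abs_summable_jtheta_term q assms)
  moreover have "norm (jtheta_term z q r / (1 - q powi (r - 1) * w)) \<le>
      norm (jtheta_term z q r) * (C / norm (jtheta w q))" for r
  proof -
    have "norm (jtheta w q) / norm (1 - q powi (r - 1) * w) \<le> C"
      using C[of w "r - 1"] \<open>d > 0\<close> lambert_denominator_nonzero[OF assms(3), of "r - 1"]
      by (simp add: jtheta_quot_def norm_divide)
    then have "1 / norm (1 - q powi (r - 1) * w) \<le> C / norm (jtheta w q)"
      using nz by (simp add: field_simps)
    from mult_left_mono[OF this, of "norm (jtheta_term z q r)"] show ?thesis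
      by (simp add: norm_divide)
  qed
  ultimately show ?thesis
    by (intro Infinite_Sum.abs_summable_on_comparison_test') auto
qed

lemma has_sum_lambert:
  assumes "z \<noteq> 0" "w \<noteq> 0" "\<And>n::int. w \<noteq> q powi n"
  shows "((\<lambda>r. jtheta_term z q r / (1 - q powi (r - 1) * w)) has_sum lambert q z w) UNIV"
  unfolding lambert_def
  by (intro has_sum_infsum abs_summable_summable[OF abs_summable_lambert[OF assms]])

text \<open>A shifted theta term and a multiple of the next Lambert term combine over one
  denominator, because consecutive theta terms differ by the factor
  \<open>- q powi (r - 1) * z\<close>.\<close>

lemma lambert_mult_nome:
  assumes z: "z \<noteq> 0" and w: "w \<noteq> 0" "\<And>n::int. w \<noteq> q powi n"
  shows "lambert q z (q * w) = jtheta z q - w / z * lambert q z w"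
proof -
  have "((\<lambda>r. jtheta_term z q (r - 1)) has_sum jtheta z q) UNIV"
    by (rule has_sum_reindex_bij_witness[of _ "\<lambda>r. r + 1" "\<lambda>r. r - 1", THEN iffD2,
          OF _ _ _ _ _ _ jacobi_triple_product[OF q z]]) auto
  from has_sum_add[OF this has_sum_cmult_right[OF has_sum_lambert[OF assms], of "- (w / z)"]]
  have "((\<lambda>r. jtheta_term z q (r - 1) + - (w / z) * (jtheta_term z q r / (1 - q powi (r - 1) * w)))
      has_sum (jtheta z q - w / z * lambert q z w)) UNIV"
    by simp
  moreover have "jtheta_term z q (r - 1) + - (w / z) * (jtheta_term z q r / (1 - q powi (r - 1) * w)) =
      jtheta_term z q (r - 1) / (1 - q powi (r - 1) * w)" for r
  proof -
    define v where "v = q powi (r - 1)"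
    have "1 - v * w \<noteq> 0" "v \<noteq> 0"
      using lambert_denominator_nonzero[OF w(2), of "r - 1"] q by (auto simp: v_def)
    then show ?thesis
      unfolding jtheta_term_pred[OF q(2) z] v_def[symmetric] using z w(1) by (simp add: divide_simps) algebra
  qed
  ultimately have "((\<lambda>r. jtheta_term z q (r - 1) / (1 - q powi (r - 1) * w))
      has_sum (jtheta z q - w / z * lambert q z w)) UNIV"
    by simp
  also have "?this \<longleftrightarrow> ((\<lambda>r. jtheta_term z q r / (1 - q powi (r - 1) * (q * w)))
      has_sum (jtheta z q - w / z * lambert q z w)) UNIV"
    by (rule has_sum_reindex_bij_witness[of _ "\<lambda>r. r + 1" "\<lambda>r. r - 1"])
       (use q in \<open>auto simp: power_int_diff power2_eq_square\<close>)
  finally show ?thesis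
    unfolding lambert_def by (rule infsumI)
qed

text \<open>At a zero of \<open>jtheta\<close> only the summand with a vanishing denominator
  survives.\<close>

lemma theta_lambert_at_power:
  "theta_lambert q z (q powi m) = jtheta_term z q (1 - m) * jtheta_quot q (- m) (q powi m)"
proof -
  have "jtheta_quot q (r - 1) (q powi m) = 0" if "r \<noteq> 1 - m" for r
  proof -
    have "q powi (r - 1) * q powi m \<noteq> 1"
    proof
      assume "q powi (r - 1) * q powi m = 1"
      then have "norm (q powi (r - 1 + m)) = 1"
        using q by (simp add: power_int_add)
      then show False
        using norm_power_int_eq_1_imp[OF q, of "r - 1 + m"] that by auto
    qed
    moreover have "jtheta (q powi m) q = 0"
      using jtheta_eq_0_iff[OF q] q by auto
    ultimately show ?thesis
      by (simp add: jtheta_quot_def)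
  qed
  then have "(\<Sum>\<^sub>\<infinity>r. jtheta_term z q r * jtheta_quot q (r - 1) (q powi m)) =
      (\<Sum>\<^sub>\<infinity>r\<in>{1 - m}. jtheta_term z q r * jtheta_quot q (r - 1) (q powi m))"
    by (intro infsum_cong_neutral) auto
  then show ?thesis
    by (simp add: theta_lambert_def)
qed

lemma theta_lambert_1: "theta_lambert q z 1 = - z * qpoch_inf q q ^ 3"
  using theta_lambert_at_power[of z 0] deriv_lambert_denominator[of 0]
    DERIV_imp_deriv[OF jtheta_has_derivative_1[OF q(1)]]
  by (simp add: jtheta_quot_def)

text \<open>The surviving index is \<open>r = 0\<close>, whose theta term is 1, so the value is
  independent of \<open>z\<close>. The derivative at \<open>q\<close> comes from the one at 1
  through \<open>j(y) = - j(y / q) * q / y\<close>.\<close>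

lemma theta_lambert_nome: "theta_lambert q z q = - (qpoch_inf q q ^ 3)"
proof -
  have "((\<lambda>y. y / q) has_field_derivative 1 / q) (at q)"
    using q by (auto intro!: derivative_eq_intros)
  moreover have "((\<lambda>w. jtheta w q) has_field_derivative - (qpoch_inf q q ^ 3)) (at (q / q))"
    using jtheta_has_derivative_1[OF q(1)] q by simp
  ultimately have "((\<lambda>y. jtheta (y / q) q) has_field_derivative - (qpoch_inf q q ^ 3) * (1 / q)) (at q)"
    by (rule DERIV_chain2[rotated])
  then have "((\<lambda>y. - (jtheta (y / q) q * (q / y))) has_field_derivative qpoch_inf q q ^ 3 / q) (at q)"
    using q jtheta_eq_0_iff[OF q, of 1] by (auto intro!: derivative_eq_intros exI[of _ "0::int"])
  moreover have "eventually (\<lambda>y. - (jtheta (y / q) q * (q / y)) = jtheta y q) (nhds q)"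
  proof (rule eventually_mono[OF eventually_nhds_in_open[of "- {0}"]])
    fix y :: complex assume "y \<in> - {0}"
    then show "- (jtheta (y / q) q * (q / y)) = jtheta y q"
      using jtheta_mult_nome[OF q, of "y / q"] q by simp
  qed (use q in auto)
  ultimately have "((\<lambda>y. jtheta y q) has_field_derivative qpoch_inf q q ^ 3 / q) (at q)"
    by (simp add: DERIV_cong_ev)
  then have "deriv (\<lambda>y. jtheta y q) q = qpoch_inf q q ^ 3 / q"
    by (rule DERIV_imp_deriv)
  then show ?thesis
    using theta_lambert_at_power[of z 1] deriv_lambert_denominator[of "-1"] q
    by (simp add: jtheta_quot_def power_int_minus)
qed

text \<open>Both sides, cleared of denominators, are theta functions of degree one in \<open>x\<close>; they agree
  at \<open>x = 1 / z1\<close>, hence everywhere.\<close>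

theorem lambert_change_z:
  assumes z0: "z0 \<noteq> 0" "\<And>n::int. z0 \<noteq> q powi n" and z1: "z1 \<noteq> 0" and x: "x \<noteq> 0"
    and x0: "\<And>n::int. x * z0 \<noteq> q powi n" and x1: "\<And>n::int. x * z1 \<noteq> q powi n"
  shows "lambert q z1 (x * z1) * jtheta z0 q - lambert q z0 (x * z0) * jtheta z1 q =
    - z1 * qpoch_inf q q ^ 3 * jtheta (z0 / z1) q * jtheta (x * z0 * z1) q /
      (jtheta (x * z0) q * jtheta (x * z1) q)"
proof -
  let ?j = "\<lambda>x. jtheta x q"
  define C where "C = - z1 * qpoch_inf q q ^ 3 * ?j (z0 / z1)"
  define \<phi> where "\<phi> x = theta_lambert q z1 (x * z1) * ?j (x * z0) * ?j z0
     - theta_lambert q z0 (x * z0) * ?j (x * z1) * ?j z1 - C * ?j (x * z0 * z1)" for x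
  let ?L = "\<lambda>x. lambert q z1 (x * z1) * ?j z0 - lambert q z0 (x * z0) * ?j z1"
  \<comment> \<open>Off \<open>P\<close> both Lambert series are free of poles and the functional
    equations apply; \<open>P\<close> is countable, so continuity covers the rest.\<close>
  define P where "P = range (\<lambda>n::int. q powi n / z0) \<union> range (\<lambda>n::int. q powi n / z1)"
  have P: "x * z0 \<noteq> q powi n" "x * z1 \<noteq> q powi n" if "x \<notin> P" for x n
    using that z0 z1 by (auto simp: P_def field_simps)
  have \<phi>_eq: "\<phi> x = ?L x * ?j (x * z0) * ?j (x * z1) - C * ?j (x * z0 * z1)"
    if "\<And>n::int. x * z0 \<noteq> q powi n" "\<And>n::int. x * z1 \<noteq> q powi n" for x
    by (simp add: \<phi>_def theta_lambert_eq that algebra_simps)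
  have scaled: "(\<lambda>x. theta_lambert q z (x * z')) holomorphic_on - {0}" if "z \<noteq> 0" "z' \<noteq> 0" for z z'
    using holomorphic_on_dilation[OF holomorphic_theta_lambert[OF that(1)], of "- {0}" z'] that(2)
    by (simp add: mult.commute)
  have hol: "\<phi> holomorphic_on (- {0})"
    unfolding \<phi>_def using q z0 z1 by (intro holomorphic_intros scaled) auto
  have "\<phi> x = 0"
  proof (rule degree_one_eq_0[OF hol q])
    show "\<phi> (q * x) = - \<phi> x / (x * (z0 * z1))" if "x \<noteq> 0" for x
    proof (rule continuous_eq_off_countable[where f = "\<lambda>x. \<phi> (q * x)"
          and g = "\<lambda>x. - \<phi> x / (x * (z0 * z1))" and S = "- {0}" and C = P])
      show "continuous_on (- {0}) (\<lambda>x. \<phi> (q * x))"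
        using q by (intro holomorphic_on_imp_continuous_on holomorphic_on_dilation[OF hol]) auto
      show "continuous_on (- {0}) (\<lambda>x. - \<phi> x / (x * (z0 * z1)))"
        using z0 z1 by (intro continuous_intros holomorphic_on_imp_continuous_on[OF hol]) auto
      show "countable P"
        by (auto simp: P_def)
      fix x assume x: "x \<in> - {0} - P"
      have qP: "q * x * z0 \<noteq> q powi n" "q * x * z1 \<noteq> q powi n" for n
        using P[of x "n - 1"] x q by (auto simp: power_int_diff field_simps)
      have xnz: "x \<noteq> 0"
        using x by simp
      \<comment> \<open>The inhomogeneous terms \<open>jtheta z1 q\<close> and
        \<open>jtheta z0 q\<close> cancel in the cross difference, so a homogeneous relation
        remains.\<close>
      have L: "?L (q * x) = - x * ?L x"
      proof -
        have "lambert q z1 (q * x * z1) = ?j z1 - x * lambert q z1 (x * z1)"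
          "lambert q z0 (q * x * z0) = ?j z0 - x * lambert q z0 (x * z0)"
          using lambert_mult_nome[of z1 "x * z1"] lambert_mult_nome[of z0 "x * z0"] P[of x] x z0 z1
          by (simp_all add: mult.assoc)
        note * = this
        show ?thesis
          unfolding * by (simp add: algebra_simps)
      qed
      have j: "?j (q * x * z0) = - ?j (x * z0) / (x * z0)" "?j (q * x * z1) = - ?j (x * z1) / (x * z1)"
        "?j (q * x * z0 * z1) = - ?j (x * z0 * z1) / (x * z0 * z1)"
        using jtheta_mult_nome[OF q, of "x * z0"] jtheta_mult_nome[OF q, of "x * z1"]
          jtheta_mult_nome[OF q, of "x * z0 * z1"] x z0 z1 by (simp_all add: mult.assoc)
      have "\<phi> (q * x) = - x * ?L x * (- ?j (x * z0) / (x * z0)) * (- ?j (x * z1) / (x * z1))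
          - C * (- ?j (x * z0 * z1) / (x * z0 * z1))"
        unfolding \<phi>_eq[OF qP] L j ..
      also have "\<dots> = - (?L x * ?j (x * z0) * ?j (x * z1) - C * ?j (x * z0 * z1)) / (x * (z0 * z1))"
        using xnz z0 z1 by (simp add: divide_simps)
      also have "\<dots> = - \<phi> x / (x * (z0 * z1))"
        using P[of x] x by (subst \<phi>_eq) auto
      finally show "\<phi> (q * x) = - \<phi> x / (x * (z0 * z1))" .
    qed (use that in auto)
    \<comment> \<open>Here \<open>x * z1 = 1\<close>: the second summand contains
      \<open>jtheta 1 q = 0\<close>, and \<open>theta_lambert_1\<close> evaluates the first. This is
      the origin of the constant \<open>C\<close>.\<close>
    show "\<phi> (1 / z1) = 0"
      using z1 z0 theta_lambert_1[of z1] jtheta_eq_0_iff[OF q, of 1]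
      by (auto simp: \<phi>_def C_def exI[of _ "0::int"])
    show "1 / z1 * (z0 * z1) \<noteq> q powi n" for n
      using z0 z1 by simp
  qed (use z0 z1 x in auto)
  moreover have "?j (x * z0) \<noteq> 0" "?j (x * z1) \<noteq> 0"
    using jtheta_eq_0_iff[OF q] x z0 z1 x0 x1 by auto
  ultimately show ?thesis
    using \<phi>_eq[OF x0 x1] by (simp add: C_def field_simps)
qed

end

section \<open>The functional equation of the rank generating function\<close>

text \<open>From \<open>1 + t \<le> exp t\<close> and the geometric series, which makes the bound
  independent of \<open>n\<close>.\<close>

lemma norm_qpoch_le:
  fixes q x :: complex
  assumes "norm q < 1"
  shows "norm (\<Prod>i<n. 1 - x * q ^ i) \<le> exp (norm x / (1 - norm q))"
proof -
  have "norm (\<Prod>i<n. 1 - x * q ^ i) \<le> (\<Prod>i<n. exp (norm (x * q ^ i)))"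
    unfolding prod_norm[symmetric]
  proof (rule prod_mono)
    fix i
    have "norm (1 - x * q ^ i) \<le> 1 + norm (x * q ^ i)"
      using norm_triangle_ineq4[of 1 "x * q ^ i"] by simp
    also have "\<dots> \<le> exp (norm (x * q ^ i))"
      by (rule exp_ge_add_one_self)
    finally show "0 \<le> norm (1 - x * q ^ i) \<and> norm (1 - x * q ^ i) \<le> exp (norm (x * q ^ i))"
      by simp
  qed
  also have "\<dots> = exp (\<Sum>i<n. norm (x * q ^ i))"
    by (simp add: exp_sum)
  also have "(\<Sum>i<n. norm (x * q ^ i)) \<le> (\<Sum>i. norm (x * q ^ i))"
    by (intro sum_le_suminf summable_qpoch assms) auto
  also have "(\<Sum>i. norm (x * q ^ i)) = norm x / (1 - norm q)"
    using assms by (simp add: norm_mult norm_power suminf_mult summable_geometric suminf_geometric)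
  finally show ?thesis
    by simp
qed

lemma norm_qpoch_inf_le:
  assumes "norm q < 1"
  shows "norm (qpoch_inf x q) \<le> exp (norm x / (1 - norm q))"
  using tendsto_upperbound[OF tendsto_norm[OF LIMSEQ_qpoch_inf[OF assms, of x]], of "exp (norm x / (1 - norm q))"]
    norm_qpoch_le[OF assms, of x] by simp

lemma qpoch_inf_split_2: "norm q < 1 \<Longrightarrow> qpoch_inf x q = qpoch_inf x (q\<^sup>2) * qpoch_inf (x * q) (q\<^sup>2)"
  using qpoch_inf_split[of q 2 x] by (simp add: numeral_2_eq_2)

lemma qpoch_inf_initial:
  assumes "norm q < 1"
  shows "qpoch_inf x q = (\<Prod>i<n. 1 - x * q ^ i) * qpoch_inf (x * q ^ n) q"
proof (induction n)
  case (Suc n)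
  then show ?case
    using qpoch_inf_rec[OF assms, of "x * q ^ n"] by (simp add: mult_ac)
qed simp

text \<open>The generating function of partitions into parts of size at most \<open>2 N\<close> without repeated odd
  parts, at \<open>q = - p\<close>, with \<open>1 / y\<close> marking the number of parts.\<close>

definition bounded_gf :: "complex \<Rightarrow> nat \<Rightarrow> complex \<Rightarrow> complex" where
  "bounded_gf p N y = (\<Prod>i<N. 1 - p / y * (p\<^sup>2) ^ i) / (\<Prod>i<N. 1 - p\<^sup>2 / y * (p\<^sup>2) ^ i)"

text \<open>\<open>bounded_gf p N y\<close> multiplied by \<open>(p\<^sup>2/y; p\<^sup>2)\<^sub>\<infinity>\<close>, which removes its poles.\<close>

definition cleared_gf :: "complex \<Rightarrow> nat \<Rightarrow> complex \<Rightarrow> complex" where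
  "cleared_gf p N y = (\<Prod>i<N. 1 - p / y * (p\<^sup>2) ^ i) * qpoch_inf (p\<^sup>2 / y * (p\<^sup>2) ^ N) (p\<^sup>2)"

definition cleared_sum :: "complex \<Rightarrow> complex \<Rightarrow> complex" where
  "cleared_sum p y = (\<Sum>N. y ^ N * cleared_gf p N y)"

text \<open>Only the power of \<open>y\<close> is dilated, not the argument of
  \<open>cleared_gf\<close>. As that factor is bounded in \<open>N\<close>, the series converges for
  \<open>norm (p\<^sup>2 * y) < 1\<close>, a region that contains the unit circle.\<close>

definition cleared_sum' :: "complex \<Rightarrow> complex \<Rightarrow> complex" where
  "cleared_sum' p y = (\<Sum>N. (p\<^sup>2 * y) ^ N * cleared_gf p N y)"

text \<open>For \<open>norm y < 1\<close> this is \<open>(1 - y) * (\<Sum>N. y ^ N * bounded_gf p N y)\<close>; the present form also makes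
  sense on the unit circle, where that series diverges.\<close>

definition rank_series :: "complex \<Rightarrow> complex \<Rightarrow> complex" where
  "rank_series p y = 1 - 1 / y + (1 / y - p) * cleared_sum' p y / cleared_gf p 0 y"

section \<open>Convergence and recurrences of the cleared sums\<close>

context
  fixes p :: complex
  assumes p: "norm p < 1" "p \<noteq> 0"
begin

lemma norm_p2: "norm (p\<^sup>2) < 1"
  using p by (simp add: norm_power power_less_one_iff)

lemma norm_cleared_gf_le:
  "norm (cleared_gf p N y) \<le> exp (2 / (norm y * (1 - norm (p\<^sup>2))))"
proof (cases "y = 0")
  \<comment> \<open>Division by zero gives 0, so every factor is 1 and the bound reads
    \<open>exp 0\<close>.\<close>
  case True
  then show ?thesis
    using norm_qpoch_inf_le[OF norm_p2, of 0] by (simp add: cleared_gf_def)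
next
  case False
  have le: "exp (norm x / (1 - norm (p\<^sup>2))) \<le> exp (1 / (norm y * (1 - norm (p\<^sup>2))))"
    if "norm x * norm y \<le> 1" for x
  proof -
    have "norm x \<le> 1 / norm y"
      using that False by (simp add: field_simps)
    then have "norm x / (1 - norm (p\<^sup>2)) \<le> 1 / norm y / (1 - norm (p\<^sup>2))"
      using norm_p2 by (intro divide_right_mono) auto
    then show ?thesis
      by simp
  qed
  have "norm ((p\<^sup>2) ^ Suc N) \<le> 1"
    unfolding norm_power by (intro power_le_one) (use p in auto)
  then have "norm (p\<^sup>2 / y * (p\<^sup>2) ^ N) * norm y \<le> 1"
    using False by (simp add: norm_mult norm_divide)
  from order_trans[OF norm_qpoch_inf_le[OF norm_p2] le[OF this]]
  have "norm (qpoch_inf (p\<^sup>2 / y * (p\<^sup>2) ^ N) (p\<^sup>2)) \<le> exp (1 / (norm y * (1 - norm (p\<^sup>2))))" .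
  moreover have "norm (p / y) * norm y \<le> 1"
    using p False by (simp add: norm_divide)
  from order_trans[OF norm_qpoch_le[OF norm_p2] le[OF this]]
  have "norm (\<Prod>i<N. 1 - p / y * (p\<^sup>2) ^ i) \<le> exp (1 / (norm y * (1 - norm (p\<^sup>2))))" .
  ultimately have "norm (cleared_gf p N y) \<le>
      exp (1 / (norm y * (1 - norm (p\<^sup>2)))) * exp (1 / (norm y * (1 - norm (p\<^sup>2))))"
    unfolding cleared_gf_def norm_mult by (intro mult_mono) auto
  then show ?thesis
    by (simp flip: exp_add)
qed

lemma abs_summable_cleared:
  assumes "norm c < 1"
  shows "summable (\<lambda>N. norm (c ^ N * cleared_gf p N y))"
proof (rule summable_comparison_test')
  show "summable (\<lambda>N. norm c ^ N * exp (2 / (norm y * (1 - norm (p\<^sup>2)))))"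
    using assms by (intro summable_mult2 summable_geometric) auto
  show "norm (norm (c ^ N * cleared_gf p N y)) \<le> norm c ^ N * exp (2 / (norm y * (1 - norm (p\<^sup>2))))" for N
    using mult_left_mono[OF norm_cleared_gf_le[of N y], of "norm c ^ N"]
    by (simp add: norm_mult norm_power)
qed

lemmas summable_cleared = summable_norm_cancel[OF abs_summable_cleared]

text \<open>On a small disc that stays away from 0 and from the unit circle the terms have a
  geometric majorant.\<close>

lemma holomorphic_cleared_sum: "cleared_sum p holomorphic_on (ball 0 1 - {0})"
proof -
  have "(\<lambda>y. \<Sum>\<^sub>\<infinity>N. y ^ N * cleared_gf p N y) holomorphic_on (ball 0 1 - {0})"
  proof (rule holomorphic_infsum[OF filterlim_lessThan_at_top])
    show "(\<lambda>y. y ^ N * cleared_gf p N y) holomorphic_on ball 0 1 - {0}" for N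
      unfolding cleared_gf_def by (intro holomorphic_intros norm_p2) auto
    fix x :: complex assume x: "x \<in> ball 0 1 - {0}"
    define d where "d = min (norm x / 2) ((1 - norm x) / 2)"
    define \<rho> where "\<rho> = (1 + norm x) / 2"
    define B where "B = exp (2 / (norm x / 2 * (1 - norm (p\<^sup>2))))"
    have d: "d > 0"
      using x by (auto simp: d_def)
    have w: "norm x / 2 \<le> norm w" "norm w \<le> \<rho>" if "w \<in> cball x d" for w
    proof -
      have "norm x - norm w \<le> d" "norm w - norm x \<le> d"
        using that norm_triangle_ineq2[of x w] norm_triangle_ineq2[of w x]
        by (auto simp: dist_norm norm_minus_commute)
      then show "norm x / 2 \<le> norm w" "norm w \<le> \<rho>"
        by (auto simp: d_def \<rho>_def field_simps)
    qed
    have \<rho>: "0 \<le> \<rho>" "\<rho> < 1"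
      using x by (auto simp: \<rho>_def add_nonneg_nonneg)
    have "(\<lambda>N. \<rho> ^ N * B) summable_on UNIV"
      using \<rho> by (intro norm_summable_imp_summable_on)
        (auto simp: norm_mult norm_power B_def intro!: summable_mult2 summable_geometric)
    moreover have "norm (w ^ N * cleared_gf p N w) \<le> \<rho> ^ N * B" if "w \<in> cball x d" for N w
    proof -
      have "exp (2 / (norm w * (1 - norm (p\<^sup>2)))) \<le> B"
        using w(1)[OF that] x norm_p2 unfolding B_def
        by (intro exp_le_cancel_iff[THEN iffD2] divide_left_mono mult_right_mono mult_pos_pos) auto
      then have "norm (cleared_gf p N w) \<le> B"
        using norm_cleared_gf_le[of N w] by simp
      then show ?thesis
        using w(2)[OF that] \<rho> by (simp add: norm_mult norm_power mult_mono power_mono)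
    qed
    moreover have "cball x d \<subseteq> ball 0 1 - {0}"
    proof
      fix w assume "w \<in> cball x d"
      from w[OF this] \<rho> x show "w \<in> ball 0 1 - {0}"
        by auto
    qed
    ultimately show "\<exists>d>0. \<exists>M. cball x d \<subseteq> ball 0 1 - {0} \<and> M summable_on UNIV \<and>
        (\<forall>i. \<forall>w\<in>cball x d. norm (w ^ i * cleared_gf p i w) \<le> M i)"
      using d by blast
  qed auto
  then show ?thesis
  proof (rule holomorphic_transform)
    fix y :: complex assume y: "y \<in> ball 0 1 - {0}"
    have "(\<lambda>N. y ^ N * cleared_gf p N y) summable_on UNIV"
      by (rule norm_summable_imp_summable_on[OF abs_summable_cleared]) (use y in auto)
    then show "(\<Sum>\<^sub>\<infinity>N. y ^ N * cleared_gf p N y) = cleared_sum p y"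
      unfolding cleared_sum_def by (intro sums_unique has_sum_imp_sums has_sum_infsum)
  qed
qed

lemma cleared_gf_dilate_0: "y \<noteq> 0 \<Longrightarrow> cleared_gf p 0 (p\<^sup>2 * y) = (1 - 1 / y) * cleared_gf p 0 y"
  using qpoch_inf_rec[OF norm_p2, of "1 / y"] p by (simp add: cleared_gf_def)

lemma cleared_gf_dilate_Suc:
  "y \<noteq> 0 \<Longrightarrow> cleared_gf p (Suc N) (p\<^sup>2 * y) = (1 - 1 / (p * y)) * cleared_gf p N y"
  unfolding cleared_gf_def prod.lessThan_Suc_shift using p
  by (simp add: power2_eq_square field_simps)

lemma cleared_gf_Suc:
  "(1 - p\<^sup>2 / y * (p\<^sup>2) ^ N) * cleared_gf p (Suc N) y = (1 - p / y * (p\<^sup>2) ^ N) * cleared_gf p N y"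
  using qpoch_inf_rec[OF norm_p2, of "p\<^sup>2 / y * (p\<^sup>2) ^ N"] by (simp add: cleared_gf_def mult_ac)

text \<open>Dilation lowers \<open>N\<close> by 1 up to the factor \<open>1 - 1 / (p * y)\<close>,
  so beyond its term \<open>N = 0\<close> the dilated sum is a multiple of
  \<open>cleared_sum' p y\<close>.\<close>

lemma cleared_sum_dilate:
  assumes "y \<noteq> 0" "norm (p\<^sup>2 * y) < 1"
  shows "cleared_sum p (p\<^sup>2 * y) = (1 - 1 / y) * cleared_gf p 0 y - p * y * ((1 / y - p) * cleared_sum' p y)"
proof -
  have "cleared_sum p (p\<^sup>2 * y) =
      cleared_gf p 0 (p\<^sup>2 * y) + (\<Sum>N. (p\<^sup>2 * y) ^ Suc N * cleared_gf p (Suc N) (p\<^sup>2 * y))"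
    unfolding cleared_sum_def using suminf_split_head[OF summable_cleared[OF assms(2), of "p\<^sup>2 * y"]] by simp
  also have "(\<lambda>N. (p\<^sup>2 * y) ^ Suc N * cleared_gf p (Suc N) (p\<^sup>2 * y)) =
      (\<lambda>N. - p * y * (1 / y - p) * ((p\<^sup>2 * y) ^ N * cleared_gf p N y))"
    unfolding cleared_gf_dilate_Suc[OF assms(1)] using p assms(1)
    by (simp add: power2_eq_square field_simps fun_eq_iff)
  also have "(\<Sum>N. - p * y * (1 / y - p) * ((p\<^sup>2 * y) ^ N * cleared_gf p N y)) =
      - p * y * (1 / y - p) * cleared_sum' p y"
    unfolding cleared_sum'_def by (intro suminf_mult summable_cleared assms)
  finally show ?thesis
    by (simp add: cleared_gf_dilate_0 assms)
qed

text \<open>The recurrence between consecutive \<open>cleared_gf\<close>, summed over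
  \<open>N\<close> with weights \<open>y ^ Suc N\<close>. Eliminating \<open>cleared_sum'\<close>
  between this relation and the dilation formula yields the functional equation.\<close>

lemma cleared_sum_relation:
  assumes "y \<noteq> 0" "norm y < 1"
  shows "(1 / y - p) * cleared_sum' p y = (1 - y) * cleared_sum p y - (1 - 1 / y) * cleared_gf p 0 y"
proof -
  let ?B = "\<lambda>N. cleared_gf p N y"
  have "norm (p\<^sup>2 * y) < 1"
    using assms norm_p2 by (simp add: norm_mult mult_le_one order.strict_trans1[OF mult_left_le_one_le])
  note s = summable_cleared[OF assms(2), of y] summable_cleared[OF this, of y]
  have "(\<lambda>N. y ^ Suc N * ?B (Suc N) - (p\<^sup>2 * y) ^ Suc N * ?B (Suc N) / y) sums
      ((cleared_sum p y - ?B 0) - (cleared_sum' p y - ?B 0) / y)"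
    using sums_Suc_iff[of "\<lambda>N. y ^ N * ?B N" "cleared_sum p y - ?B 0"] summable_sums[OF s(1)]
      sums_Suc_iff[of "\<lambda>N. (p\<^sup>2 * y) ^ N * ?B N" "cleared_sum' p y - ?B 0"] summable_sums[OF s(2)]
    unfolding cleared_sum_def cleared_sum'_def by (intro sums_diff sums_divide) simp_all
  moreover have "(\<lambda>N. y * (y ^ N * ?B N) - p * ((p\<^sup>2 * y) ^ N * ?B N)) sums
      (y * cleared_sum p y - p * cleared_sum' p y)"
    using s unfolding cleared_sum_def cleared_sum'_def
    by (intro sums_diff sums_mult) (auto intro: summable_sums)
  moreover have "y ^ Suc N * ?B (Suc N) - (p\<^sup>2 * y) ^ Suc N * ?B (Suc N) / y =
      y * (y ^ N * ?B N) - p * ((p\<^sup>2 * y) ^ N * ?B N)" for N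
  proof -
    have "y ^ Suc N * ?B (Suc N) - (p\<^sup>2 * y) ^ Suc N * ?B (Suc N) / y =
        y ^ Suc N * ((1 - p\<^sup>2 / y * (p\<^sup>2) ^ N) * ?B (Suc N))"
      using assms(1) by (simp add: field_simps)
    also have "\<dots> = y * (y ^ N * ?B N) - p * ((p\<^sup>2 * y) ^ N * ?B N)"
      unfolding cleared_gf_Suc using assms(1) by (simp add: field_simps)
    finally show ?thesis .
  qed
  ultimately have "(cleared_sum p y - ?B 0) - (cleared_sum' p y - ?B 0) / y =
      y * cleared_sum p y - p * cleared_sum' p y"
    by (simp add: sums_unique2)
  then show ?thesis
    by (simp add: algebra_simps diff_divide_distrib)
qed

lemma cleared_gf_eq_bounded_gf:
  assumes "cleared_gf p 0 y \<noteq> 0"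
  shows "cleared_gf p N y = bounded_gf p N y * cleared_gf p 0 y"
  using assms qpoch_inf_initial[OF norm_p2, of "p\<^sup>2 / y" N]
  by (auto simp: cleared_gf_def bounded_gf_def)

text \<open>Differences of consecutive products carry a factor \<open>(p\<^sup>2) ^ N\<close>, so
  this series converges on the unit circle. Its summands will be the contributions of the partitions
  with \<open>half_largest\<close> equal to \<open>Suc N\<close>.\<close>

lemma rank_series_sums:
  assumes y: "y \<noteq> 0" "norm (p\<^sup>2 * y) < 1" and nz: "cleared_gf p 0 y \<noteq> 0"
  shows "(\<lambda>N. y ^ Suc N * (bounded_gf p (Suc N) y - bounded_gf p N y)) sums (rank_series p y - 1)"
proof -
  let ?B = "\<lambda>N. cleared_gf p N y"
  have s: "(\<lambda>N. (p\<^sup>2 * y) ^ N * ?B N) sums cleared_sum' p y"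
    unfolding cleared_sum'_def by (intro summable_sums summable_cleared y)
  then have "(\<lambda>N. (p\<^sup>2 * y) ^ Suc N * ?B (Suc N)) sums (cleared_sum' p y - ?B 0)"
    using sums_Suc_iff[of "\<lambda>N. (p\<^sup>2 * y) ^ N * ?B N" "cleared_sum' p y - ?B 0"] by simp
  with s have "(\<lambda>N. ((p\<^sup>2 * y) ^ Suc N * ?B (Suc N) / y - p * ((p\<^sup>2 * y) ^ N * ?B N)) / ?B 0) sums
      (((cleared_sum' p y - ?B 0) / y - p * cleared_sum' p y) / ?B 0)"
    by (intro sums_diff sums_mult sums_divide)
  moreover have "((p\<^sup>2 * y) ^ Suc N * ?B (Suc N) / y - p * ((p\<^sup>2 * y) ^ N * ?B N)) / ?B 0 =
      y ^ Suc N * (bounded_gf p (Suc N) y - bounded_gf p N y)" for N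
  proof -
    have "(p\<^sup>2 * y) ^ Suc N * ?B (Suc N) / y - p * ((p\<^sup>2 * y) ^ N * ?B N) =
        y ^ Suc N * (?B (Suc N) - ?B N)"
    proof -
      have "?B (Suc N) - ?B N = p\<^sup>2 / y * (p\<^sup>2) ^ N * ?B (Suc N) - p / y * (p\<^sup>2) ^ N * ?B N"
        using cleared_gf_Suc[of y N] by (simp add: algebra_simps)
      note diff = this
      show ?thesis
        unfolding diff using y(1) by (simp add: field_simps)
    qed
    then show ?thesis
      using nz by (simp add: cleared_gf_eq_bounded_gf[of y "Suc N"] cleared_gf_eq_bounded_gf[of y N]
        del: power_Suc flip: left_diff_distrib)
  qed
  moreover have "((cleared_sum' p y - ?B 0) / y - p * cleared_sum' p y) / ?B 0 = rank_series p y - 1"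
    using nz y(1) by (simp add: rank_series_def field_simps)
  ultimately show ?thesis
    by simp
qed

text \<open>The factors of \<open>qpoch_inf (p / y) p\<close> with even exponents of
  \<open>p\<close> are exactly \<open>cleared_gf p 0 y\<close>, so multiplication by
  \<open>jtheta y p\<close> removes the poles of the quotient by it.\<close>

lemma jtheta_split_cleared:
  "jtheta y p = qpoch_inf y p * qpoch_inf p p * qpoch_inf (p / y) (p\<^sup>2) * cleared_gf p 0 y"
  using qpoch_inf_split_2[OF p(1), of "p / y"]
  by (simp add: jtheta_def cleared_gf_def power2_eq_square mult_ac)

lemma lambert_mult_nome_twice:
  assumes "y \<noteq> 0" "\<And>n::int. y \<noteq> p powi n"
  shows "lambert p (-1) (p\<^sup>2 * y) = (1 + p * y) * jtheta (-1) p + p * y\<^sup>2 * lambert p (-1) y"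
proof -
  have "p * y \<noteq> p powi n" for n
    using assms(2)[of "n - 1"] p by (auto simp: power_int_diff field_simps)
  then have "lambert p (-1) (p * (p * y)) = jtheta (-1) p + p * y * lambert p (-1) (p * y)"
    using lambert_mult_nome[OF p, of "-1" "p * y"] assms p by simp
  also have "lambert p (-1) (p * y) = jtheta (-1) p + y * lambert p (-1) y"
    using lambert_mult_nome[OF p, of "-1" y] assms by simp
  finally show ?thesis
    by (simp add: power2_eq_square algebra_simps)
qed

lemma jtheta_mult_nome_twice: "y \<noteq> 0 \<Longrightarrow> jtheta (p\<^sup>2 * y) p = jtheta y p / (p * y\<^sup>2)"
  using jtheta_mult_nome[OF p, of "p * y"] jtheta_mult_nome[OF p, of y] p
  by (simp add: power2_eq_square mult_ac)

lemma minus_one_not_power: "(-1::complex) \<noteq> p powi n"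
proof
  assume *: "-1 = p powi n"
  then have "norm (p powi n) = norm (-1::complex)"
    by simp
  then have "n = 0"
    using norm_power_int_eq_1_imp[OF p] by simp
  with * show False
    by simp
qed

text \<open>\<open>h\<close> is the left side written without poles. Both quotients satisfy the same
  equation, so their difference only picks up the factor \<open>p * y\<^sup>2\<close>, which
  \<open>jtheta\<close> loses at the same time.\<close>

lemma cleared_sum_eq:
  assumes y: "y \<noteq> 0" "norm y < 1" "\<And>n::int. y \<noteq> p powi n"
  shows "jtheta y p * (cleared_sum p y / cleared_gf p 0 y - lambert p (-1) y / jtheta (-1) p) =
    qpoch_inf p p ^ 3 / jtheta (-1) p"
proof -
  define T where "T y = qpoch_inf y p * qpoch_inf p p * qpoch_inf (p / y) (p\<^sup>2)" for y
  define h where "h y = T y * cleared_sum p y - theta_lambert p (-1) y / jtheta (-1) p" for y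
  have j1: "jtheta (-1) p \<noteq> 0"
    using jtheta_eq_0_iff[OF p, of "-1"] minus_one_not_power by auto
  have nz: "cleared_gf p 0 y \<noteq> 0" if "y \<noteq> 0" "\<And>n::int. y \<noteq> p powi n" for y
    using jtheta_split_cleared[of y] jtheta_eq_0_iff[OF p that(1)] that(2) by auto
  have h: "h y = jtheta y p * (cleared_sum p y / cleared_gf p 0 y - lambert p (-1) y / jtheta (-1) p)"
    if "y \<noteq> 0" "\<And>n::int. y \<noteq> p powi n" for y
    using nz[OF that] theta_lambert_eq[OF p that(2)]
    by (simp add: h_def T_def jtheta_split_cleared[of y] algebra_simps)
  have "h y = h p"
  proof (rule q_periodic_constant[where \<psi> = h and r = 1 and q = "p\<^sup>2" and C = "range (\<lambda>n::int. p powi n)"])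
    show "h holomorphic_on ball 0 1 - {0}"
      unfolding h_def T_def
      by (intro holomorphic_intros holomorphic_cleared_sum p norm_p2 j1
            holomorphic_on_subset[OF holomorphic_theta_lambert[OF p]]) auto
    fix y assume "y \<in> ball 0 1 - {0} - range (\<lambda>n::int. p powi n)"
    then have y: "y \<noteq> 0" "norm y < 1" "\<And>n::int. y \<noteq> p powi n"
      by auto
    have y': "p\<^sup>2 * y \<noteq> p powi n" for n
      using y(3)[of "n - 2"] p by (auto simp: power_int_diff field_simps)
    have "y \<noteq> 1"
      using y(3)[of 0] by simp
    have "norm (p\<^sup>2 * y) < 1"
      using ball_dilation[of y 1 "p\<^sup>2"] y norm_p2 by simp
    from cleared_sum_dilate[OF y(1) this, unfolded cleared_sum_relation[OF y(1,2)]]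
    have "cleared_sum p (p\<^sup>2 * y) = (1 - 1 / y) * cleared_gf p 0 y
        - p * y * ((1 - y) * cleared_sum p y - (1 - 1 / y) * cleared_gf p 0 y)" .
    also have "\<dots> =
        (1 + p * y) * ((1 - 1 / y) * cleared_gf p 0 y) + p * y\<^sup>2 * ((1 - 1 / y) * cleared_sum p y)"
      using y(1) by (simp add: field_simps power2_eq_square)
    finally have "cleared_sum p (p\<^sup>2 * y) =
        (1 + p * y) * ((1 - 1 / y) * cleared_gf p 0 y) + p * y\<^sup>2 * ((1 - 1 / y) * cleared_sum p y)" .
    moreover have "(1 - 1 / y) * cleared_gf p 0 y \<noteq> 0"
      using nz[OF y(1,3)] \<open>y \<noteq> 1\<close> y(1) by simp
    ultimately have "cleared_sum p (p\<^sup>2 * y) / cleared_gf p 0 (p\<^sup>2 * y) =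
        (1 + p * y) + p * y\<^sup>2 * (cleared_sum p y / cleared_gf p 0 y)"
      unfolding cleared_gf_dilate_0[OF y(1)] using \<open>y \<noteq> 1\<close> by (simp add: add_divide_distrib)
    moreover have "p\<^sup>2 * y \<noteq> 0"
      using p y by simp
    ultimately show "h (p\<^sup>2 * y) = h y"
      unfolding h[OF y(1,3)] h[OF \<open>p\<^sup>2 * y \<noteq> 0\<close> y'] jtheta_mult_nome_twice[OF y(1)]
        lambert_mult_nome_twice[OF y(1,3)]
      using j1 p y(1) by (simp add: field_simps)
  qed (use p y norm_p2 in auto)
  \<comment> \<open>The factor \<open>T p\<close> contains \<open>qpoch_inf 1 (p\<^sup>2)\<close>,
    so at \<open>y = p\<close> only the Appell--Lerch part contributes to the constant.\<close>
  moreover have "qpoch_inf 1 (p\<^sup>2) = 0"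
    using qpoch_inf_eq_0_iff[OF norm_p2, of 1] by (auto intro: exI[of _ 0])
  ultimately show ?thesis
    using h[OF y(1,3)] theta_lambert_nome[OF p] p by (simp add: h_def T_def)
qed

text \<open>The point \<open>p\<^sup>2 * y\<close> lies in the unit disc, where the constant is
  known. The functional equations express everything there through values at \<open>y\<close>; the
  terms \<open>1 + p * y\<close> drop out and \<open>p * y\<^sup>2\<close> cancels.\<close>

theorem rank_series_eq:
  assumes y: "norm y = 1" "y \<noteq> 1"
  shows "rank_series p y = (1 - y) * (lambert p (-1) y / jtheta (-1) p
    + qpoch_inf p p ^ 3 / (jtheta (-1) p * jtheta y p))"
proof -
  have y0: "y \<noteq> 0"
    using y by auto
  have np: "y \<noteq> p powi n" for n
    using norm_power_int_eq_1_imp[OF p, of n] y by auto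
  have np': "p\<^sup>2 * y \<noteq> p powi n" for n
    using np[of "n - 2"] p by (auto simp: power_int_diff field_simps)
  have jy: "jtheta y p \<noteq> 0"
    using jtheta_eq_0_iff[OF p y0] np by auto
  then have nz: "cleared_gf p 0 y \<noteq> 0"
    using jtheta_split_cleared[of y] by auto
  have j1: "jtheta (-1) p \<noteq> 0"
    using jtheta_eq_0_iff[OF p, of "-1"] minus_one_not_power by auto
  have n1: "norm (p\<^sup>2 * y) < 1"
    using y norm_p2 by (simp add: norm_mult)
  have "(1 / y - p) * cleared_sum' p y = cleared_gf p 0 y * (rank_series p y - 1 + 1 / y)"
    using nz by (simp add: rank_series_def)
  from cleared_sum_dilate[OF y0 n1, unfolded this]
  have "cleared_sum p (p\<^sup>2 * y) =
      (1 - 1 / y) * cleared_gf p 0 y - p * y * (cleared_gf p 0 y * (rank_series p y - 1 + 1 / y))" .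
  also have "\<dots> =
      ((1 + p * y) * (1 - 1 / y) - p * y * rank_series p y) * cleared_gf p 0 y"
    using y0 by (simp add: field_simps)
  finally have quot: "cleared_sum p (p\<^sup>2 * y) / cleared_gf p 0 (p\<^sup>2 * y) =
      1 + p * y + p * y\<^sup>2 * (rank_series p y / (1 - y))"
    unfolding cleared_gf_dilate_0[OF y0] using nz y0 y(2) by (simp add: divide_simps power2_eq_square) (simp add: algebra_simps)
  define X where "X = rank_series p y / (1 - y)"
  have "p\<^sup>2 * y \<noteq> 0"
    using y0 p by simp
  from cleared_sum_eq[OF this n1 np', unfolded quot X_def[symmetric] jtheta_mult_nome_twice[OF y0]
      lambert_mult_nome_twice[OF y0 np]]
  have "X * (p * (jtheta y p * (jtheta (-1) p * y\<^sup>2))) =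
      p * (y\<^sup>2 * qpoch_inf p p ^ 3) + p * (jtheta y p * (y\<^sup>2 * lambert p (-1) y))"
    using j1 p y0 by (simp add: divide_simps) (simp add: algebra_simps)
  then have "p * y\<^sup>2 * (X * jtheta (-1) p * jtheta y p) =
      p * y\<^sup>2 * (qpoch_inf p p ^ 3 + jtheta y p * lambert p (-1) y)"
    by (simp only: ring_distribs mult_ac)
  then have "X * jtheta (-1) p * jtheta y p = qpoch_inf p p ^ 3 + jtheta y p * lambert p (-1) y"
    using p y0 by (simp only: mult_cancel_left) simp
  then have "X = lambert p (-1) y / jtheta (-1) p
      + qpoch_inf p p ^ 3 / (jtheta (-1) p * jtheta y p)"
    using jy j1 by (simp add: field_simps)
  then show ?thesis
    using y(2) by (simp add: X_def nonzero_divide_eq_eq mult.commute)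
qed

end

section \<open>Partitions without repeated odd parts\<close>

lemma has_sum_fibres:
  fixes f :: "'a \<Rightarrow> complex"
  assumes "(f has_sum s) A" "\<And>b. (f has_sum h b) {a \<in> A. g a = b}"
  shows "(h has_sum s) UNIV"
proof (rule has_sum_SigmaD)
  show "((\<lambda>(b, a). f a) has_sum s) (SIGMA b:UNIV. {a \<in> A. g a = b})"
    using assms(1) by (rule has_sum_reindex_bij_witness[of _ snd "\<lambda>a. (g a, a)", THEN iffD1, rotated -1]) auto
  show "((\<lambda>a. case (b, a) of (b, a) \<Rightarrow> f a) has_sum h b) {a \<in> A. g a = b}" for b
    using assms(2) by simp
qed

text \<open>As \<open>c\<close> does not occur in members of \<open>A\<close>, the multiset
  determines \<open>a\<close> and \<open>k\<close>, and the sum factors. With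
  \<open>K = {0, 1}\<close> this adjoins an odd size, with \<open>K = UNIV\<close> an even
  one.\<close>

lemma has_sum_add_copies:
  fixes f :: "nat multiset \<Rightarrow> complex"
  assumes A: "(\<lambda>\<pi>. norm (f \<pi>)) summable_on A" "(f has_sum s) A"
    and K: "(\<lambda>k. norm (x ^ k)) summable_on K" "((\<lambda>k. x ^ k) has_sum t) K"
    and mult: "\<And>a k. a \<in> A \<Longrightarrow> k \<in> K \<Longrightarrow> f (a + replicate_mset k c) = f a * x ^ k"
    and c: "\<And>a. a \<in> A \<Longrightarrow> c \<notin># a"
    and B: "B = (\<lambda>(a, k). a + replicate_mset k c) ` (A \<times> K)"
  shows "(\<lambda>\<pi>. norm (f \<pi>)) summable_on B" "(f has_sum s * t) B"
proof -
  let ?h = "\<lambda>(a, k). a + replicate_mset k c"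
  have inj: "inj_on ?h (A \<times> K)"
  proof (rule inj_onI, clarify)
    fix a k a' k' assume a: "a \<in> A" "a' \<in> A" and eq: "a + replicate_mset k c = a' + replicate_mset k' c"
    have "count (a + replicate_mset k c) c = k" "count (a' + replicate_mset k' c) c = k'"
      using c[OF a(1)] c[OF a(2)] by (simp_all add: not_in_iff)
    with eq show "a = a' \<and> k = k'"
      by simp
  qed
  have abs: "(\<lambda>y. norm ((\<lambda>(a, k). f a * x ^ k) y)) summable_on A \<times> K"
    unfolding Infinite_Sum.abs_summable_on_Sigma_iff
  proof (intro conjI ballI, goal_cases)
    case (1 a)
    show ?case
      using summable_on_cmult_right[OF K(1), of "norm (f a)"] by (simp add: norm_mult)
  next
    case 2
    have "(\<lambda>a. norm (f a) * (\<Sum>\<^sub>\<infinity>k\<in>K. norm (x ^ k))) summable_on A"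
      by (intro summable_on_cmult_left A)
    then show ?case
      by (simp add: norm_mult infsum_cmult_right' infsum_nonneg abs_mult)
  qed
  have "((\<lambda>(a, k). f a * x ^ k) has_sum s * t) (A \<times> K)"
  proof (rule has_sum_SigmaI)
    show "((\<lambda>k. case (a, k) of (a, k) \<Rightarrow> f a * x ^ k) has_sum f a * t) K" for a
      using has_sum_cmult_right[OF K(2), of "f a"] by simp
    show "((\<lambda>a. f a * t) has_sum s * t) A"
      by (intro has_sum_cmult_left A)
    show "(\<lambda>(a, k). f a * x ^ k) summable_on A \<times> K"
      using abs by (rule abs_summable_summable)
  qed
  moreover have eq: "(\<lambda>(a, k). f a * x ^ k) y = (f \<circ> ?h) y" if "y \<in> A \<times> K" for y
    using that mult by auto
  ultimately have "((f \<circ> ?h) has_sum s * t) (A \<times> K)"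
    by (subst has_sum_cong[OF eq[symmetric]])
  then show "(f has_sum s * t) B"
    unfolding B by (simp add: has_sum_reindex[OF inj])
  have "(\<lambda>y. norm ((f \<circ> ?h) y)) summable_on A \<times> K"
    using abs by (subst summable_on_cong[OF arg_cong[OF eq[symmetric]]])
  then show "(\<lambda>\<pi>. norm (f \<pi>)) summable_on B"
    unfolding B by (simp add: summable_on_reindex[OF inj] o_def)
qed

section \<open>Generating functions of partitions with bounded parts\<close>

definition odd_distinct_partitions :: "nat multiset set" where
  "odd_distinct_partitions = {\<pi>. 0 \<notin># \<pi> \<and> odd_parts_distinct \<pi>}"

definition odd_distinct_bounded :: "nat \<Rightarrow> nat multiset set" where
  "odd_distinct_bounded N = {\<pi> \<in> odd_distinct_partitions. \<forall>k\<in>#\<pi>. k \<le> 2 * N}"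

lemma odd_distinct_bounded_0: "odd_distinct_bounded 0 = {{#}}"
  by (auto simp: odd_distinct_bounded_def odd_distinct_partitions_def odd_parts_distinct_def)
     (metis multiset_nonemptyE neq0_conv)

lemma odd_distinct_bounded_Suc:
  fixes N defines "U \<equiv> (\<lambda>(a, k). a + replicate_mset k (2 * N + 1)) ` (odd_distinct_bounded N \<times> {0, 1})"
  shows "odd_distinct_bounded (Suc N) = (\<lambda>(a, k). a + replicate_mset k (2 * N + 2)) ` (U \<times> UNIV)"
    and "\<And>a. a \<in> U \<Longrightarrow> 2 * N + 2 \<notin># a" and "\<And>a. a \<in> odd_distinct_bounded N \<Longrightarrow> 2 * N + 1 \<notin># a"
proof -
  show c1: "2 * N + 1 \<notin># a" if "a \<in> odd_distinct_bounded N" for a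
    using that by (auto simp: odd_distinct_bounded_def)
  show "2 * N + 2 \<notin># a" if "a \<in> U" for a
    using that by (fastforce simp: U_def odd_distinct_bounded_def split: if_splits)
  show "odd_distinct_bounded (Suc N) = (\<lambda>(a, k). a + replicate_mset k (2 * N + 2)) ` (U \<times> UNIV)"
  proof (intro equalityI subsetI)
    fix b assume b: "b \<in> odd_distinct_bounded (Suc N)"
    define a where "a = filter_mset (\<lambda>k. k \<le> 2 * N) b"
    have le: "count b (2 * N + 1) \<le> 1"
      using b by (auto simp: odd_distinct_bounded_def odd_distinct_partitions_def odd_parts_distinct_def)
    have "a \<in> odd_distinct_bounded N"
      using b by (auto simp: a_def odd_distinct_bounded_def odd_distinct_partitions_def odd_parts_distinct_def)
    moreover have "b = a + replicate_mset (count b (2 * N + 1)) (2 * N + 1) +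
        replicate_mset (count b (2 * N + 2)) (2 * N + 2)"
    proof (rule multiset_eqI)
      fix k
      have "count b k = 0" if "k > 2 * N + 2"
        using b that by (auto simp: odd_distinct_bounded_def not_in_iff[symmetric])
      then show "count b k = count (a + replicate_mset (count b (2 * N + 1)) (2 * N + 1) +
          replicate_mset (count b (2 * N + 2)) (2 * N + 2)) k"
        by (cases k "2 * N + 1" rule: linorder_cases) (auto simp: a_def)
    qed
    ultimately show "b \<in> (\<lambda>(a, k). a + replicate_mset k (2 * N + 2)) ` (U \<times> UNIV)"
      using le unfolding U_def by (force simp: le_Suc_eq)
  next
    fix b assume "b \<in> (\<lambda>(a, k). a + replicate_mset k (2 * N + 2)) ` (U \<times> UNIV)"
    then obtain a e k where a: "a \<in> odd_distinct_bounded N" "e \<le> (1::nat)"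
      and b: "b = a + replicate_mset e (2 * N + 1) + replicate_mset k (2 * N + 2)"
      unfolding U_def by auto
    have "count b m \<le> 1" if "odd m" for m
      using that a c1[OF a(1)] unfolding b
      by (auto simp: odd_distinct_bounded_def odd_distinct_partitions_def odd_parts_distinct_def not_in_iff)
    moreover have "0 \<notin># b" "\<forall>m\<in>#b. m \<le> 2 * Suc N"
      using a unfolding b
      by (auto simp: odd_distinct_bounded_def odd_distinct_partitions_def split: if_splits)
    ultimately show "b \<in> odd_distinct_bounded (Suc N)"
      by (simp add: odd_distinct_bounded_def odd_distinct_partitions_def odd_parts_distinct_def)
  qed
qed

lemma power_sum_abs_summable:
  assumes "norm (x::complex) < 1"
  shows "(\<lambda>k. norm (x ^ k)) summable_on UNIV" "((\<lambda>k. x ^ k) has_sum 1 / (1 - x)) UNIV"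
proof -
  have "summable (\<lambda>k. norm (x ^ k))"
    using assms by (simp add: norm_power summable_geometric)
  then show "(\<lambda>k. norm (x ^ k)) summable_on UNIV"
    by (intro norm_summable_imp_summable_on) auto
  show "((\<lambda>k. x ^ k) has_sum 1 / (1 - x)) UNIV"
    using \<open>summable (\<lambda>k. norm (x ^ k))\<close> geometric_sums[OF assms] by (rule norm_summable_imp_has_sum)
qed

lemma has_sum_odd_distinct_bounded:
  assumes q: "norm (q::complex) < 1" "q \<noteq> 0" and y: "norm y = 1"
  shows "(\<lambda>\<pi>. norm (q ^ sum_mset \<pi> * (1 / y) ^ size \<pi>)) summable_on odd_distinct_bounded N"
    and "((\<lambda>\<pi>. q ^ sum_mset \<pi> * (1 / y) ^ size \<pi>) has_sum bounded_gf (- q) N y) (odd_distinct_bounded N)"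
proof -
  let ?f = "\<lambda>\<pi>. q ^ sum_mset \<pi> * (1 / y) ^ size \<pi>"
  have mult: "?f (a + replicate_mset k c) = ?f a * (q ^ c / y) ^ k" for a k c
    by (simp add: power_add power_mult[symmetric] power_divide mult_ac)
  have "(\<lambda>\<pi>. norm (?f \<pi>)) summable_on odd_distinct_bounded N \<and>
      (?f has_sum bounded_gf (- q) N y) (odd_distinct_bounded N)"
  proof (induction N)
    case 0
    then show ?case
      by (simp add: odd_distinct_bounded_0 bounded_gf_def has_sum_finiteI)
  next
    case (Suc N)
    let ?U = "(\<lambda>(a, k). a + replicate_mset k (2 * N + 1)) ` (odd_distinct_bounded N \<times> {0, 1})"
    let ?x = "q ^ (2 * N + 1) / y" and ?x' = "q ^ (2 * N + 2) / y"
    have x': "norm ?x' < 1"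
      using q y by (simp add: norm_divide norm_power power_less_one_iff del: power_Suc)
    have O1: "(\<lambda>\<pi>. norm (?f \<pi>)) summable_on ?U"
      and O2: "(?f has_sum bounded_gf (- q) N y * (1 + ?x)) ?U"
      using has_sum_add_copies[of ?f "odd_distinct_bounded N" "bounded_gf (- q) N y" ?x "{0, 1}"
          "1 + ?x" "2 * N + 1" ?U, OF _ _ _ _ mult] Suc.IH odd_distinct_bounded_Suc(3)[of _ N]
      by (auto simp: has_sum_finiteI)
    have "(\<lambda>\<pi>. norm (?f \<pi>)) summable_on odd_distinct_bounded (Suc N)"
      "(?f has_sum bounded_gf (- q) N y * (1 + ?x) * (1 / (1 - ?x'))) (odd_distinct_bounded (Suc N))"
      using has_sum_add_copies[OF O1 O2 power_sum_abs_summable[OF x'] mult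
          odd_distinct_bounded_Suc(2)[of _ N] odd_distinct_bounded_Suc(1)[of N]]
      by blast+
    \<comment> \<open>At \<open>p = - q\<close> the factor
      \<open>1 - p / y * (p\<^sup>2) ^ N\<close> becomes \<open>1 + q ^ (2 * N + 1) / y\<close>, the
      choice between no and one part \<open>2 * N + 1\<close>.\<close>
    moreover have "bounded_gf (- q) N y * (1 + ?x) * (1 / (1 - ?x')) = bounded_gf (- q) (Suc N) y"
    proof -
      have "q ^ (2 * N + 1) = q * (q\<^sup>2) ^ N" "q ^ (2 * N + 2) = q\<^sup>2 * (q\<^sup>2) ^ N"
        by (simp_all add: power_mult power_add power2_eq_square)
      then show ?thesis
        by (simp add: bounded_gf_def mult_ac)
    qed
    ultimately show ?case
      by simp
  qed
  then show "(\<lambda>\<pi>. norm (?f \<pi>)) summable_on odd_distinct_bounded N"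
    "(?f has_sum bounded_gf (- q) N y) (odd_distinct_bounded N)"
    by auto
qed

lemma cleared_gf_0_nonzero:
  assumes p: "norm (p::complex) < 1" and y: "norm y = 1"
  shows "cleared_gf p 0 y \<noteq> 0"
proof
  assume "cleared_gf p 0 y = 0"
  then obtain i where "p\<^sup>2 / y * (p\<^sup>2) ^ i = 1"
    using qpoch_inf_eq_0_iff[of "p\<^sup>2" "p\<^sup>2 / y"] p
    by (auto simp: cleared_gf_def norm_power power_less_one_iff)
  then have "norm (p ^ (2 * i + 2)) = norm y"
    using y by (auto simp: power_add power_mult power2_eq_square field_simps)
  with p y show False
    using power_less_one_iff[of "norm p" "2 * i + 2"] by (simp add: norm_mult norm_power)
qed

lemma bounded_gf_bounded:
  assumes p: "norm (p::complex) < 1" "p \<noteq> 0" and y: "norm y = 1"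
  obtains B where "\<And>N. norm (bounded_gf p N y) \<le> B"
proof -
  note nz = cleared_gf_0_nonzero[OF p(1) y]
  have "norm (bounded_gf p N y) \<le> exp (2 / (norm y * (1 - norm (p\<^sup>2)))) / norm (cleared_gf p 0 y)" for N
    using norm_cleared_gf_le[OF p, of N y] cleared_gf_eq_bounded_gf[OF p nz, of N] nz
    by (simp add: norm_mult field_simps)
  then show ?thesis
    using that by blast
qed

text \<open>At the positive number \<open>norm q\<close> and \<open>y = 1\<close> the weights are
  the norms themselves, and \<open>bounded_gf_bounded\<close> bounds their totals over all levels at
  once.\<close>

lemma abs_summable_odd_distinct:
  assumes q: "norm (q::complex) < 1" "q \<noteq> 0"
  shows "(\<lambda>\<pi>. norm (q ^ sum_mset \<pi>)) summable_on odd_distinct_partitions"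
proof -
  let ?q = "of_real (norm q) :: complex"
  have q': "norm ?q < 1" "?q \<noteq> 0"
    using q by auto
  obtain B where B: "\<And>N. norm (bounded_gf (- ?q) N 1) \<le> B"
    using bounded_gf_bounded[of "- ?q" 1] q' by auto
  have le: "(\<Sum>\<pi>\<in>F. norm (q ^ sum_mset \<pi>)) \<le> B" if F: "F \<subseteq> odd_distinct_partitions" "finite F" for F
  proof -
    \<comment> \<open>Any common bound for the parts will do: parts at most \<open>N\<close> are in
      particular at most \<open>2 * N\<close>.\<close>
    define N where "N = Max (insert 0 (\<Union>\<pi>\<in>F. set_mset \<pi>))"
    have "k \<le> N" if "\<pi> \<in> F" "k \<in># \<pi>" for \<pi> k
      unfolding N_def using that F by (intro Max_ge) auto
    then have sub: "F \<subseteq> odd_distinct_bounded N"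
      using F by (fastforce simp: odd_distinct_bounded_def)
    have "((\<lambda>\<pi>. of_real (norm (q ^ sum_mset \<pi>)) :: complex) has_sum bounded_gf (- ?q) N 1) (odd_distinct_bounded N)"
      using has_sum_odd_distinct_bounded(2)[OF q', of 1 N] by (simp add: norm_power)
    then have "((\<lambda>\<pi>. norm (q ^ sum_mset \<pi>)) has_sum Re (bounded_gf (- ?q) N 1)) (odd_distinct_bounded N)"
      using has_sum_Re by fastforce
    then have "(\<Sum>\<pi>\<in>F. norm (q ^ sum_mset \<pi>)) \<le> Re (bounded_gf (- ?q) N 1)"
      by (rule finite_sum_le_has_sum) (use F sub in auto)
    also have "\<dots> \<le> B"
      using B[of N] complex_Re_le_cmod order_trans by blast
    finally show ?thesis .
  qed
  show ?thesis
    unfolding Infinite_Sum.abs_summable_iff_bdd_above by (rule bdd_aboveI2[of _ _ B]) (use le in auto)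
qed

section \<open>Grouping by half the largest part\<close>

definition half_largest :: "nat multiset \<Rightarrow> nat" where
  "half_largest \<pi> = (largest_part \<pi> + 1) div 2"

lemma M2_rank_eq: "M2_rank \<pi> = int (half_largest \<pi>) - int (size \<pi>)"
proof -
  have "\<lceil>real n / 2\<rceil> = int ((n + 1) div 2)" for n
    by (rule ceiling_unique) (cases "even n"; auto elim!: evenE oddE)+
  then show ?thesis
    by (simp add: M2_rank_def half_largest_def)
qed

lemma half_largest_le_iff: "half_largest \<pi> \<le> N \<longleftrightarrow> (\<forall>k\<in>#\<pi>. k \<le> 2 * N)"
proof -
  have "half_largest \<pi> \<le> N \<longleftrightarrow> largest_part \<pi> \<le> 2 * N"
    by (auto simp: half_largest_def)
  also have "\<dots> \<longleftrightarrow> (\<forall>k\<in>#\<pi>. k \<le> 2 * N)"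
    by (simp add: largest_part_def)
  finally show ?thesis .
qed

lemma odd_distinct_bounded_eq:
  "odd_distinct_bounded N = {\<pi> \<in> odd_distinct_partitions. half_largest \<pi> \<le> N}"
  by (simp add: odd_distinct_bounded_def half_largest_le_iff)

text \<open>The fibre of \<open>half_largest\<close> over a positive \<open>N\<close> is the
  difference of two consecutive bounded sets, so its total is a summand of
  \<open>rank_series_sums\<close>.\<close>

lemma has_sum_M2_rank:
  assumes q: "norm (q::complex) < 1" "q \<noteq> 0" and y: "norm y = 1"
  shows "((\<lambda>\<pi>. y powi M2_rank \<pi> * q ^ sum_mset \<pi>) has_sum rank_series (- q) y) odd_distinct_partitions"
proof -
  let ?w = "\<lambda>\<pi>. y powi M2_rank \<pi> * q ^ sum_mset \<pi>" and ?f = "\<lambda>\<pi>. q ^ sum_mset \<pi> * (1 / y) ^ size \<pi>"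
  have y0: "y \<noteq> 0"
    using y by auto
  have w: "?w \<pi> = y ^ N * ?f \<pi>" if "half_largest \<pi> = N" for \<pi> N
    using that y0 by (simp add: M2_rank_eq power_int_diff power_divide)
  have "(\<lambda>\<pi>. norm (?w \<pi>)) summable_on odd_distinct_partitions"
    using abs_summable_odd_distinct[OF q] y by (simp add: norm_mult norm_power_int)
  then have "?w summable_on odd_distinct_partitions"
    by (rule abs_summable_summable)
  then have total: "(?w has_sum infsum ?w odd_distinct_partitions) odd_distinct_partitions"
    by simp
  \<comment> \<open>The value 1 at \<open>N = 0\<close> belongs to the empty partition.\<close>
  define h where "h N = (case N of 0 \<Rightarrow> 1 | Suc N \<Rightarrow>
    y ^ Suc N * (bounded_gf (- q) (Suc N) y - bounded_gf (- q) N y))" for N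
  have level: "(?w has_sum h N) {\<pi> \<in> odd_distinct_partitions. half_largest \<pi> = N}" for N
  proof (cases N)
    case 0
    have "{\<pi> \<in> odd_distinct_partitions. half_largest \<pi> = 0} = odd_distinct_bounded 0"
      by (simp add: odd_distinct_bounded_eq)
    then show ?thesis
      by (simp add: 0 h_def odd_distinct_bounded_0 has_sum_finiteI M2_rank_eq half_largest_def largest_part_def)
  next
    case (Suc n)
    have "(?f has_sum (bounded_gf (- q) (Suc n) y - bounded_gf (- q) n y))
        (odd_distinct_bounded (Suc n) - odd_distinct_bounded n)"
      by (intro has_sum_Diff has_sum_odd_distinct_bounded(2) q y) (auto simp: odd_distinct_bounded_eq)
    from has_sum_cmult_right[OF this, of "y ^ N"]
    have "((\<lambda>\<pi>. y ^ N * ?f \<pi>) has_sum h N) (odd_distinct_bounded (Suc n) - odd_distinct_bounded n)"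
      by (simp add: h_def Suc)
    moreover have "odd_distinct_bounded (Suc n) - odd_distinct_bounded n =
        {\<pi> \<in> odd_distinct_partitions. half_largest \<pi> = N}"
      by (auto simp: odd_distinct_bounded_eq Suc)
    ultimately have "((\<lambda>\<pi>. y ^ N * ?f \<pi>) has_sum h N) {\<pi> \<in> odd_distinct_partitions. half_largest \<pi> = N}"
      by simp
    then show ?thesis
      by (rule has_sum_cong[THEN iffD1, rotated]) (simp add: w del: of_nat_Suc)
  qed
  have "h sums infsum ?w odd_distinct_partitions"
    by (rule has_sum_imp_sums[OF has_sum_fibres[OF total level]])
  moreover have "(\<lambda>N. h (Suc N)) sums (rank_series (- q) y - 1)"
    unfolding h_def nat.case
    by (rule rank_series_sums) (use q y y0 cleared_gf_0_nonzero[of "- q" y] in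
      \<open>auto simp: norm_mult norm_power power_less_one_iff\<close>)
  then have "h sums rank_series (- q) y"
    by (subst (asm) sums_Suc_iff) (simp add: h_def)
  ultimately have "infsum ?w odd_distinct_partitions = rank_series (- q) y"
    by (rule sums_unique2)
  with total show ?thesis
    by simp
qed

section \<open>Coefficients of the rank series and the root of unity filter\<close>

lemma size_le_sum_mset: "0 \<notin># \<pi> \<Longrightarrow> size \<pi> \<le> sum_mset (\<pi> :: nat multiset)"
  by (induction \<pi>) auto

lemma finite_partitions_of: "finite (partitions_of n)"
proof -
  have "partitions_of n \<subseteq> mset ` {xs. set xs \<subseteq> {..n} \<and> length xs \<le> n}"
  proof
    fix \<pi> assume \<pi>: "\<pi> \<in> partitions_of n"
    obtain xs where xs: "mset xs = \<pi>"
      using ex_mset by blast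
    have "length xs \<le> n"
      using \<pi> size_le_sum_mset[of \<pi>] xs by (auto simp: partitions_of_def)
    moreover have "set xs \<subseteq> {..n}"
    proof
      fix x assume "x \<in> set xs"
      then have "x \<in># \<pi>"
        using xs by auto
      then obtain \<mu> where "\<pi> = add_mset x \<mu>"
        by (metis insert_DiffM)
      with \<pi> show "x \<in> {..n}"
        by (auto simp: partitions_of_def)
    qed
    ultimately show "\<pi> \<in> mset ` {xs. set xs \<subseteq> {..n} \<and> length xs \<le> n}"
      using xs by auto
  qed
  moreover have "finite {xs. set xs \<subseteq> {..n} \<and> length xs \<le> n}"
    by (rule finite_lists_length_le) auto
  ultimately show ?thesis
    using finite_surj by blast
qed

definition odd_distinct_of :: "nat \<Rightarrow> nat multiset set" where
  "odd_distinct_of n = {\<pi> \<in> partitions_of n. odd_parts_distinct \<pi>}"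

lemma finite_odd_distinct_of [simp]: "finite (odd_distinct_of n)"
  using finite_partitions_of by (simp add: odd_distinct_of_def)

lemma M2_rank_sums:
  assumes q: "norm (q::complex) < 1" "q \<noteq> 0" and y: "norm y = 1"
  shows "(\<lambda>n. (\<Sum>\<pi>\<in>odd_distinct_of n. y powi M2_rank \<pi>) * q ^ n) sums rank_series (- q) y"
proof (rule has_sum_imp_sums[OF has_sum_fibres[OF has_sum_M2_rank[OF assms]]])
  show "((\<lambda>\<pi>. y powi M2_rank \<pi> * q ^ sum_mset \<pi>) has_sum
      (\<Sum>\<pi>\<in>odd_distinct_of n. y powi M2_rank \<pi>) * q ^ n) {\<pi> \<in> odd_distinct_partitions. sum_mset \<pi> = n}" for n
  proof -
    have "{\<pi> \<in> odd_distinct_partitions. sum_mset \<pi> = n} = odd_distinct_of n"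
      by (auto simp: odd_distinct_partitions_def odd_distinct_of_def partitions_of_def)
    moreover have "(\<Sum>\<pi>\<in>odd_distinct_of n. y powi M2_rank \<pi>) * q ^ n =
        (\<Sum>\<pi>\<in>odd_distinct_of n. y powi M2_rank \<pi> * q ^ sum_mset \<pi>)"
      unfolding sum_distrib_right
      by (rule sum.cong) (auto simp: odd_distinct_of_def partitions_of_def)
    ultimately show ?thesis
      by (simp add: has_sum_finiteI)
  qed
qed

lemma cis_root_power:
  assumes "M > 0"
  shows "(cis (2 * pi / real M) ^ k) ^ M = 1"
proof -
  have "cis (2 * pi / real M) ^ M = 1"
    unfolding Complex.DeMoivre using assms by simp
  then show ?thesis
    by (metis power_mult mult.commute power_one)
qed

lemma cis_root_power_neq_1:
  assumes "0 < k" "k < M"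
  shows "cis (2 * pi / real M) ^ k \<noteq> 1"
proof -
  have "cis (2 * pi / real M) ^ k = exp (2 * of_real pi * \<i> * of_nat k / of_nat M)"
    unfolding Complex.DeMoivre unfolding cis_conv_exp by (simp add: mult_ac)
  then show ?thesis
    using complex_root_unity_eq_1[of M k] assms by (auto dest: dvd_imp_le)
qed

lemma unity_root_filter:
  fixes r :: int
  assumes "M > 0"
  defines "\<omega> \<equiv> cis (2 * pi / real M)"
  shows "(\<Sum>k<M. (\<omega> ^ k) powi r) = (if int M dvd r then of_nat M else 0)"
proof -
  have \<omega>M: "\<omega> ^ M = 1"
    using cis_root_power[OF assms(1), of 1] by (simp add: \<omega>_def)
  have \<omega>0: "\<omega> \<noteq> 0"
    by (simp add: \<omega>_def)
  have \<omega>r: "\<omega> powi r = \<omega> ^ nat (r mod int M)"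
  proof -
    have "\<omega> powi r = \<omega> powi (int M * (r div int M) + int (nat (r mod int M)))"
      using assms by simp
    also have "\<dots> = \<omega> ^ nat (r mod int M)"
      unfolding power_int_add[OF disjI1[OF \<omega>0]] power_int_mult power_int_of_nat \<omega>M by simp
    finally show ?thesis .
  qed
  have powi_pow: "(\<omega> ^ k) powi r = (\<omega> powi r) ^ k" for k
    by (metis mult.commute power_int_mult power_int_of_nat)
  show ?thesis
  proof (cases "int M dvd r")
    case True
    then show ?thesis
      unfolding powi_pow \<omega>r by (simp add: dvd_imp_mod_0)
  next
    case False
    define j where "j = nat (r mod int M)"
    have j: "0 < j" "j < M"
      using False assms by (auto simp: j_def dvd_eq_mod_eq_0 nat_less_iff)
         (metis pos_mod_sign of_nat_0_less_iff order_le_less)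
    have "\<omega> powi r \<noteq> 1"
      using cis_root_power_neq_1[OF j, folded \<omega>_def] unfolding \<omega>r j_def[symmetric] .
    moreover have "(\<omega> powi r) ^ M = 1"
      unfolding \<omega>r by (metis \<omega>M power_mult mult.commute power_one)
    ultimately show ?thesis
      unfolding powi_pow using False geometric_sum[of "\<omega> powi r" M] by simp
  qed
qed

text \<open>The root 1 contributes \<open>p_o n\<close>, which the subtraction of
  \<open>p_o n / M\<close> removes. Hence the sum starts at \<open>k = 1\<close>, and the rank
  series is never evaluated at \<open>y = 1\<close>.\<close>

lemma D_2_eq:
  assumes M: "M \<ge> 1" and q: "norm q < 1" "q \<noteq> 0"
  defines "\<omega> \<equiv> cis (2 * pi / real M)"
  shows "D_2 a M q = (\<Sum>k\<in>{1..<M}. (\<omega> ^ k) powi (- int a) * rank_series (- q) (\<omega> ^ k)) / of_nat M"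
proof -
  have norm\<omega>: "norm (\<omega> ^ k) = 1" for k
    by (simp add: \<omega>_def norm_power)
  have \<omega>0: "\<omega> \<noteq> 0"
    by (simp add: \<omega>_def)
  let ?c = "\<lambda>k n. \<Sum>\<pi>\<in>odd_distinct_of n. (\<omega> ^ k) powi M2_rank \<pi>"
  have coeff: "of_nat (N_2 a M n) - of_nat (p_o n) / of_nat M =
      (\<Sum>k\<in>{1..<M}. (\<omega> ^ k) powi (- int a) * ?c k n) / of_nat M" for n
  proof -
    have "(\<Sum>k<M. (\<omega> ^ k) powi (- int a) * ?c k n) =
        (\<Sum>\<pi>\<in>odd_distinct_of n. \<Sum>k<M. (\<omega> ^ k) powi (M2_rank \<pi> - int a))"
      using \<omega>0 by (subst sum.swap) (simp add: sum_distrib_left power_int_diff power_int_minus field_simps)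
    also have "\<dots> = (\<Sum>\<pi>\<in>odd_distinct_of n. if [M2_rank \<pi> = int a] (mod int M) then of_nat M else 0)"
      unfolding \<omega>_def using M by (subst unity_root_filter) (simp_all add: cong_iff_dvd_diff)
    also have "\<dots> = of_nat (card {\<pi> \<in> odd_distinct_of n. [M2_rank \<pi> = int a] (mod int M)}) * of_nat M"
      by (subst sum.inter_filter[symmetric]) simp_all
    also have "{\<pi> \<in> odd_distinct_of n. [M2_rank \<pi> = int a] (mod int M)} =
        {p \<in> partitions_of n. odd_parts_distinct p \<and> [M2_rank p = int a] (mod int M)}"
      by (auto simp: odd_distinct_of_def)
    also have "of_nat (card \<dots>) * of_nat M = of_nat (N_2 a M n) * (of_nat M :: complex)"
      by (simp add: N_2_def)
    finally have "(\<Sum>k<M. (\<omega> ^ k) powi (- int a) * ?c k n) = of_nat (N_2 a M n) * of_nat M" .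
    moreover have "{..<M} = insert 0 {1..<M}"
      using M by auto
    ultimately have "of_nat (p_o n) + (\<Sum>k\<in>{1..<M}. (\<omega> ^ k) powi (- int a) * ?c k n) =
        of_nat (N_2 a M n) * of_nat M"
      by (simp add: p_o_def odd_distinct_of_def)
    then show ?thesis
      using M by (simp add: field_simps)
  qed
  have "(\<lambda>n. (\<Sum>k\<in>{1..<M}. (\<omega> ^ k) powi (- int a) * (?c k n * q ^ n)) / of_nat M) sums
      ((\<Sum>k\<in>{1..<M}. (\<omega> ^ k) powi (- int a) * rank_series (- q) (\<omega> ^ k)) / of_nat M)"
    by (intro sums_divide sums_sum sums_mult M2_rank_sums q norm\<omega>)
  moreover have "(\<Sum>k\<in>{1..<M}. (\<omega> ^ k) powi (- int a) * ?c k n) / of_nat M * q ^ n =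
      (\<Sum>k\<in>{1..<M}. (\<omega> ^ k) powi (- int a) * (?c k n * q ^ n)) / of_nat M" for n
    by (simp only: times_divide_eq_left sum_distrib_right mult.assoc)
  ultimately show ?thesis
    unfolding D_2_def coeff by (simp only: sums_iff)
qed

section \<open>Dissection modulo \<open>M\<close>\<close>

lemma two_triangular: "2 * (r * (r - 1) div 2) = r * (r - 1 :: int)"
  by (rule dvd_mult_div_cancel) auto

lemma two_choose_two: "2 * int (M choose 2) = int M * (int M - 1)"
proof -
  have "even (M * (M - 1))"
    by (cases M) auto
  then have "2 * (M choose 2) = M * (M - 1)"
    unfolding choose_two by (rule dvd_mult_div_cancel)
  then have "2 * int (M choose 2) = int (M * (M - 1))"
    by (metis of_nat_mult of_nat_numeral)
  then show ?thesis
    by (cases M) (auto simp: algebra_simps)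
qed

lemma has_sum_finite_sum:
  fixes f :: "'i \<Rightarrow> 'a \<Rightarrow> complex"
  assumes "finite I" "\<And>i. i \<in> I \<Longrightarrow> (f i has_sum S i) A"
  shows "((\<lambda>x. \<Sum>i\<in>I. f i x) has_sum (\<Sum>i\<in>I. S i)) A"
  using assms by (induction I rule: finite_induct) (auto intro!: has_sum_add)

text \<open>The classes are those of \<open>r - 1\<close>, the exponent in the Lambert denominators;
  \<open>k - 1\<close> keeps the same shift in the dissected series.\<close>

lemma has_sum_residue_classes:
  fixes f :: "int \<Rightarrow> complex"
  assumes M: "M > 0" and sums: "\<And>t. t < M \<Longrightarrow> (h t has_sum S t) UNIV"
    and f: "\<And>k t. t < M \<Longrightarrow> f (int M * (k - 1) + int t + 1) = h t k"
  shows "(f has_sum (\<Sum>t<M. S t)) UNIV"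
proof -
  define B where "B t = {r. (r - 1) mod int M = int t}" for t
  have "(f has_sum (\<Sum>t<M. S t)) (\<Union>t\<in>{..<M}. B t)"
  proof (rule sum_has_sum)
    show "(f has_sum S t) (B t)" if "t \<in> {..<M}" for t
    proof (rule has_sum_reindex_bij_witness[where j = "\<lambda>k. int M * (k - 1) + int t + 1"
          and i = "\<lambda>r. (r - 1) div int M + 1", THEN iffD1, OF _ _ _ _ _ refl sums[of t]])
      show "(int M * (k - 1) + int t + 1 - 1) div int M + 1 = k" for k
        using that by simp
      show "int M * (k - 1) + int t + 1 \<in> B t" for k
        using that by (simp add: B_def)
      show "int M * ((r - 1) div int M + 1 - 1) + int t + 1 = r" if "r \<in> B t" for r
        using that mult_div_mod_eq[of "int M" "r - 1"] by (simp add: B_def)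
      show "f (int M * (k - 1) + int t + 1) = h t k" for k
        using f that by simp
    qed (use that in auto)
    show "B t \<inter> B t' = {}" if "t \<noteq> t'" for t t'
      using that by (auto simp: B_def)
  qed auto
  also have "(\<Union>t\<in>{..<M}. B t) = UNIV"
  proof (intro equalityI subsetI UNIV_I)
    fix r :: int
    have "nat ((r - 1) mod int M) < M" "int (nat ((r - 1) mod int M)) = (r - 1) mod int M"
      using M by (simp_all add: nat_less_iff)
    then show "r \<in> (\<Union>t\<in>{..<M}. B t)"
      unfolding B_def by (intro UN_I[of "nat ((r - 1) mod int M)"]) auto
  qed
  finally show ?thesis .
qed

text \<open>Expanding \<open>1 / (1 - \<zeta> * v)\<close> over the common denominator
  \<open>1 - v ^ M\<close>, the filter keeps the exponents congruent to \<open>a\<close> and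
  \<open>a - 1\<close>. For \<open>a = 0\<close> the second one is \<open>M - 1\<close> instead of
  \<open>-1\<close>, whence the extra \<open>1 / v\<close>.\<close>

lemma roots_of_unity_partial_fraction:
  assumes "a < M" and v: "v ^ M \<noteq> 1" "v \<noteq> 0"
  defines "\<omega> \<equiv> cis (2 * pi / real M)"
  shows "(\<Sum>k<M. (\<omega> ^ k) powi (- int a) * (1 - \<omega> ^ k) / (1 - \<omega> ^ k * v)) / of_nat M =
    (v powi int a - v powi (int a - 1)) / (1 - v ^ M) + (if a = 0 then 1 / v else 0)"
proof -
  have M: "M > 0"
    using assms(1) by simp
  have \<omega>0: "\<omega> ^ k \<noteq> 0" for k
    by (simp add: \<omega>_def)
  have \<omega>M: "(\<omega> ^ k) ^ M = 1" for k
    unfolding \<omega>_def by (rule cis_root_power[OF M])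
  have geo: "1 / (1 - \<omega> ^ k * v) = (\<Sum>s<M. (\<omega> ^ k * v) ^ s) / (1 - v ^ M)" for k
  proof -
    have "(\<omega> ^ k * v) ^ M = v ^ M"
      by (simp add: power_mult_distrib \<omega>M)
    with v have "\<omega> ^ k * v \<noteq> 1"
      by (metis power_one)
    with \<open>(\<omega> ^ k * v) ^ M = v ^ M\<close> v show ?thesis
      using geometric_sum[of "\<omega> ^ k * v" M] by (simp add: field_simps)
  qed
  have "(\<Sum>k<M. (\<omega> ^ k) powi (- int a) * (1 - \<omega> ^ k) * (\<Sum>s<M. (\<omega> ^ k * v) ^ s)) =
      (\<Sum>s<M. v ^ s * ((\<Sum>k<M. (\<omega> ^ k) powi (int s - int a)) - (\<Sum>k<M. (\<omega> ^ k) powi (int s + 1 - int a))))"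
    unfolding sum_distrib_left sum_subtractf[symmetric]
  proof (subst sum.swap, intro sum.cong refl)
    fix s k
    have "(\<omega> ^ k) powi (int s + 1 - int a) = \<omega> ^ k * (\<omega> ^ k) powi (int s - int a)"
      using power_int_add_1'[of "\<omega> ^ k" "int s - int a"] \<omega>0 by (simp add: algebra_simps)
    moreover have "(\<omega> ^ k) powi (int s - int a) = (\<omega> ^ k) powi (- int a) * (\<omega> ^ k) ^ s"
      using power_int_add[of "\<omega> ^ k" "- int a" "int s"] \<omega>0 by simp
    ultimately show "(\<omega> ^ k) powi (- int a) * (1 - \<omega> ^ k) * (\<omega> ^ k * v) ^ s =
        v ^ s * ((\<omega> ^ k) powi (int s - int a) - (\<omega> ^ k) powi (int s + 1 - int a))"
      by (simp add: power_mult_distrib algebra_simps)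
  qed
  also have "\<dots> = (\<Sum>s<M. v ^ s * ((if s = a then of_nat M else 0)
      - (if s = (if a = 0 then M - 1 else a - 1) then of_nat M else 0)))"
  proof (intro sum.cong refl)
    fix s assume s: "s \<in> {..<M}"
    have small: "int M dvd d \<longleftrightarrow> d = 0" if "\<bar>d\<bar> < int M" for d
      using that dvd_imp_le_int[of d "int M"] by (cases "d = 0") auto
    have "int M dvd int s - int a \<longleftrightarrow> s = a"
      using s assms(1) small[of "int s - int a"] by auto
    moreover have "int M dvd int s + 1 - int a \<longleftrightarrow> s = (if a = 0 then M - 1 else a - 1)"
    proof (cases "a = 0 \<and> s = M - 1")
      case True
      then show ?thesis
        using M by simp
    next
      case False
      then have "\<bar>int s + 1 - int a\<bar> < int M"
        using s assms(1) by auto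
      from small[OF this] False show ?thesis
        by auto
    qed
    ultimately show "v ^ s * ((\<Sum>k<M. (\<omega> ^ k) powi (int s - int a)) - (\<Sum>k<M. (\<omega> ^ k) powi (int s + 1 - int a))) =
        v ^ s * ((if s = a then of_nat M else 0)
          - (if s = (if a = 0 then M - 1 else a - 1) then of_nat M else 0))"
      unfolding \<omega>_def unity_root_filter[OF M] by simp
  qed
  also have "\<dots> = of_nat M * (v ^ a - v ^ (if a = 0 then M - 1 else a - 1))"
    using assms(1) M by (auto simp: right_diff_distrib sum_subtractf if_distrib[of "\<lambda>x. _ * x"] cong: if_cong)
  finally have "(\<Sum>k<M. (\<omega> ^ k) powi (- int a) * (1 - \<omega> ^ k) / (1 - \<omega> ^ k * v)) =
      of_nat M * (v ^ a - v ^ (if a = 0 then M - 1 else a - 1)) / (1 - v ^ M)"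
    using geo by (simp add: divide_inverse sum_distrib_right[symmetric] mult.assoc[symmetric])
  then have "(\<Sum>k<M. (\<omega> ^ k) powi (- int a) * (1 - \<omega> ^ k) / (1 - \<omega> ^ k * v)) / of_nat M =
      (v ^ a - v ^ (if a = 0 then M - 1 else a - 1)) / (1 - v ^ M)"
    using M by simp
  also have "\<dots> = (v powi int a - v powi (int a - 1)) / (1 - v ^ M) + (if a = 0 then 1 / v else 0)"
  proof (cases "a = 0")
    case True
    have "v ^ M = v * v ^ (M - 1)"
      using M by (metis Suc_diff_1 power_Suc)
    then show ?thesis
      using True v by (simp add: field_simps power_int_minus)
  next
    case False
    then obtain b where "a = Suc b"
      by (metis not0_implies_Suc)
    then show ?thesis
      by (simp flip: power_int_of_nat)
  qed
  finally show ?thesis .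
qed

text \<open>The unit \<open>u = \<i>\<^bsup>1/M\<^esup>\<close> serves as an auxiliary argument: no \<open>u * \<zeta>\<close> with \<open>\<zeta> ^ M = 1\<close> is an integral
  power of the nome, so that no term of the dissection below has a pole.\<close>

definition aux_unit :: "nat \<Rightarrow> complex" where
  "aux_unit M = cis (pi / (2 * real M))"

lemma aux_unit_power:
  assumes "M \<ge> 1"
  shows "aux_unit M ^ M = \<i>"
proof -
  have "aux_unit M ^ M = cis (pi / 2)"
    unfolding aux_unit_def Complex.DeMoivre using assms by (simp add: field_simps)
  then show ?thesis
    by simp
qed

lemma norm_aux_unit [simp]: "norm (aux_unit M) = 1" and aux_unit_nonzero [simp]: "aux_unit M \<noteq> 0"
  by (simp_all add: aux_unit_def)

text \<open>Writing \<open>r - 1 = M * (k - 1) + t\<close> with \<open>0 \<le> t < M\<close> turns the part of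
  \<open>\<Sum>r. jtheta_term (- u) p r * (u * p powi (r - 1)) powi s / (1 - (u * p powi (r - 1)) ^ M)\<close> with a fixed \<open>t\<close> into
  \<open>dissect_coeff M p s t\<close> times the Appell--Lerch series at \<open>z = dissect_z M p s t\<close> with nome \<open>p ^ M\<^sup>2\<close>.
  The corresponding \<open>x\<close> does not depend on \<open>t\<close>.\<close>

definition dissect_z :: "nat \<Rightarrow> complex \<Rightarrow> int \<Rightarrow> nat \<Rightarrow> complex" where
  "dissect_z M p s t = - \<i> * p powi (int M * (int t + s) - int (M choose 2))"

definition dissect_coeff :: "nat \<Rightarrow> complex \<Rightarrow> int \<Rightarrow> nat \<Rightarrow> complex" where
  "dissect_coeff M p s t = aux_unit M powi (s + 1 + int t - int M) *
     p powi ((int t - int M + 1) * (int t - int M) div 2 + (int t - int M) * s)"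

definition dissect_x :: "nat \<Rightarrow> complex \<Rightarrow> int \<Rightarrow> complex" where
  "dissect_x M p s = - (p powi (int (M choose 2) - int M * s))"

text \<open>The theta quotients left over when every \<open>dissect_z M p s t\<close> is moved to
  the common \<open>z\<close> by \<open>lambert_change_z\<close>.\<close>

definition dissect_error :: "complex \<Rightarrow> nat \<Rightarrow> int \<Rightarrow> complex \<Rightarrow> complex" where
  "dissect_error p M s z = (\<Sum>t<M. dissect_coeff M p s t *
     (- dissect_z M p s t * qpoch_inf (p ^ M\<^sup>2) (p ^ M\<^sup>2) ^ 3 * jtheta (z / dissect_z M p s t) (p ^ M\<^sup>2) *
        jtheta (dissect_x M p s * z * dissect_z M p s t) (p ^ M\<^sup>2) /
        (jtheta (dissect_x M p s * z) (p ^ M\<^sup>2) * jtheta (dissect_x M p s * dissect_z M p s t) (p ^ M\<^sup>2)))) /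
     (jtheta z (p ^ M\<^sup>2) * jtheta (- aux_unit M) p)"

text \<open>The first summand comes from moving \<open>z = -1\<close> to
  \<open>- aux_unit M\<close>, the second is the theta quotient of
  \<open>rank_series_eq\<close>.\<close>

definition rank_error :: "complex \<Rightarrow> nat \<Rightarrow> complex \<Rightarrow> complex" where
  "rank_error p M y = qpoch_inf p p ^ 3 * jtheta (aux_unit M) p * jtheta (- y * aux_unit M) p /
     (jtheta (y * aux_unit M) p * jtheta y p * jtheta (- aux_unit M) p * jtheta (-1) p) +
     qpoch_inf p p ^ 3 / (jtheta (-1) p * jtheta y p)"

section \<open>The dissected series and its Appell--Lerch form\<close>

context
  fixes p :: complex and M :: nat
  assumes p: "norm p < 1" "p \<noteq> 0" and M: "M \<ge> 1"
begin

lemma nome_bounds: "norm (p ^ M\<^sup>2) < 1" "p ^ M\<^sup>2 \<noteq> 0"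
  using p M by (simp_all add: norm_power power_less_one_iff)

lemma nome_power_int: "(p ^ M\<^sup>2) powi m = p powi ((int M)\<^sup>2 * m)"
  by (metis of_nat_power power_int_mult power_int_of_nat)

lemma power_M_not_power_int:
  assumes "x ^ M \<noteq> 1" "norm x = 1"
  shows "x \<noteq> p powi n"
proof
  assume x: "x = p powi n"
  with assms(2) have "n = 0"
    using norm_power_int_eq_1_imp[OF p] by simp
  with x assms(1) show False
    by simp
qed

lemma lambert_denominator_power:
  "(aux_unit M * p powi n) ^ M = \<i> * p powi (int M * n)"
  by (simp add: power_mult_distrib aux_unit_power[OF M] mult.commute[of "int M"] power_int_mult power_int_of_nat)

text \<open>The norm forces \<open>int M * n = 0\<close>, and then the power is
  \<open>\<i>\<close>.\<close>

lemma lambert_denominator_power_neq_1: "(aux_unit M * p powi n) ^ M \<noteq> 1"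
proof
  assume *: "(aux_unit M * p powi n) ^ M = 1"
  then have "norm (p powi (int M * n)) = 1"
    unfolding lambert_denominator_power
    by (metis mult_1 norm_ii norm_mult norm_one)
  then have "int M * n = 0"
    by (rule norm_power_int_eq_1_imp[OF p])
  with * show False
    unfolding lambert_denominator_power by (simp add: complex_eq_iff)
qed

text \<open>Since \<open>\<i>\<close> is \<open>aux_unit M ^ M\<close>, both sides are a power of
  \<open>aux_unit M\<close> times a power of \<open>p\<close>. The exponents of \<open>p\<close> are
  compared after doubling, which removes the divisions by 2.\<close>

lemma dissect_term:
  assumes "n = int M * (k - 1) + int t"
  shows "jtheta_term (- aux_unit M) p (n + 1) * (aux_unit M * p powi n) powi s =
    dissect_coeff M p s t * jtheta_term (dissect_z M p s t) (p ^ M\<^sup>2) k"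
proof -
  let ?u = "aux_unit M" and ?\<tau> = "int t - int M"
  have n: "n = int M * k + ?\<tau>"
    using assms by (simp add: algebra_simps)
  have "jtheta_term (- ?u) p (n + 1) = ?u powi (n + 1) * p powi ((n + 1) * n div 2)"
    by (simp add: jtheta_term_def mult_ac flip: power_int_mult_distrib)
  then have lhs: "jtheta_term (- ?u) p (n + 1) * (?u * p powi n) powi s =
      ?u powi (n + 1 + s) * p powi ((n + 1) * n div 2 + n * s)"
    using p by (simp add: power_int_mult_distrib power_int_add power_int_mult)
  have "jtheta_term (dissect_z M p s t) (p ^ M\<^sup>2) k =
      (\<i> * p powi (int M * (int t + s) - int (M choose 2))) powi k * (p ^ M\<^sup>2) powi (k * (k - 1) div 2)"
    by (simp add: jtheta_term_def dissect_z_def mult_ac flip: power_int_mult_distrib)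
  also have "\<i> = ?u powi int M"
    by (simp add: aux_unit_power[OF M])
  also have "(?u powi int M * p powi (int M * (int t + s) - int (M choose 2))) powi k *
      (p ^ M\<^sup>2) powi (k * (k - 1) div 2) =
      ?u powi (int M * k) * p powi ((int M * (int t + s) - int (M choose 2)) * k + (int M)\<^sup>2 * (k * (k - 1) div 2))"
    using p by (simp add: power_int_mult_distrib power_int_add power_int_mult flip: power_int_of_nat)
  finally have rhs: "dissect_coeff M p s t * jtheta_term (dissect_z M p s t) (p ^ M\<^sup>2) k =
      ?u powi ((s + 1 + ?\<tau>) + int M * k) *
      p powi (((?\<tau> + 1) * ?\<tau> div 2 + ?\<tau> * s) +
        ((int M * (int t + s) - int (M choose 2)) * k + (int M)\<^sup>2 * (k * (k - 1) div 2)))"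
    using p by (simp add: dissect_coeff_def power_int_add mult_ac add_diff_eq)
  define T1 T2 T3 C where T: "T1 = (n + 1) * n div 2" "T2 = (?\<tau> + 1) * ?\<tau> div 2" "T3 = k * (k - 1) div 2"
    "C = int (M choose 2)"
  have "2 * T1 = (n + 1) * n" "2 * T2 = (?\<tau> + 1) * ?\<tau>" "2 * T3 = k * (k - 1)" "2 * C = int M * (int M - 1)"
    using two_triangular[of "n + 1"] two_triangular[of "?\<tau> + 1"] two_triangular[of k] two_choose_two[of M]
    by (simp_all add: T)
  with n have "2 * (T1 + n * s) = 2 * ((T2 + ?\<tau> * s) + ((int M * (int t + s) - C) * k + (int M)\<^sup>2 * T3))"
    by algebra
  then have "(n + 1) * n div 2 + n * s = ((?\<tau> + 1) * ?\<tau> div 2 + ?\<tau> * s) +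
        ((int M * (int t + s) - int (M choose 2)) * k + (int M)\<^sup>2 * (k * (k - 1) div 2))"
    unfolding T by simp
  moreover have "n + 1 + s = (s + 1 + ?\<tau>) + int M * k"
    by (simp add: n)
  ultimately show ?thesis
    unfolding lhs rhs by (simp only:)
qed

text \<open>The shift \<open>s\<close> cancels, and what remains is a power of \<open>p\<close>
  turned by \<open>\<i>\<close>; this excludes poles for all \<open>s\<close> and
  \<open>t\<close>.\<close>

lemma dissect_xz: "dissect_x M p s * dissect_z M p s t = \<i> * p powi (int M * int t)"
  using p by (simp add: dissect_x_def dissect_z_def ring_distribs flip: power_int_add)

lemma dissect_xz_not_power: "dissect_x M p s * dissect_z M p s t \<noteq> (p ^ M\<^sup>2) powi n"
proof
  assume "dissect_x M p s * dissect_z M p s t = (p ^ M\<^sup>2) powi n"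
  then have "\<i> * p powi (int M * int t) = p powi (int (M\<^sup>2) * n)"
    unfolding dissect_xz by (simp only: power_int_mult power_int_of_nat)
  then have *: "\<i> = p powi (int (M\<^sup>2) * n - int M * int t)"
    using p by (simp add: power_int_diff field_simps)
  then have "norm (p powi (int (M\<^sup>2) * n - int M * int t)) = 1"
    by (metis norm_ii)
  then have "int (M\<^sup>2) * n - int M * int t = 0"
    by (rule norm_power_int_eq_1_imp[OF p])
  with * show False
    by (simp add: complex_eq_iff)
qed

lemma dissect_z_nonzero: "dissect_z M p s t \<noteq> 0" and dissect_x_nonzero: "dissect_x M p s \<noteq> 0"
  using p by (simp_all add: dissect_z_def dissect_x_def)

lemma has_sum_dissected:
  "((\<lambda>r. jtheta_term (- aux_unit M) p r * (aux_unit M * p powi (r - 1)) powi s /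
      (1 - (aux_unit M * p powi (r - 1)) ^ M)) has_sum
    (\<Sum>t<M. dissect_coeff M p s t * lambert (p ^ M\<^sup>2) (dissect_z M p s t)
      (dissect_x M p s * dissect_z M p s t))) UNIV"
proof (rule has_sum_residue_classes)
  fix t assume "t < M"
  show "((\<lambda>k. dissect_coeff M p s t * (jtheta_term (dissect_z M p s t) (p ^ M\<^sup>2) k /
      (1 - (p ^ M\<^sup>2) powi (k - 1) * (dissect_x M p s * dissect_z M p s t)))) has_sum
    dissect_coeff M p s t * lambert (p ^ M\<^sup>2) (dissect_z M p s t) (dissect_x M p s * dissect_z M p s t)) UNIV"
    using dissect_z_nonzero dissect_x_nonzero dissect_xz_not_power
    by (intro has_sum_cmult_right has_sum_lambert nome_bounds) auto
  fix k
  let ?n = "int M * (k - 1) + int t"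
  have "(p ^ M\<^sup>2) powi (k - 1) * (\<i> * p powi (int M * int t)) = \<i> * p powi (int M * ?n)"
  proof -
    have "int M * ?n = (int M)\<^sup>2 * (k - 1) + int M * int t"
      by (simp add: algebra_simps power2_eq_square)
    then show ?thesis
      using p by (simp only: nome_power_int power_int_add mult_ac simp_thms)
  qed
  then show "jtheta_term (- aux_unit M) p (?n + 1) * (aux_unit M * p powi (?n + 1 - 1)) powi s /
      (1 - (aux_unit M * p powi (?n + 1 - 1)) ^ M) =
    dissect_coeff M p s t * (jtheta_term (dissect_z M p s t) (p ^ M\<^sup>2) k /
      (1 - (p ^ M\<^sup>2) powi (k - 1) * (dissect_x M p s * dissect_z M p s t)))"
    unfolding dissect_xz add_diff_cancel_right' lambert_denominator_power
    by (simp add: dissect_term[OF refl])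
qed (use M in auto)

text \<open>Summing over \<open>t\<close> undoes the dissection of the series without Lambert
  denominators, and \<open>r = m - s\<close> turns that into a theta series. The power of
  \<open>p\<close> split off becomes the prefactor of the Appell--Lerch sum.\<close>

lemma sum_dissected_jtheta:
  "(\<Sum>t<M. dissect_coeff M p s t * jtheta (dissect_z M p s t) (p ^ M\<^sup>2)) =
    p powi (- ((s + 1) * s div 2)) * jtheta (- aux_unit M) p"
proof (rule has_sum_unique)
  let ?f = "\<lambda>r. jtheta_term (- aux_unit M) p r * (aux_unit M * p powi (r - 1)) powi s"
  show "(?f has_sum (\<Sum>t<M. dissect_coeff M p s t * jtheta (dissect_z M p s t) (p ^ M\<^sup>2))) UNIV"
  proof (rule has_sum_residue_classes)
    show "((\<lambda>k. dissect_coeff M p s t * jtheta_term (dissect_z M p s t) (p ^ M\<^sup>2) k) has_sum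
        dissect_coeff M p s t * jtheta (dissect_z M p s t) (p ^ M\<^sup>2)) UNIV" for t
      by (intro has_sum_cmult_right jacobi_triple_product nome_bounds dissect_z_nonzero)
  qed (use M in \<open>auto simp: dissect_term\<close>)
  have shift: "?f (m - s) = p powi (- ((s + 1) * s div 2)) * jtheta_term (- aux_unit M) p m" for m
  proof -
    have term_eq: "jtheta_term (- aux_unit M) p r = aux_unit M powi r * p powi (r * (r - 1) div 2)" for r
      by (simp add: jtheta_term_def mult_ac flip: power_int_mult_distrib)
    have "2 * ((m - s) * (m - s - 1) div 2 + (m - s - 1) * s) = 2 * (- ((s + 1) * s div 2) + m * (m - 1) div 2)"
      using two_triangular[of "m - s"] two_triangular[of "s + 1"] two_triangular[of m]
      by (simp add: ring_distribs)
    then have "(m - s) * (m - s - 1) div 2 + (m - s - 1) * s = - ((s + 1) * s div 2) + m * (m - 1) div 2"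
      by simp
    then have "p powi ((m - s) * (m - s - 1) div 2) * p powi ((m - s - 1) * s) =
        p powi (- ((s + 1) * s div 2)) * p powi (m * (m - 1) div 2)"
      by (simp only: power_int_add[OF disjI1[OF p(2)], symmetric])
    note exponents = this
    have "?f (m - s) = (aux_unit M powi (m - s) * aux_unit M powi s) *
        (p powi ((m - s) * (m - s - 1) div 2) * p powi ((m - s - 1) * s))"
      unfolding term_eq by (simp add: power_int_mult_distrib power_int_mult)
    also have "aux_unit M powi (m - s) * aux_unit M powi s = aux_unit M powi m"
      by (simp flip: power_int_add)
    finally show ?thesis
      unfolding exponents term_eq by (simp only: mult_ac)
  qed
  have "((\<lambda>m. ?f (m - s)) has_sum p powi (- ((s + 1) * s div 2)) * jtheta (- aux_unit M) p) UNIV"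
    unfolding shift by (intro has_sum_cmult_right jacobi_triple_product p) auto
  then show "(?f has_sum p powi (- ((s + 1) * s div 2)) * jtheta (- aux_unit M) p) UNIV"
    by (rule has_sum_reindex_bij_witness[of _ "\<lambda>m. m + s" "\<lambda>m. m - s", THEN iffD1, rotated -1]) auto
qed

lemma aux_theta_nonzero: "jtheta (- aux_unit M) p \<noteq> 0"
proof -
  have "- aux_unit M \<noteq> p powi n" for n
  proof
    assume *: "- aux_unit M = p powi n"
    then have "norm (p powi n) = 1"
      by (metis norm_aux_unit norm_minus_cancel)
    then have "n = 0"
      by (rule norm_power_int_eq_1_imp[OF p])
    with * have "aux_unit M = -1"
      by (simp add: minus_equation_iff)
    with aux_unit_power[OF M] have "(-1) ^ M = \<i>"
      by simp
    then show False
      by (cases "even M") (auto simp: complex_eq_iff)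
  qed
  then show ?thesis
    using jtheta_eq_0_iff[OF p, of "- aux_unit M"] by auto
qed

text \<open>After the change of \<open>z\<close> the quotient of \<open>lambert\<close> and
  \<open>jtheta\<close> at \<open>z\<close> is common to all \<open>t\<close>, so its coefficient is
  the sum evaluated in \<open>sum_dissected_jtheta\<close>.\<close>

lemma dissected_eq_appell_lerch:
  assumes "appell_lerch_defined (dissect_x M p s) (p ^ M\<^sup>2) z"
  shows "(\<Sum>t<M. dissect_coeff M p s t * lambert (p ^ M\<^sup>2) (dissect_z M p s t)
      (dissect_x M p s * dissect_z M p s t)) / jtheta (- aux_unit M) p =
    p powi (- ((s + 1) * s div 2)) * appell_lerch (dissect_x M p s) (p ^ M\<^sup>2) z + dissect_error p M s z"
proof -
  let ?Q = "p ^ M\<^sup>2" and ?x = "dissect_x M p s" and ?z = "dissect_z M p s"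
  let ?e = "\<lambda>t. - ?z t * qpoch_inf ?Q ?Q ^ 3 * jtheta (z / ?z t) ?Q * jtheta (?x * z * ?z t) ?Q /
        (jtheta (?x * z) ?Q * jtheta (?x * ?z t) ?Q)"
  have z: "z \<noteq> 0" "\<And>n::int. z \<noteq> ?Q powi n" "\<And>n::int. ?x * z \<noteq> ?Q powi n"
    using assms by (auto simp: appell_lerch_defined_def)
  have jz: "jtheta z ?Q \<noteq> 0"
    using jtheta_eq_0_iff[OF nome_bounds z(1)] z(2) by auto
  have "lambert ?Q (?z t) (?x * ?z t) = lambert ?Q z (?x * z) / jtheta z ?Q * jtheta (?z t) ?Q + ?e t / jtheta z ?Q" for t
    using lambert_change_z[OF nome_bounds z(1,2) dissect_z_nonzero[of s t] dissect_x_nonzero[of s] z(3)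
        dissect_xz_not_power[of s t]] jz
    by (simp add: field_simps)
  then have "(\<Sum>t<M. dissect_coeff M p s t * lambert ?Q (?z t) (?x * ?z t)) =
      lambert ?Q z (?x * z) / jtheta z ?Q * (\<Sum>t<M. dissect_coeff M p s t * jtheta (?z t) ?Q) +
      (\<Sum>t<M. dissect_coeff M p s t * ?e t) / jtheta z ?Q"
    by (simp only: ring_distribs sum.distrib sum_distrib_left sum_divide_distrib times_divide_eq_right mult_ac)
  also have "\<dots> = lambert ?Q z (?x * z) / jtheta z ?Q * (p powi (- ((s + 1) * s div 2)) * jtheta (- aux_unit M) p) +
      (\<Sum>t<M. dissect_coeff M p s t * ?e t) / jtheta z ?Q"
    by (simp only: sum_dissected_jtheta)
  finally show ?thesis
    using aux_theta_nonzero by (simp add: dissect_error_def appell_lerch_eq_lambert add_divide_distrib)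
qed

text \<open>The partial fraction is applied in each summand with
  \<open>v = aux_unit M * p powi (r - 1)\<close>, which turns the average into dissected series with
  shifts \<open>a\<close> and \<open>a - 1\<close>.\<close>

lemma lambert_roots_of_unity_average:
  assumes a: "a < M"
  defines "\<omega> \<equiv> cis (2 * pi / real M)"
  shows "(\<Sum>k<M. (\<omega> ^ k) powi (- int a) * (1 - \<omega> ^ k) * lambert p (- aux_unit M) (\<omega> ^ k * aux_unit M)) / of_nat M =
    (\<Sum>t<M. dissect_coeff M p (int a) t * lambert (p ^ M\<^sup>2) (dissect_z M p (int a) t)
      (dissect_x M p (int a) * dissect_z M p (int a) t)) -
    (\<Sum>t<M. dissect_coeff M p (int a - 1) t * lambert (p ^ M\<^sup>2) (dissect_z M p (int a - 1) t)
      (dissect_x M p (int a - 1) * dissect_z M p (int a - 1) t)) +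
    (if a = 0 then jtheta (- aux_unit M) p else 0)"
proof (rule has_sum_unique)
  let ?u = "aux_unit M"
  let ?v = "\<lambda>r. ?u * p powi (r - 1)"
  let ?f = "\<lambda>r. (\<Sum>k<M. (\<omega> ^ k) powi (- int a) * (1 - \<omega> ^ k) *
      (jtheta_term (- ?u) p r / (1 - p powi (r - 1) * (\<omega> ^ k * ?u)))) / of_nat M"
  have \<omega>M: "(\<omega> ^ k) ^ M = 1" for k
    unfolding \<omega>_def by (rule cis_root_power) (use M in simp)
  have "\<omega> ^ k * ?u \<noteq> p powi n" for k n
  proof (rule power_M_not_power_int)
    show "(\<omega> ^ k * ?u) ^ M \<noteq> 1"
      unfolding power_mult_distrib \<omega>M aux_unit_power[OF M] by (simp add: complex_eq_iff)
  qed (simp add: norm_mult norm_power \<omega>_def)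
  then show "(?f has_sum (\<Sum>k<M. (\<omega> ^ k) powi (- int a) * (1 - \<omega> ^ k) *
      lambert p (- ?u) (\<omega> ^ k * ?u)) / of_nat M) UNIV"
    by (intro has_sum_divide_const has_sum_finite_sum has_sum_cmult_right has_sum_lambert p)
       (simp_all add: \<omega>_def)
  have f: "?f r = jtheta_term (- ?u) p r * ?v r powi int a / (1 - ?v r ^ M)
      - jtheta_term (- ?u) p r * ?v r powi (int a - 1) / (1 - ?v r ^ M)
      + (if a = 0 then jtheta_term (- ?u) p r * ?v r powi (-1) else 0)" for r
  proof -
    have "?f r = jtheta_term (- ?u) p r * ((\<Sum>k<M. (\<omega> ^ k) powi (- int a) * (1 - \<omega> ^ k) /
        (1 - \<omega> ^ k * ?v r)) / of_nat M)"
      by (simp add: sum_distrib_left mult_ac)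
    also have "\<dots> = jtheta_term (- ?u) p r * ((?v r powi int a - ?v r powi (int a - 1)) / (1 - ?v r ^ M)
        + (if a = 0 then 1 / ?v r else 0))"
      unfolding \<omega>_def using p
      by (subst roots_of_unity_partial_fraction[OF a lambert_denominator_power_neq_1]) auto
    finally show ?thesis
      by (simp add: ring_distribs diff_divide_distrib power_int_minus divide_inverse)
  qed
  \<comment> \<open>For \<open>a = 0\<close> the extra \<open>1 / v\<close> moves the theta term by
    one index, so its sum is again the full theta series.\<close>
  have "((\<lambda>r. jtheta_term (- ?u) p r * ?v r powi (-1)) has_sum jtheta (- ?u) p) UNIV"
  proof -
    have "jtheta_term (- ?u) p r * ?v r powi (-1) = jtheta_term (- ?u) p (r - 1)" for r
      using jtheta_term_pred[OF p(2), of "- ?u" r] by (simp add: power_int_minus field_simps)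
    moreover have "((\<lambda>r. jtheta_term (- ?u) p (r - 1)) has_sum jtheta (- ?u) p) UNIV"
      by (rule has_sum_reindex_bij_witness[of _ "\<lambda>r. r + 1" "\<lambda>r. r - 1", THEN iffD2,
            OF _ _ _ _ _ _ jacobi_triple_product[OF p]]) auto
    ultimately show ?thesis
      by simp
  qed
  then have "((\<lambda>r. if a = 0 then jtheta_term (- ?u) p r * ?v r powi (-1) else 0) has_sum
      (if a = 0 then jtheta (- ?u) p else 0)) UNIV"
    by simp
  moreover have diff: "((\<lambda>r. jtheta_term (- ?u) p r * ?v r powi int a / (1 - ?v r ^ M)
      - jtheta_term (- ?u) p r * ?v r powi (int a - 1) / (1 - ?v r ^ M)) has_sum
    ((\<Sum>t<M. dissect_coeff M p (int a) t * lambert (p ^ M\<^sup>2) (dissect_z M p (int a) t)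
      (dissect_x M p (int a) * dissect_z M p (int a) t)) -
    (\<Sum>t<M. dissect_coeff M p (int a - 1) t * lambert (p ^ M\<^sup>2) (dissect_z M p (int a - 1) t)
      (dissect_x M p (int a - 1) * dissect_z M p (int a - 1) t)))) UNIV"
    using has_sum_add[OF has_sum_dissected[of "int a"] has_sum_uminusI[OF has_sum_dissected[of "int a - 1"]]]
    by simp
  ultimately show "(?f has_sum
    ((\<Sum>t<M. dissect_coeff M p (int a) t * lambert (p ^ M\<^sup>2) (dissect_z M p (int a) t)
      (dissect_x M p (int a) * dissect_z M p (int a) t)) -
    (\<Sum>t<M. dissect_coeff M p (int a - 1) t * lambert (p ^ M\<^sup>2) (dissect_z M p (int a - 1) t)
      (dissect_x M p (int a - 1) * dissect_z M p (int a - 1) t)) +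
    (if a = 0 then jtheta (- ?u) p else 0))) UNIV"
    unfolding f by (intro has_sum_add)
qed

text \<open>\<open>lambert_change_z\<close> with \<open>z0 = - aux_unit M\<close>,
  \<open>z1 = -1\<close> and \<open>x = - y\<close>, so that \<open>x * z1 = y\<close> and
  \<open>x * z0 = y * aux_unit M\<close>.\<close>

lemma rank_series_at_root_of_unity:
  assumes y: "y ^ M = 1" "y \<noteq> 1" "norm y = 1"
  shows "rank_series p y = (1 - y) * (lambert p (- aux_unit M) (y * aux_unit M) / jtheta (- aux_unit M) p + rank_error p M y)"
proof -
  let ?u = "aux_unit M"
  have y0: "y \<noteq> 0"
    using y by auto
  have yu: "y * ?u \<noteq> p powi n" for n
    by (rule power_M_not_power_int) (simp_all add: power_mult_distrib y aux_unit_power[OF M] norm_mult complex_eq_iff)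
  have yn: "y \<noteq> p powi n" for n
    using norm_power_int_eq_1_imp[OF p, of n] y by auto
  have u: "- ?u \<noteq> p powi n" for n
    using aux_theta_nonzero jtheta_eq_0_iff[OF p, of "- ?u"] by auto
  have j1: "jtheta (-1) p \<noteq> 0"
    using jtheta_eq_0_iff[OF p, of "-1"] minus_one_not_power[OF p] by auto
  have "lambert p (-1) y * jtheta (- ?u) p - lambert p (- ?u) (y * ?u) * jtheta (-1) p =
      qpoch_inf p p ^ 3 * jtheta ?u p * jtheta (- y * ?u) p / (jtheta (y * ?u) p * jtheta y p)"
    using lambert_change_z[OF p, of "- ?u" "-1" "- y"] u yu yn y0 by simp
  then have "lambert p (-1) y / jtheta (-1) p = lambert p (- ?u) (y * ?u) / jtheta (- ?u) p +
      qpoch_inf p p ^ 3 * jtheta ?u p * jtheta (- y * ?u) p / (jtheta (y * ?u) p * jtheta y p) /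
      (jtheta (- ?u) p * jtheta (-1) p)"
    using j1 aux_theta_nonzero by (simp add: field_simps)
  then show ?thesis
    unfolding rank_series_eq[OF p y(3,2)] rank_error_def by (simp add: mult_ac)
qed

end

section \<open>Theta functions\<close>

lemma qpow_of_int: "qpow w (of_int e) = exp w powi e"
  by (simp add: qpow_def exp_power_int)

lemma qpow_add: "qpow w (e + e') = qpow w e * qpow w e'"
  by (simp add: qpow_def of_rat_add ring_distribs exp_add)

section \<open>Closure properties of theta functions\<close>

definition term_mult :: "theta_term \<Rightarrow> theta_term \<Rightarrow> theta_term" where
  "term_mult t t' = \<lparr>coeff = (\<lambda>z0 z1. coeff t z0 z1 * coeff t' z0 z1),
     q_exp = q_exp t + q_exp t', factors = factors t @ factors t'\<rparr>"

lemma term_value_mult: "term_value z0 z1 w (term_mult t t') = term_value z0 z1 w t * term_value z0 z1 w t'"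
  by (simp add: term_value_def term_mult_def qpow_add mult_ac)

lemma sum_list_term_mult:
  "(\<Sum>t\<leftarrow>concat (map (\<lambda>t. map (term_mult t) us) ts). term_value z0 z1 w t) =
    (\<Sum>t\<leftarrow>ts. term_value z0 z1 w t) * (\<Sum>t\<leftarrow>us. term_value z0 z1 w t)"
  by (induction ts) (simp_all add: ring_distribs o_def term_value_mult sum_list_const_mult)

lemma theta_function_on_cong:
  assumes "theta_function_on S F" "\<And>z0 z1 q. (z0, z1, q) \<in> S \<Longrightarrow> F z0 z1 q = G z0 z1 q"
  shows "theta_function_on S G"
proof -
  obtain ts where "\<And>t f. t \<in> set ts \<Longrightarrow> f \<in> set (factors t) \<Longrightarrow> wf_theta_factor f"
    "\<And>z0 z1 q w. (z0, z1, q) \<in> S \<Longrightarrow> exp w = q \<Longrightarrow>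
      (\<forall>t \<in> set ts. \<forall>f \<in> set (factors t). factor_sign f = -1 \<longrightarrow> factor_theta z0 z1 w f \<noteq> 0) \<and>
      F z0 z1 q = (\<Sum>t\<leftarrow>ts. term_value z0 z1 w t)"
    using assms(1) unfolding theta_function_on_def by blast
  then show ?thesis
    unfolding theta_function_on_def using assms(2) by (intro exI[of _ ts]) auto
qed

lemma theta_function_on_0: "theta_function_on S (\<lambda>_ _ _. 0)"
  unfolding theta_function_on_def by (intro exI[of _ "[]"]) auto

lemma theta_function_on_add:
  assumes "theta_function_on S F" "theta_function_on S G"
  shows "theta_function_on S (\<lambda>z0 z1 q. F z0 z1 q + G z0 z1 q)"
proof -
  obtain ts where ts: "\<And>t f. t \<in> set ts \<Longrightarrow> f \<in> set (factors t) \<Longrightarrow> wf_theta_factor f"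
    "\<And>z0 z1 q w. (z0, z1, q) \<in> S \<Longrightarrow> exp w = q \<Longrightarrow>
      (\<forall>t \<in> set ts. \<forall>f \<in> set (factors t). factor_sign f = -1 \<longrightarrow> factor_theta z0 z1 w f \<noteq> 0) \<and>
      F z0 z1 q = (\<Sum>t\<leftarrow>ts. term_value z0 z1 w t)"
    using assms(1) unfolding theta_function_on_def by blast
  obtain us where us: "\<And>t f. t \<in> set us \<Longrightarrow> f \<in> set (factors t) \<Longrightarrow> wf_theta_factor f"
    "\<And>z0 z1 q w. (z0, z1, q) \<in> S \<Longrightarrow> exp w = q \<Longrightarrow>
      (\<forall>t \<in> set us. \<forall>f \<in> set (factors t). factor_sign f = -1 \<longrightarrow> factor_theta z0 z1 w f \<noteq> 0) \<and>
      G z0 z1 q = (\<Sum>t\<leftarrow>us. term_value z0 z1 w t)"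
    using assms(2) unfolding theta_function_on_def by blast
  show ?thesis
    unfolding theta_function_on_def using ts us by (intro exI[of _ "ts @ us"]) auto
qed

lemma theta_function_on_mult:
  assumes "theta_function_on S F" "theta_function_on S G"
  shows "theta_function_on S (\<lambda>z0 z1 q. F z0 z1 q * G z0 z1 q)"
proof -
  obtain ts where ts: "\<And>t f. t \<in> set ts \<Longrightarrow> f \<in> set (factors t) \<Longrightarrow> wf_theta_factor f"
    "\<And>z0 z1 q w. (z0, z1, q) \<in> S \<Longrightarrow> exp w = q \<Longrightarrow>
      (\<forall>t \<in> set ts. \<forall>f \<in> set (factors t). factor_sign f = -1 \<longrightarrow> factor_theta z0 z1 w f \<noteq> 0) \<and>
      F z0 z1 q = (\<Sum>t\<leftarrow>ts. term_value z0 z1 w t)"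
    using assms(1) unfolding theta_function_on_def by blast
  obtain us where us: "\<And>t f. t \<in> set us \<Longrightarrow> f \<in> set (factors t) \<Longrightarrow> wf_theta_factor f"
    "\<And>z0 z1 q w. (z0, z1, q) \<in> S \<Longrightarrow> exp w = q \<Longrightarrow>
      (\<forall>t \<in> set us. \<forall>f \<in> set (factors t). factor_sign f = -1 \<longrightarrow> factor_theta z0 z1 w f \<noteq> 0) \<and>
      G z0 z1 q = (\<Sum>t\<leftarrow>us. term_value z0 z1 w t)"
    using assms(2) unfolding theta_function_on_def by blast
  have factors: "\<exists>t\<in>set ts \<union> set us. f \<in> set (factors t)"
    if "v \<in> set (concat (map (\<lambda>t. map (term_mult t) us) ts))" "f \<in> set (factors v)" for v f
    using that by (auto simp: term_mult_def)
  show ?thesis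
    unfolding theta_function_on_def
  proof (intro exI[of _ "concat (map (\<lambda>t. map (term_mult t) us) ts)"] conjI ballI, goal_cases)
    case (1 v f)
    then show ?case
      using factors ts(1) us(1) by blast
  next
    case (2 x)
    then show ?case
      using factors ts(2) us(2) by (fastforce simp only: sum_list_term_mult split: prod.splits)
  qed
qed

lemma theta_function_on_monomial:
  assumes "\<And>z0 z1 q. (z0, z1, q) \<in> S \<Longrightarrow> F z0 z1 q = c z0 z1 * q powi e"
  shows "theta_function_on S F"
  unfolding theta_function_on_def
  by (intro exI[of _ "[\<lparr>coeff = c, q_exp = of_int e, factors = []\<rparr>]"])
     (use assms in \<open>auto simp: term_value_def qpow_of_int\<close>)

lemma theta_function_on_const: "theta_function_on S (\<lambda>z0 z1 q. c z0 z1)"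
  by (rule theta_function_on_monomial[of _ _ c 0]) simp

lemma theta_function_on_minus:
  "theta_function_on S F \<Longrightarrow> theta_function_on S (\<lambda>z0 z1 q. - F z0 z1 q)"
  using theta_function_on_mult[OF theta_function_on_const[of S "\<lambda>_ _. -1"], of F] by simp

lemma theta_function_on_diff:
  "theta_function_on S F \<Longrightarrow> theta_function_on S G \<Longrightarrow> theta_function_on S (\<lambda>z0 z1 q. F z0 z1 q - G z0 z1 q)"
  using theta_function_on_add[OF _ theta_function_on_minus, of S F G] by simp

lemma theta_function_on_power:
  "theta_function_on S F \<Longrightarrow> theta_function_on S (\<lambda>z0 z1 q. F z0 z1 q ^ n)"
  by (induction n) (auto intro: theta_function_on_mult theta_function_on_const[of S "\<lambda>_ _. 1"])

lemma theta_function_on_sum: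
  assumes "finite I" "\<And>i. i \<in> I \<Longrightarrow> theta_function_on S (F i)"
  shows "theta_function_on S (\<lambda>z0 z1 q. \<Sum>i\<in>I. F i z0 z1 q)"
  using assms
  by (induction I rule: finite_induct) (auto intro: theta_function_on_add theta_function_on_0)

lemma theta_function_on_jtheta_pos:
  assumes F: "\<And>z0 z1 q. (z0, z1, q) \<in> S \<Longrightarrow> F z0 z1 q = jtheta (c z0 z1 * q powi s) (q ^ k)"
    and k: "k > 0" and c: "\<And>z0 z1. z0 \<noteq> 0 \<Longrightarrow> z1 \<noteq> 0 \<Longrightarrow> c z0 z1 \<noteq> 0"
  shows "theta_function_on S F"
  unfolding theta_function_on_def
proof (intro exI[of _ "[\<lparr>coeff = (\<lambda>_ _. 1), q_exp = 0,
    factors = [\<lparr>arg_const = c, arg_exp = of_int s, nome_exp = k, factor_sign = 1\<rparr>]\<rparr>]"] conjI)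
qed (use assms in \<open>auto simp: term_value_def factor_theta_def qpow_of_int wf_theta_factor_def
      qpow_of_int[of _ 0, simplified]\<close>)

lemma theta_function_on_jtheta_neg:
  assumes F: "\<And>z0 z1 q. (z0, z1, q) \<in> S \<Longrightarrow> F z0 z1 q = inverse (jtheta (c z0 z1 * q powi s) (q ^ k))"
    and nz: "\<And>z0 z1 q. (z0, z1, q) \<in> S \<Longrightarrow> jtheta (c z0 z1 * q powi s) (q ^ k) \<noteq> 0"
    and k: "k > 0" and c: "\<And>z0 z1. z0 \<noteq> 0 \<Longrightarrow> z1 \<noteq> 0 \<Longrightarrow> c z0 z1 \<noteq> 0"
  shows "theta_function_on S F"
  unfolding theta_function_on_def
proof (intro exI[of _ "[\<lparr>coeff = (\<lambda>_ _. 1), q_exp = 0,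
    factors = [\<lparr>arg_const = c, arg_exp = of_int s, nome_exp = k, factor_sign = -1\<rparr>]\<rparr>]"] conjI)
qed (use assms in \<open>auto simp: term_value_def factor_theta_def qpow_of_int wf_theta_factor_def
      qpow_of_int[of _ 0, simplified] power_int_minus\<close>)

text \<open>Splitting the product modulo 3 gives the three factors of
  \<open>jtheta n (n ^ 3)\<close>. This brings the cubed products of the theta quotients into
  admissible form.\<close>

lemma qpoch_inf_self_eq_jtheta:
  assumes "norm n < 1" "n \<noteq> 0"
  shows "qpoch_inf n n = jtheta n (n ^ 3)"
  using qpoch_inf_split[OF assms(1), of 3 n] assms(2)
  by (simp add: jtheta_def numeral_3_eq_3 lessThan_Suc mult_ac)

text \<open>The definition of theta functions only admits the nomes \<open>q ^ k\<close>; the following identity trades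
  the nome \<open>n = (- q) ^ k\<close> for even powers of itself.\<close>

lemma jtheta_even_nomes:
  assumes n: "norm n < 1" "n \<noteq> 0"
  shows "jtheta x n * (jtheta (n ^ 2) (n ^ 6) * jtheta (n ^ 4) (n ^ 12)) =
    jtheta x (n ^ 2) * jtheta (x * n) (n ^ 2) * jtheta n (n ^ 4)"
proof -
  have n2: "norm (n ^ 2) < 1" "n ^ 2 \<noteq> 0" and n4: "norm (n ^ 4) < 1" "n ^ 4 \<noteq> 0"
    using n by (simp_all add: norm_power power_less_one_iff)
  have self: "qpoch_inf (n ^ 2) (n ^ 2) = jtheta (n ^ 2) (n ^ 6)" "qpoch_inf (n ^ 4) (n ^ 4) = jtheta (n ^ 4) (n ^ 12)"
    using qpoch_inf_self_eq_jtheta[OF n2] qpoch_inf_self_eq_jtheta[OF n4] by simp_all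
  have split: "qpoch_inf x n = qpoch_inf x (n ^ 2) * qpoch_inf (x * n) (n ^ 2)" for x
    by (rule qpoch_inf_split_2[OF n(1)])
  have "qpoch_inf n (n ^ 2) = qpoch_inf n (n ^ 4) * qpoch_inf (n ^ 3) (n ^ 4)"
    using qpoch_inf_split_2[OF n2(1), of n] by (simp add: power2_eq_square power3_eq_cube power4_eq_xxxx mult_ac)
  \<comment> \<open>The product over odd exponents, completed by
    \<open>qpoch_inf (n ^ 4) (n ^ 4)\<close>, is itself a theta product.\<close>
  then have odd: "qpoch_inf n (n ^ 2) * qpoch_inf (n ^ 4) (n ^ 4) = jtheta n (n ^ 4)"
    using n by (simp add: jtheta_def power3_eq_cube power4_eq_xxxx mult_ac)
  have nn: "qpoch_inf n n = qpoch_inf n (n ^ 2) * qpoch_inf (n ^ 2) (n ^ 2)"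
    using split[of n] by (simp add: power2_eq_square)
  show ?thesis
    unfolding odd[symmetric] self[symmetric]
    using split[of x] split[of "n / x"] n nn
    by (simp add: jtheta_def power2_eq_square mult_ac)
qed

lemma signed_nome_powers:
  fixes q :: complex
  shows "((- q) ^ k) ^ 2 = q ^ (2 * k)" "((- q) ^ k) ^ 4 = q ^ (4 * k)" "((- q) ^ k) ^ 6 = q ^ (6 * k)"
    "((- q) ^ k) ^ 12 = q ^ (12 * k)"
proof -
  have "((- q) ^ k) ^ (2 * m) = q ^ (2 * m * k)" for m
    by (simp add: mult.commute[of k] flip: power_mult)
  from this[of 1] this[of 2] this[of 3] this[of 6]
  show "((- q) ^ k) ^ 2 = q ^ (2 * k)" "((- q) ^ k) ^ 4 = q ^ (4 * k)" "((- q) ^ k) ^ 6 = q ^ (6 * k)"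
    "((- q) ^ k) ^ 12 = q ^ (12 * k)"
    by simp_all
qed

section \<open>Theta functions whose nome is a power of \<open>- q\<close>\<close>

context
  fixes S :: "(complex \<times> complex \<times> complex) set"
  assumes S: "\<And>z0 z1 q. (z0, z1, q) \<in> S \<Longrightarrow> 0 < norm q \<and> norm q < 1 \<and> z0 \<noteq> 0 \<and> z1 \<noteq> 0"
begin

lemma theta_function_on_minus_q_powi: "theta_function_on S (\<lambda>z0 z1 q. (- q) powi e)"
  by (rule theta_function_on_monomial[of _ _ "\<lambda>_ _. (-1) powi e" e])
     (simp flip: power_int_mult_distrib)

lemma signed_nome:
  assumes "(z0, z1, q) \<in> S" "k > 0"
  shows "norm ((- q) ^ k) < 1" "(- q) ^ k \<noteq> 0"
  using S[OF assms(1)] assms(2) by (auto simp: norm_power power_less_one_iff)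

lemma theta_jtheta_const_factors:
  assumes k: "k > 0"
  shows "theta_function_on S (\<lambda>z0 z1 q. jtheta (((- q) ^ k) ^ 2) (((- q) ^ k) ^ 6))"
    and "theta_function_on S (\<lambda>z0 z1 q. inverse (jtheta (((- q) ^ k) ^ 2) (((- q) ^ k) ^ 6)))"
    and "theta_function_on S (\<lambda>z0 z1 q. jtheta (((- q) ^ k) ^ 4) (((- q) ^ k) ^ 12))"
    and "theta_function_on S (\<lambda>z0 z1 q. inverse (jtheta (((- q) ^ k) ^ 4) (((- q) ^ k) ^ 12)))"
    and "theta_function_on S (\<lambda>z0 z1 q. jtheta ((- q) ^ k) (((- q) ^ k) ^ 4))"
proof -
  have nz: "jtheta (q ^ (m * k)) (q ^ (3 * m * k)) \<noteq> 0" if "(z0, z1, q) \<in> S" "m > 0" for z0 z1 q m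
  proof -
    have "norm (q ^ (m * k)) < 1" "q ^ (m * k) \<noteq> 0"
      using S[OF that(1)] that(2) k by (auto simp: norm_power power_less_one_iff)
    then have "jtheta (q ^ (m * k)) ((q ^ (m * k)) ^ 3) \<noteq> 0"
      using qpoch_inf_self_eq_jtheta[of "q ^ (m * k)"] qpoch_inf_self_nonzero[of "q ^ (m * k)"] by simp
    then show ?thesis
      by (simp only: power_mult[symmetric] mult_ac not_False_eq_True)
  qed
  have pos: "theta_function_on S (\<lambda>z0 z1 q. jtheta (q ^ (m * k)) (q ^ (3 * m * k)))" if "m > 0" for m
    by (rule theta_function_on_jtheta_pos[of _ _ "\<lambda>_ _. 1" "int (m * k)" "3 * m * k"])
       (use that k in \<open>auto simp only: power_int_of_nat mult_1 one_neq_zero nat_0_less_mult_iff zero_less_numeral\<close>)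
  have neg: "theta_function_on S (\<lambda>z0 z1 q. inverse (jtheta (q ^ (m * k)) (q ^ (3 * m * k))))" if "m > 0" for m
    by (rule theta_function_on_jtheta_neg[of _ _ "\<lambda>_ _. 1" "int (m * k)" "3 * m * k"])
       (use that k nz[OF _ that] in
         \<open>auto simp only: power_int_of_nat mult_1 one_neq_zero nat_0_less_mult_iff zero_less_numeral\<close>)
  show "theta_function_on S (\<lambda>z0 z1 q. jtheta (((- q) ^ k) ^ 2) (((- q) ^ k) ^ 6))"
    "theta_function_on S (\<lambda>z0 z1 q. jtheta (((- q) ^ k) ^ 4) (((- q) ^ k) ^ 12))"
    "theta_function_on S (\<lambda>z0 z1 q. inverse (jtheta (((- q) ^ k) ^ 2) (((- q) ^ k) ^ 6)))"
    "theta_function_on S (\<lambda>z0 z1 q. inverse (jtheta (((- q) ^ k) ^ 4) (((- q) ^ k) ^ 12)))"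
    unfolding signed_nome_powers using pos[of 2] pos[of 4] neg[of 2] neg[of 4] by simp_all
  show "theta_function_on S (\<lambda>z0 z1 q. jtheta ((- q) ^ k) (((- q) ^ k) ^ 4))"
    by (rule theta_function_on_jtheta_pos[of _ _ "\<lambda>_ _. (-1) ^ k" "int k" "4 * k"])
       (simp_all add: signed_nome_powers k flip: power_mult_distrib)
qed

text \<open>The signs of \<open>(- q) powi s\<close> and \<open>(- q) ^ k\<close> go into the
  constant, and \<open>jtheta_even_nomes\<close> passes to even nomes. For the inverse, that
  identity shows that a nonzero \<open>F\<close> has nonzero factors, as is demanded of
  denominators.\<close>

lemma theta_function_on_jtheta:
  assumes F: "\<And>z0 z1 q. (z0, z1, q) \<in> S \<Longrightarrow> F z0 z1 q = jtheta (c z0 z1 * (- q) powi s) ((- q) ^ k)"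
    and k: "k > 0" and c: "\<And>z0 z1. z0 \<noteq> 0 \<Longrightarrow> z1 \<noteq> 0 \<Longrightarrow> c z0 z1 \<noteq> 0"
  shows "theta_function_on S F"
    and "(\<And>z0 z1 q. (z0, z1, q) \<in> S \<Longrightarrow> F z0 z1 q \<noteq> 0) \<Longrightarrow> theta_function_on S (\<lambda>z0 z1 q. inverse (F z0 z1 q))"
proof -
  let ?n = "\<lambda>q::complex. (- q) ^ k" and ?x = "\<lambda>z0 z1 q. c z0 z1 * (- q) powi s"
  let ?A = "\<lambda>z0 z1 q. jtheta (?x z0 z1 q) (?n q ^ 2)" and ?B = "\<lambda>z0 z1 q. jtheta (?x z0 z1 q * ?n q) (?n q ^ 2)"
    and ?C = "\<lambda>z0 z1 q. jtheta (?n q) (?n q ^ 4)"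
    and ?D = "\<lambda>z0 z1 q. jtheta (?n q ^ 2) (?n q ^ 6)" and ?E = "\<lambda>z0 z1 q. jtheta (?n q ^ 4) (?n q ^ 12)"
  have eq: "F z0 z1 q * (?D z0 z1 q * ?E z0 z1 q) = ?A z0 z1 q * ?B z0 z1 q * ?C z0 z1 q"
    if "(z0, z1, q) \<in> S" for z0 z1 q
    unfolding F[OF that] by (rule jtheta_even_nomes[OF signed_nome[OF that k]])
  have DE: "?D z0 z1 q \<noteq> 0" "?E z0 z1 q \<noteq> 0" if "(z0, z1, q) \<in> S" for z0 z1 q
  proof -
    have "norm (?n q ^ 2) < 1" "?n q ^ 2 \<noteq> 0" "norm (?n q ^ 4) < 1" "?n q ^ 4 \<noteq> 0"
      using signed_nome[OF that k] by (simp_all add: norm_power power_less_one_iff)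
    then show "?D z0 z1 q \<noteq> 0" "?E z0 z1 q \<noteq> 0"
      using qpoch_inf_self_eq_jtheta[of "?n q ^ 2"] qpoch_inf_self_eq_jtheta[of "?n q ^ 4"]
        qpoch_inf_self_nonzero[of "?n q ^ 2"] qpoch_inf_self_nonzero[of "?n q ^ 4"] by simp_all
  qed
  have Aeq: "?A z0 z1 q = jtheta ((c z0 z1 * (-1) powi s) * q powi s) (q ^ (2 * k))" for z0 z1 q
    by (simp add: signed_nome_powers mult.assoc flip: power_int_mult_distrib)
  have Beq: "?B z0 z1 q = jtheta ((c z0 z1 * (-1) powi s * (-1) ^ k) * q powi (s + int k)) (q ^ (2 * k))"
    if "(z0, z1, q) \<in> S" for z0 z1 q
  proof -
    have "(- q) powi s = (-1) powi s * q powi s" "(- q) ^ k = (-1) ^ k * q ^ k"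
      by (simp_all flip: power_int_mult_distrib power_mult_distrib)
    then show ?thesis
      using S[OF that] unfolding signed_nome_powers(1) by (simp add: power_int_add mult_ac)
  qed
  have A: "theta_function_on S ?A"
    by (rule theta_function_on_jtheta_pos[of _ _ "\<lambda>z0 z1. c z0 z1 * (-1) powi s" s "2 * k"]) (use k c Aeq in auto)
  have B: "theta_function_on S ?B"
    by (rule theta_function_on_jtheta_pos[of _ _ "\<lambda>z0 z1. c z0 z1 * (-1) powi s * (-1) ^ k" "s + int k" "2 * k"])
       (use k c Beq in auto)
  note const = theta_jtheta_const_factors[OF k]
  have "theta_function_on S (\<lambda>z0 z1 q. ?A z0 z1 q * ?B z0 z1 q * ?C z0 z1 q *
      (inverse (?D z0 z1 q) * inverse (?E z0 z1 q)))"
    by (intro theta_function_on_mult A B const)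
  then show "theta_function_on S F"
    by (rule theta_function_on_cong) (use eq DE in \<open>simp add: field_simps\<close>)
  assume nz: "\<And>z0 z1 q. (z0, z1, q) \<in> S \<Longrightarrow> F z0 z1 q \<noteq> 0"
  have ABC: "?A z0 z1 q \<noteq> 0" "?B z0 z1 q \<noteq> 0" "?C z0 z1 q \<noteq> 0" if "(z0, z1, q) \<in> S" for z0 z1 q
    using eq[OF that] nz[OF that] DE[OF that] by auto
  have A': "theta_function_on S (\<lambda>z0 z1 q. inverse (?A z0 z1 q))"
    by (rule theta_function_on_jtheta_neg[of _ _ "\<lambda>z0 z1. c z0 z1 * (-1) powi s" s "2 * k"])
       (use k c Aeq ABC in auto)
  have B': "theta_function_on S (\<lambda>z0 z1 q. inverse (?B z0 z1 q))"
    by (rule theta_function_on_jtheta_neg[of _ _ "\<lambda>z0 z1. c z0 z1 * (-1) powi s * (-1) ^ k" "s + int k" "2 * k"])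
       (use k c Beq ABC in auto)
  have Ceq: "?C z0 z1 q = jtheta ((-1) ^ k * q powi int k) (q ^ (4 * k))" for z0 z1 q :: complex
    by (simp add: signed_nome_powers flip: power_mult_distrib)
  have C': "theta_function_on S (\<lambda>z0 z1 q. inverse (?C z0 z1 q))"
    by (rule theta_function_on_jtheta_neg[of _ _ "\<lambda>_ _. (-1) ^ k" "int k" "4 * k"])
       (use k ABC(3) Ceq in auto)
  have "theta_function_on S (\<lambda>z0 z1 q. ?D z0 z1 q * ?E z0 z1 q *
      (inverse (?A z0 z1 q) * inverse (?B z0 z1 q) * inverse (?C z0 z1 q)))"
    by (intro theta_function_on_mult A' B' C' const)
  then show "theta_function_on S (\<lambda>z0 z1 q. inverse (F z0 z1 q))"
  proof (rule theta_function_on_cong)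
    fix z0 z1 q assume s: "(z0, z1, q) \<in> S"
    from eq[OF s] DE[OF s] have "F z0 z1 q = ?A z0 z1 q * ?B z0 z1 q * ?C z0 z1 q / (?D z0 z1 q * ?E z0 z1 q)"
      by (simp add: field_simps)
    then show "?D z0 z1 q * ?E z0 z1 q * (inverse (?A z0 z1 q) * inverse (?B z0 z1 q) * inverse (?C z0 z1 q)) =
        inverse (F z0 z1 q)"
      by (simp add: field_simps)
  qed
qed

lemma theta_function_on_qpoch:
  assumes k: "k > 0"
  shows "theta_function_on S (\<lambda>z0 z1 q. qpoch_inf ((- q) ^ k) ((- q) ^ k))"
  by (rule theta_function_on_jtheta(1)[of _ "\<lambda>_ _. 1" "int k" "3 * k"])
     (use k signed_nome in \<open>auto simp: qpoch_inf_self_eq_jtheta mult.commute[of 3] simp flip: power_mult\<close>)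

text \<open>The theta functions in the denominators have constant arguments of norm 1 other than 1,
  so they are nonzero for every \<open>q\<close> at once.\<close>

lemma theta_function_on_rank_error:
  assumes M: "M \<ge> 1" and y: "y ^ M = 1" "y \<noteq> 1" "norm y = 1"
  shows "theta_function_on S (\<lambda>z0 z1 q. rank_error (- q) M y)"
proof -
  let ?u = "aux_unit M"
  have y0: "y \<noteq> 0"
    using y by auto
  have j: "theta_function_on S (\<lambda>z0 z1 q. jtheta c (- q))" if "c \<noteq> 0" for c
    by (rule theta_function_on_jtheta(1)[of _ "\<lambda>_ _. c" 0 1]) (use that in auto)
  have j': "theta_function_on S (\<lambda>z0 z1 q. inverse (jtheta c (- q)))"
    if "\<And>z0 z1 q. (z0, z1, q) \<in> S \<Longrightarrow> jtheta c (- q) \<noteq> 0" "c \<noteq> 0" for c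
    by (rule theta_function_on_jtheta(2)[of _ "\<lambda>_ _. c" 0 1]) (use that in auto)
  have nz: "jtheta (y * ?u) (- q) \<noteq> 0" "jtheta y (- q) \<noteq> 0" "jtheta (- ?u) (- q) \<noteq> 0" "jtheta (-1) (- q) \<noteq> 0"
    if "(z0, z1, q) \<in> S" for z0 z1 q
  proof -
    have p: "norm (- q) < 1" "- q \<noteq> 0"
      using S[OF that] by auto
    have "y * ?u \<noteq> (- q) powi n" for n
    proof (rule power_M_not_power_int[OF p M])
      show "(y * ?u) ^ M \<noteq> 1"
        unfolding power_mult_distrib y aux_unit_power[OF M] by (simp add: complex_eq_iff)
    qed (simp add: norm_mult y norm_aux_unit)
    then show "jtheta (y * ?u) (- q) \<noteq> 0"
      using jtheta_eq_0_iff[OF p, of "y * ?u"] y0 aux_unit_nonzero by auto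
    show "jtheta y (- q) \<noteq> 0"
    proof -
      have "y \<noteq> (- q) powi n" for n
        using norm_power_int_eq_1_imp[OF p, of n] y by auto
      then show ?thesis
        using jtheta_eq_0_iff[OF p y0] by auto
    qed
    show "jtheta (- ?u) (- q) \<noteq> 0"
      by (rule aux_theta_nonzero[OF p M])
    show "jtheta (-1) (- q) \<noteq> 0"
      using jtheta_eq_0_iff[OF p, of "-1"] minus_one_not_power[OF p] by auto
  qed
  have u0: "?u \<noteq> 0"
    by (simp add: aux_unit_def)
  have J: "theta_function_on S (\<lambda>z0 z1 q. qpoch_inf (- q) (- q) ^ 3)"
    using theta_function_on_power[OF theta_function_on_qpoch[of 1]] by simp
  show ?thesis
    unfolding rank_error_def divide_inverse inverse_mult_distrib
    by (intro theta_function_on_add theta_function_on_mult J j j' nz) (use u0 y0 nz in auto)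
qed

text \<open>Denominators containing \<open>g z0 z1\<close> are nonzero because the Appell--Lerch sum
  is defined; the others have arguments built from \<open>aux_unit M\<close> or \<open>\<i>\<close>.
  Both projections, to \<open>z0\<close> and to \<open>z1\<close>, serve as
  \<open>g\<close>.\<close>

lemma theta_function_on_dissect_error:
  fixes g :: "complex \<Rightarrow> complex \<Rightarrow> complex"
  assumes M: "M \<ge> 1" and g: "\<And>z0 z1. z0 \<noteq> 0 \<Longrightarrow> z1 \<noteq> 0 \<Longrightarrow> g z0 z1 \<noteq> 0"
    and def: "\<And>z0 z1 q. (z0, z1, q) \<in> S \<Longrightarrow> appell_lerch_defined (dissect_x M (- q) s) ((- q) ^ M\<^sup>2) (g z0 z1)"
  shows "theta_function_on S (\<lambda>z0 z1 q. dissect_error (- q) M s (g z0 z1))"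
proof -
  let ?Q = "\<lambda>q::complex. (- q) ^ M\<^sup>2" and ?x = "\<lambda>q. dissect_x M (- q) s" and ?z = "\<lambda>t q. dissect_z M (- q) s t"
  have M2: "M\<^sup>2 > 0"
    using M by simp
  have p: "norm (- q) < 1" "- q \<noteq> 0" if "(z0, z1, q) \<in> S" for z0 z1 q
    using S[OF that] by auto
  have J: "theta_function_on S (\<lambda>z0 z1 q. qpoch_inf (?Q q) (?Q q) ^ 3)"
    by (rule theta_function_on_power[OF theta_function_on_qpoch[OF M2]])
  have coeff: "theta_function_on S (\<lambda>z0 z1 q. dissect_coeff M (- q) s t)" for t
    unfolding dissect_coeff_def
    by (intro theta_function_on_mult theta_function_on_minus_q_powi theta_function_on_const)
  have z: "theta_function_on S (\<lambda>z0 z1 q. - ?z t q)" for t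
    unfolding dissect_z_def
    by (intro theta_function_on_minus theta_function_on_mult theta_function_on_minus_q_powi theta_function_on_const)
  have j1: "theta_function_on S (\<lambda>z0 z1 q. jtheta (g z0 z1 / ?z t q) (?Q q))" for t
    by (rule theta_function_on_jtheta(1)[of _ "\<lambda>z0 z1. g z0 z1 / (- \<i>)"
          "- (int M * (int t + s) - int (M choose 2))" "M\<^sup>2"])
       (use M2 g in \<open>auto simp: dissect_z_def power_int_minus[of _ "_ - _"] divide_inverse inverse_mult_distrib mult_ac
          simp del: minus_diff_eq\<close>)
  have j2: "theta_function_on S (\<lambda>z0 z1 q. jtheta (?x q * g z0 z1 * ?z t q) (?Q q))" for t
  proof (rule theta_function_on_jtheta(1)[of _ "\<lambda>z0 z1. g z0 z1 * \<i>" "int M * int t" "M\<^sup>2"])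
    fix z0 z1 q assume "(z0, z1, q) \<in> S"
    from dissect_xz[OF p[OF this] M, of s t]
    have "?x q * g z0 z1 * ?z t q = g z0 z1 * \<i> * (- q) powi (int M * int t)"
      by (simp add: mult_ac)
    then show "jtheta (?x q * g z0 z1 * ?z t q) (?Q q) = jtheta (g z0 z1 * \<i> * (- q) powi (int M * int t)) (?Q q)"
      by (simp only:)
  qed (use M2 g in auto)
  have j3: "theta_function_on S (\<lambda>z0 z1 q. inverse (jtheta (?x q * g z0 z1) (?Q q)))"
  proof (rule theta_function_on_jtheta(2)[of _ "\<lambda>z0 z1. - g z0 z1" "int (M choose 2) - int M * s" "M\<^sup>2"])
    fix z0 z1 q assume s: "(z0, z1, q) \<in> S"
    show "jtheta (?x q * g z0 z1) (?Q q) \<noteq> 0"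
      using jtheta_eq_0_iff[OF nome_bounds[OF p[OF s] M], of "?x q * g z0 z1"] def[OF s]
      by (auto simp: appell_lerch_defined_def)
  qed (use M2 g in \<open>auto simp: dissect_x_def mult_ac\<close>)
  have j4: "theta_function_on S (\<lambda>z0 z1 q. inverse (jtheta (?x q * ?z t q) (?Q q)))" for t
  proof (rule theta_function_on_jtheta(2)[of _ "\<lambda>z0 z1. \<i>" "int M * int t" "M\<^sup>2"])
    fix z0 z1 q assume s: "(z0, z1, q) \<in> S"
    show "jtheta (?x q * ?z t q) (?Q q) = jtheta (\<i> * (- q) powi (int M * int t)) (?Q q)"
      by (simp only: dissect_xz[OF p[OF s] M])
    show "jtheta (?x q * ?z t q) (?Q q) \<noteq> 0"
      using jtheta_eq_0_iff[OF nome_bounds[OF p[OF s] M], of "?x q * ?z t q"]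
        dissect_xz_not_power[OF p[OF s] M, of s t] dissect_x_nonzero[OF p[OF s] M] dissect_z_nonzero[OF p[OF s] M]
      by auto
  qed (use M2 in auto)
  have j5: "theta_function_on S (\<lambda>z0 z1 q. inverse (jtheta (g z0 z1) (?Q q)))"
  proof (rule theta_function_on_jtheta(2)[of _ "\<lambda>z0 z1. g z0 z1" 0 "M\<^sup>2"])
    fix z0 z1 q assume s: "(z0, z1, q) \<in> S"
    show "jtheta (g z0 z1) (?Q q) \<noteq> 0"
      using jtheta_eq_0_iff[OF nome_bounds[OF p[OF s] M], of "g z0 z1"] def[OF s]
      by (auto simp: appell_lerch_defined_def)
  qed (use M2 g in auto)
  have j6: "theta_function_on S (\<lambda>z0 z1 q. inverse (jtheta (- aux_unit M) (- q)))"
  proof (rule theta_function_on_jtheta(2)[of _ "\<lambda>z0 z1. - aux_unit M" 0 1])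
    fix z0 z1 q assume s: "(z0, z1, q) \<in> S"
    show "jtheta (- aux_unit M) (- q) \<noteq> 0"
      by (rule aux_theta_nonzero[OF p[OF s] M])
  qed (auto simp: aux_unit_def)
  show ?thesis
    unfolding dissect_error_def divide_inverse[of _ "_ * _"] inverse_mult_distrib
    by (intro theta_function_on_mult theta_function_on_sum coeff z J j1 j2 j3 j4 j5 j6) auto
qed

end

section \<open>The Appell--Lerch form of \<open>D_2\<close>\<close>

theorem theorem7p1:
  fixes M a :: nat
    and x0 x1 :: "complex \<Rightarrow> complex"
    and S :: "(complex \<times> complex \<times> complex) set"
  assumes "M \<ge> 1" and "a < M"
  defines "x0 \<equiv> \<lambda>q. - ((-q) powi (int (M choose 2) - int M * int a))"
    and "x1 \<equiv> \<lambda>q. - ((-q) powi (int (M choose 2) - int M * (int a - 1)))"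
  defines "S \<equiv> {(z0, z1, q). 0 < norm q \<and> norm q < 1 \<and>
                  appell_lerch_defined (x0 q) ((-q) ^ M\<^sup>2) z0 \<and>
                  appell_lerch_defined (x1 q) ((-q) ^ M\<^sup>2) z1}"
  shows "\<exists>T. theta_function_on S T \<and>
           (\<forall>(z0, z1, q) \<in> S.
              D_2 a M q =
                (-q) powi (- int ((a + 1) choose 2)) * appell_lerch (x0 q) ((-q) ^ M\<^sup>2) z0
                - (-q) powi (- int (a choose 2)) * appell_lerch (x1 q) ((-q) ^ M\<^sup>2) z1
                + T z0 z1 q)"
proof -
  note M = assms(1)
  define \<omega> where "\<omega> = cis (2 * pi / real M)"
  \<comment> \<open>The constant 1 for \<open>a = 0\<close> is the extra theta series of the average
    over roots, divided by itself.\<close>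
  define T where "T z0 z1 q = dissect_error (- q) M (int a) z0 - dissect_error (- q) M (int a - 1) z1
    + (if a = 0 then 1 else 0)
    + (\<Sum>k\<in>{1..<M}. (\<omega> ^ k) powi (- int a) * (1 - \<omega> ^ k) * rank_error (- q) M (\<omega> ^ k)) * (1 / of_nat M)"
    for z0 z1 q
  have x: "x0 q = dissect_x M (- q) (int a)" "x1 q = dissect_x M (- q) (int a - 1)" for q
    by (simp_all add: x0_def x1_def dissect_x_def)
  have S: "0 < norm q \<and> norm q < 1 \<and> z0 \<noteq> 0 \<and> z1 \<noteq> 0"
    and def0: "appell_lerch_defined (dissect_x M (- q) (int a)) ((- q) ^ M\<^sup>2) z0"
    and def1: "appell_lerch_defined (dissect_x M (- q) (int a - 1)) ((- q) ^ M\<^sup>2) z1"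
    if "(z0, z1, q) \<in> S" for z0 z1 q
    using that by (auto simp: S_def x appell_lerch_defined_def)
  have \<omega>: "(\<omega> ^ k) ^ M = 1" "norm (\<omega> ^ k) = 1" for k
    using cis_root_power[of M k] M by (simp_all add: \<omega>_def norm_power)
  have \<omega>1: "\<omega> ^ k \<noteq> 1" if "k \<in> {1..<M}" for k
    unfolding \<omega>_def by (rule cis_root_power_neq_1) (use that in auto)
  have "theta_function_on S T"
    unfolding T_def
    by (intro theta_function_on_add theta_function_on_diff theta_function_on_mult theta_function_on_sum
          theta_function_on_const theta_function_on_rank_error[OF S M \<omega>(1) \<omega>1 \<omega>(2)]
          theta_function_on_dissect_error[OF S M, where g = "\<lambda>z0 z1. z0"]
          theta_function_on_dissect_error[OF S M, where g = "\<lambda>z0 z1. z1"] def0 def1) auto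
  moreover have "D_2 a M q = (-q) powi (- int ((a + 1) choose 2)) * appell_lerch (x0 q) ((-q) ^ M\<^sup>2) z0
      - (-q) powi (- int (a choose 2)) * appell_lerch (x1 q) ((-q) ^ M\<^sup>2) z1 + T z0 z1 q"
    if s: "(z0, z1, q) \<in> S" for z0 z1 q
  proof -
    let ?p = "- q" and ?ju = "jtheta (- aux_unit M) (- q)"
    have p: "norm ?p < 1" "?p \<noteq> 0" and q: "norm q < 1" "q \<noteq> 0"
      using S[OF s] by auto
    note ju = aux_theta_nonzero[OF p M]
    let ?c = "\<lambda>k. (\<omega> ^ k) powi (- int a) * (1 - \<omega> ^ k)"
    let ?l = "\<lambda>k. lambert ?p (- aux_unit M) (\<omega> ^ k * aux_unit M)"
    let ?W = "\<lambda>s. \<Sum>t<M. dissect_coeff M ?p s t * lambert (?p ^ M\<^sup>2) (dissect_z M ?p s t)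
      (dissect_x M ?p s * dissect_z M ?p s t)"
    have "D_2 a M q = (\<Sum>k\<in>{1..<M}. (\<omega> ^ k) powi (- int a) * rank_series ?p (\<omega> ^ k)) / of_nat M"
      unfolding \<omega>_def by (rule D_2_eq[OF M q])
    also have "(\<Sum>k\<in>{1..<M}. (\<omega> ^ k) powi (- int a) * rank_series ?p (\<omega> ^ k)) =
        (\<Sum>k\<in>{1..<M}. ?c k * ?l k) / ?ju + (\<Sum>k\<in>{1..<M}. ?c k * rank_error ?p M (\<omega> ^ k))"
      unfolding sum_divide_distrib sum.distrib[symmetric]
    proof (rule sum.cong[OF refl])
      fix k assume "k \<in> {1..<M}"
      show "(\<omega> ^ k) powi (- int a) * rank_series ?p (\<omega> ^ k) = ?c k * ?l k / ?ju + ?c k * rank_error ?p M (\<omega> ^ k)"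
        unfolding rank_series_at_root_of_unity[OF p M \<omega>(1) \<omega>1[OF \<open>k \<in> {1..<M}\<close>] \<omega>(2)]
        by (simp add: ring_distribs mult_ac)
    qed
    \<comment> \<open>The summand \<open>k = 0\<close> has weight
      \<open>1 - \<omega> ^ 0 = 0\<close>; adding it completes the range for the average over all
      roots.\<close>
    also have "(\<Sum>k\<in>{1..<M}. ?c k * ?l k) = (\<Sum>k<M. ?c k * ?l k)"
      by (rule sum.mono_neutral_left) (auto simp: not_le)
    finally have "D_2 a M q = (\<Sum>k<M. ?c k * ?l k) / of_nat M / ?ju +
        (\<Sum>k\<in>{1..<M}. ?c k * rank_error ?p M (\<omega> ^ k)) * (1 / of_nat M)"
      by (simp add: add_divide_distrib mult.commute)
    also have "(\<Sum>k<M. ?c k * ?l k) / of_nat M = ?W (int a) - ?W (int a - 1) + (if a = 0 then ?ju else 0)"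
      unfolding \<omega>_def by (rule lambert_roots_of_unity_average[OF p M assms(2)])
    also have "(?W (int a) - ?W (int a - 1) + (if a = 0 then ?ju else 0)) / ?ju =
        ?W (int a) / ?ju - ?W (int a - 1) / ?ju + (if a = 0 then 1 else 0)"
      using ju by (simp add: add_divide_distrib diff_divide_distrib)
    also have "?W (int a) / ?ju = ?p powi (- ((int a + 1) * int a div 2)) * appell_lerch (x0 q) (?p ^ M\<^sup>2) z0
        + dissect_error ?p M (int a) z0"
      unfolding x by (rule dissected_eq_appell_lerch[OF p M def0[OF s]])
    also have "?W (int a - 1) / ?ju = ?p powi (- ((int a - 1 + 1) * (int a - 1) div 2)) * appell_lerch (x1 q) (?p ^ M\<^sup>2) z1
        + dissect_error ?p M (int a - 1) z1"
      unfolding x by (rule dissected_eq_appell_lerch[OF p M def1[OF s]])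
    \<comment> \<open>The exponents split off by the dissection at \<open>s = a\<close> and
      \<open>s = a - 1\<close> are the two binomial coefficients of the statement.\<close>
    also have "(int a + 1) * int a div 2 = int ((a + 1) choose 2)"
      using two_choose_two[of "a + 1"] by (simp add: algebra_simps)
    also have "(int a - 1 + 1) * (int a - 1) div 2 = int (a choose 2)"
      using two_choose_two[of a] by simp
    finally show ?thesis
      by (simp add: T_def)
  qed
  ultimately show ?thesis
    by blast
qed

end
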